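(* A state $\rho$ is quantum Schnorr random if and only if for every computable measure machine $C$ and every $\epsilon>0$ there is a constant $d>0$ such that $QK^{\epsilon}_C(\rho_n)>n-d$ for all $n$.
   Context: A computable measure machine is a prefix-free Turing machine $C$ whose domain has computable Lebesgue measure $\sum_{\pi\in\operatorname{dom}(C)}2^{-|\pi|}$. Outputs of machines are interpreted as finite sets of vectors with complex algebraic entries via a fixed canonical effective indexing; $C(\pi)\downarrow=F$ means $C$ on input $\pi$ halts with output the code of $F$. $\mathbb{C}^{2^n}_{alg}$ denotes the vectors in $\mathbb{C}^{2^n}$ with complex algebraic entries. Logarithms are base 2. For a density matrix $\tau$ on $\mathbb{C}^{2^n}$ write $|\tau|=n$, and for $\epsilon>0$ define $QK^{\epsilon}_C(\tau)=\inf\{|\pi|+\log|F| : C(\pi)\downarrow=F,\ F \text{ an orthonormal subset of } \mathbb{C}^{2^{|\tau|}}_{alg},\ \sum_{v\in F}\langle v|\tau|v\rangle>\epsilon\}$, with $\inf\emptyset=\infty$. A state is a sequence $\rho=(\rho_n)_{n\in\mathbb{N}}$ of density matrices $\rho_n$ on $\mathbb{C}^{2^n}$ such that the partial trace of $\rho_n$ over the last qubit equals $\rho_{n-1}$. A special projection is a Hermitian projection matrix with complex algebraic entries. For a special projection $S$ on $\mathbb{C}^{2^n}$ put $\tau(S)=2^{-n}\operatorname{Tr}(S)$ and $\rho(S)=\operatorname{Tr}(\rho_nS)$. A strong Solovay test is a computable sequence $(S^m)_m$ of special projections with $\sum_m\tau(S^m)<\infty$; $\rho$ fails it at level $\epsilon>0$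 if $\rho(S^m)>\epsilon$ for infinitely many $m$, and passes it if it fails it at no level $\epsilon>0$. A quantum Schnorr test is a strong Solovay test $(S^m)_m$ such that $\sum_m\tau(S^m)$ is a computable real number. A state is quantum Schnorr random if it passes every quantum Schnorr test. *)

theory Defs
  imports "HOL-Analysis.Infinite_Sum" "HOL-Library.Nat_Bijection" "HOL-Library.Sublist"
    "HOL-Computational_Algebra.Polynomial" "Jordan_Normal_Form.Schur_Decomposition"
begin

datatype recf = Zero | Succ | Proj nat | Comp recf "recf list" | Prim recf recf | Mini recf

inductive reval :: "recf \<Rightarrow> nat list \<Rightarrow> nat \<Rightarrow> bool" where
  reval_zero: "reval Zero xs 0"
| reval_succ: "reval Succ (x # xs) (Suc x)"
| reval_proj: "i < length xs \<Longrightarrow> reval (Proj i) xs (xs ! i)"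
| reval_comp: "list_all2 (\<lambda>g y. reval g xs y) gs ys \<Longrightarrow> reval f ys z \<Longrightarrow> reval (Comp f gs) xs z"
| reval_prim0: "reval f xs y \<Longrightarrow> reval (Prim f g) (0 # xs) y"
| reval_primS: "reval (Prim f g) (n # xs) y \<Longrightarrow> reval g (n # y # xs) z
                 \<Longrightarrow> reval (Prim f g) (Suc n # xs) z"
| reval_mini: "reval f (n # xs) 0 \<Longrightarrow> (\<forall>m<n. \<exists>y. reval f (m # xs) (Suc y))
                 \<Longrightarrow> reval (Mini f) xs n"

definition partial_computable :: "(nat \<Rightarrow> nat option) \<Rightarrow> bool" where
  "partial_computable h \<longleftrightarrow> (\<exists>f. \<forall>x y. h x = Some y \<longleftrightarrow> reval f [x] y)"

definition computable :: "(nat \<Rightarrow> nat) \<Rightarrow> bool" where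
  "computable g \<longleftrightarrow> partial_computable (\<lambda>x. Some (g x))"

text \<open>Bijective coding of binary strings by naturals.\<close>
fun bl_encode :: "bool list \<Rightarrow> nat" where
  "bl_encode [] = 0"
| "bl_encode (b # bs) = 2 * bl_encode bs + (if b then 2 else 1)"

definition rat_decode :: "nat \<Rightarrow> real" where
  "rat_decode c = (case prod_decode c of (a, b) \<Rightarrow> real_of_int (int_decode a) / real (Suc b))"

definition computable_real :: "real \<Rightarrow> bool" where
  "computable_real x \<longleftrightarrow> (\<exists>g. computable g \<and> (\<forall>k. \<bar>rat_decode (g k) - x\<bar> \<le> (1/2) ^ k))"

text \<open>Complex algebraic numbers: code (p,k) denotes the k-th root (in lexicographic
  order of (Re, Im)) of the nonzero integer polynomial coded by p; defaults are 0.\<close>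
definition clex_less :: "complex \<Rightarrow> complex \<Rightarrow> bool" where
  "clex_less w z \<longleftrightarrow> Re w < Re z \<or> (Re w = Re z \<and> Im w < Im z)"

definition int_poly_decode :: "nat \<Rightarrow> complex poly" where
  "int_poly_decode c = Poly (map (\<lambda>a. of_int (int_decode a)) (list_decode c))"

definition alg_decode :: "nat \<Rightarrow> complex" where
  "alg_decode c = (case prod_decode c of (pc, k) \<Rightarrow>
     (let p = int_poly_decode pc;
          P = (\<lambda>z. poly p z = 0 \<and> card {w. poly p w = 0 \<and> clex_less w z} = k)
      in if p \<noteq> 0 \<and> (\<exists>z. P z) then (THE z. P z) else 0))"

definition vec_decode :: "nat \<Rightarrow> complex vec" where
  "vec_decode c = vec_of_list (map alg_decode (list_decode c))"

definition vset_decode :: "nat \<Rightarrow> complex vec set" where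
  "vset_decode c = vec_decode ` set_decode c"

definition mat_decode :: "nat \<Rightarrow> nat \<times> complex mat" where
  "mat_decode c = (case prod_decode c of (n, lc) \<Rightarrow>
     (let L = list_decode lc in
      (n, mat (2^n) (2^n) (\<lambda>(i, j). if i * 2^n + j < length L then alg_decode (L ! (i * 2^n + j)) else 0))))"

definition prefix_free_machine :: "(bool list \<Rightarrow> nat option) \<Rightarrow> bool" where
  "prefix_free_machine C \<longleftrightarrow>
     (\<exists>f. \<forall>\<pi> y. C \<pi> = Some y \<longleftrightarrow> reval f [bl_encode \<pi>] y) \<and>
     (\<forall>\<pi>\<in>dom C. \<forall>\<sigma>\<in>dom C. prefix \<pi> \<sigma> \<longrightarrow> \<pi> = \<sigma>)"

definition machine_measure :: "(bool list \<Rightarrow> nat option) \<Rightarrow> real" where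
  "machine_measure C = (\<Sum>\<^sub>\<infinity>\<pi>\<in>dom C. (1/2) ^ length \<pi>)"

definition computable_measure_machine :: "(bool list \<Rightarrow> nat option) \<Rightarrow> bool" where
  "computable_measure_machine C \<longleftrightarrow> prefix_free_machine C \<and> computable_real (machine_measure C)"

definition mtrace :: "complex mat \<Rightarrow> complex" where
  "mtrace A = (\<Sum>i<dim_row A. A $$ (i, i))"

definition density_matrix :: "nat \<Rightarrow> complex mat \<Rightarrow> bool" where
  "density_matrix n \<tau> \<longleftrightarrow> \<tau> \<in> carrier_mat (2^n) (2^n) \<and> mat_adjoint \<tau> = \<tau> \<and>
     (\<forall>v\<in>carrier_vec (2^n). 0 \<le> Re ((\<tau> *\<^sub>v v) \<bullet>c v)) \<and> mtrace \<tau> = 1"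

text \<open>Partial trace over the last qubit (the last qubit is the least significant bit
  of the basis index).\<close>
definition ptrace_last :: "complex mat \<Rightarrow> complex mat" where
  "ptrace_last A = mat (dim_row A div 2) (dim_col A div 2)
     (\<lambda>(i, j). A $$ (2 * i, 2 * j) + A $$ (2 * i + 1, 2 * j + 1))"

definition is_state :: "(nat \<Rightarrow> complex mat) \<Rightarrow> bool" where
  "is_state \<rho> \<longleftrightarrow> (\<forall>n. density_matrix n (\<rho> n)) \<and> (\<forall>n. ptrace_last (\<rho> (Suc n)) = \<rho> n)"

definition orthonormal_set :: "nat \<Rightarrow> complex vec set \<Rightarrow> bool" where
  "orthonormal_set n F \<longleftrightarrow> F \<subseteq> carrier_vec (2^n) \<and>
     (\<forall>v\<in>F. \<forall>w\<in>F. v \<bullet>c w = (if v = w then 1 else 0))"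

definition QK :: "(bool list \<Rightarrow> nat option) \<Rightarrow> real \<Rightarrow> nat \<Rightarrow> complex mat \<Rightarrow> ereal" where
  "QK C \<epsilon> n \<tau> = Inf {ereal (real (length \<pi>) + log 2 (real (card F))) | \<pi> F.
      (\<exists>c. C \<pi> = Some c \<and> F = vset_decode c) \<and> orthonormal_set n F \<and>
      (\<forall>v\<in>F. \<forall>i<dim_vec v. algebraic (v $ i)) \<and>
      (\<Sum>v\<in>F. Re ((\<tau> *\<^sub>v v) \<bullet>c v)) > \<epsilon>}"

definition special_projection :: "nat \<Rightarrow> complex mat \<Rightarrow> bool" where
  "special_projection n S \<longleftrightarrow> S \<in> carrier_mat (2^n) (2^n) \<and> mat_adjoint S = S \<and> S * S = S \<and>
     (\<forall>i<2^n. \<forall>j<2^n. algebraic (S $$ (i, j)))"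

definition tau_val :: "nat \<times> complex mat \<Rightarrow> real" where
  "tau_val T = Re (mtrace (snd T)) / 2 ^ fst T"

definition rho_val :: "(nat \<Rightarrow> complex mat) \<Rightarrow> nat \<times> complex mat \<Rightarrow> real" where
  "rho_val \<rho> T = Re (mtrace (\<rho> (fst T) * snd T))"

definition strong_solovay_test :: "(nat \<Rightarrow> nat \<times> complex mat) \<Rightarrow> bool" where
  "strong_solovay_test T \<longleftrightarrow>
     (\<exists>g. computable g \<and> (\<forall>m. mat_decode (g m) = T m)) \<and>
     (\<forall>m. special_projection (fst (T m)) (snd (T m))) \<and>
     summable (\<lambda>m. tau_val (T m))"

definition quantum_schnorr_test :: "(nat \<Rightarrow> nat \<times> complex mat) \<Rightarrow> bool" where
  "quantum_schnorr_test T \<longleftrightarrow> strong_solovay_test T \<and> computable_real (\<Sum>m. tau_val (T m))"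

definition fails_at :: "(nat \<Rightarrow> complex mat) \<Rightarrow> (nat \<Rightarrow> nat \<times> complex mat) \<Rightarrow> real \<Rightarrow> bool" where
  "fails_at \<rho> T \<epsilon> \<longleftrightarrow> (\<exists>\<^sub>\<infinity>m. rho_val \<rho> (T m) > \<epsilon>)"

definition passes :: "(nat \<Rightarrow> complex mat) \<Rightarrow> (nat \<Rightarrow> nat \<times> complex mat) \<Rightarrow> bool" where
  "passes \<rho> T \<longleftrightarrow> \<not> (\<exists>\<epsilon>>0. fails_at \<rho> T \<epsilon>)"

definition quantum_schnorr_random :: "(nat \<Rightarrow> complex mat) \<Rightarrow> bool" where
  "quantum_schnorr_random \<rho> \<longleftrightarrow> (\<forall>T. quantum_schnorr_test T \<longrightarrow> passes \<rho> T)"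

end

(* A machine gives a test: when a program p is seen to halt with an orthonormal set F in dimension 2^n
   and |F| / 2^n is at most 2^-|p|, the projection onto the span of F joins the test. The trace sum is
   dominated term by term by the computable measure of the domain, so it is computable; and
   QK(rho_n) <= n - d for all d means that arbitrarily light members of the test are large on rho.
   Conversely, cut a test into blocks whose tails are at most 8^-k, multiply the weights of the k-th
   block by 2^k, and let a Shannon-Fano-Elias code of these weights describe orthonormal bases of the
   projections: the bases in the k-th block then have complexity at most n - k + 2.

   All of this needs exact computation with coded algebraic numbers. An approximation of the roots of an
   integer polynomial can be sorted lexicographically, and polynomial identities between roots can be
   decided, once nonzero values are known to stay away from 0. The bound comes from integer matrices:
   if a * x is an eigenvalue of an integer matrix, then the lowest nonzero coefficient of its
   characteristic polynomial is an integer, hence at least 1 in absolute value. *)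
theory Submission
  imports Defs
begin

section \<open>Recursive functions\<close>

text \<open>The constants 8 and 2 hide a trade-off. A tail of 8^-k absorbs a factor 4^k and still
  leaves the summable 2^-k. Of this factor only 2^k enters the code lengths; the other 2^k makes the
  weights of late blocks vanish at a known rate, since boundedness alone would not make the measure
  of the machine computable. Likewise, in the other direction, it is the domination term by term
  that carries a modulus of convergence from the domain of the machine to the test. The obstacle in
  the arithmetic is that a code names a root by its rank in the order of (Re, Im), and equality of
  two real parts is never visible in an approximation. A gap below which no nonzero difference can
  fall turns it into a finite check. After that hardly any algorithm is written down: results are
  found by unbounded search for a value together with a certificate that is checked on integers. The
  search ends because every algebraic number has a code and every special projection has an
  orthonormal basis with algebraic entries.\<close>

lemma reval_Zero_iff: "reval Zero xs y \<longleftrightarrow> y = 0"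
  by (auto elim: reval.cases intro: reval.intros)

lemma reval_Succ_iff: "reval Succ xs y \<longleftrightarrow> xs \<noteq> [] \<and> y = Suc (hd xs)"
  by (cases xs) (auto elim: reval.cases intro: reval.intros)

lemma reval_Proj_iff: "reval (Proj i) xs y \<longleftrightarrow> i < length xs \<and> y = xs ! i"
  by (auto elim: reval.cases intro: reval.intros)

lemma reval_Comp_iff:
  "reval (Comp f gs) xs z \<longleftrightarrow> (\<exists>ys. list_all2 (\<lambda>g y. reval g xs y) gs ys \<and> reval f ys z)"
  by (auto elim: reval.cases intro: reval.intros)

lemma reval_Prim_Nil_iff: "reval (Prim f g) [] y \<longleftrightarrow> False"
  by (auto elim: reval.cases)

lemma reval_Prim_0_iff: "reval (Prim f g) (0 # xs) y \<longleftrightarrow> reval f xs y"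
  by (auto elim: reval.cases intro: reval.intros)

lemma reval_Prim_Suc_iff:
  "reval (Prim f g) (Suc n # xs) z \<longleftrightarrow> (\<exists>y. reval (Prim f g) (n # xs) y \<and> reval g (n # y # xs) z)"
  by (auto elim: reval.cases intro: reval.intros)

lemma reval_Mini_iff:
  "reval (Mini f) xs n \<longleftrightarrow> reval f (n # xs) 0 \<and> (\<forall>m<n. \<exists>y. reval f (m # xs) (Suc y))"
  by (auto elim: reval.cases intro: reval.intros)

lemma reval_det: "reval f xs y \<Longrightarrow> reval f xs z \<Longrightarrow> y = z"
proof (induction f arbitrary: xs y z)
  case (Comp f gs)
  from Comp.prems obtain ys zs where ys: "list_all2 (\<lambda>g y. reval g xs y) gs ys" "reval f ys y"
    and zs: "list_all2 (\<lambda>g y. reval g xs y) gs zs" "reval f zs z"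
    unfolding reval_Comp_iff by blast
  have "ys = zs"
  proof (rule nth_equalityI)
    show "ys ! i = zs ! i" if "i < length ys" for i
      using that ys(1) zs(1) Comp.IH(2)[of "gs ! i" xs] by (auto simp: list_all2_conv_all_nth)
  qed (use ys zs in \<open>auto simp: list_all2_conv_all_nth\<close>)
  with ys zs Comp.IH(1) show ?case by blast
next
  case (Prim f g)
  show ?case
  proof (cases xs)
    case Nil
    with Prim.prems show ?thesis by (simp add: reval_Prim_Nil_iff)
  next
    case (Cons n xs')
    have "reval (Prim f g) (n # xs') y \<Longrightarrow> reval (Prim f g) (n # xs') z \<Longrightarrow> y = z" for y z
    proof (induction n arbitrary: y z)
      case 0 thus ?case using Prim.IH(1) unfolding reval_Prim_0_iff by blast
    next
      case (Suc n) thus ?case using Prim.IH(2) unfolding reval_Prim_Suc_iff by metis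
    qed
    with Prim.prems Cons show ?thesis by blast
  qed
next
  case (Mini f)
  have a: "reval f (y # xs) 0" "reval f (z # xs) 0"
    and b: "\<forall>m<y. \<exists>k. reval f (m # xs) (Suc k)" "\<forall>m<z. \<exists>k. reval f (m # xs) (Suc k)"
    using Mini.prems unfolding reval_Mini_iff by blast+
  show ?case
  proof (rule linorder_cases[of y z])
    assume "y < z" then obtain k where "reval f (y # xs) (Suc k)" using b by blast
    with a Mini.IH show ?thesis by blast
  next
    assume "z < y" then obtain k where "reval f (z # xs) (Suc k)" using b by blast
    with a Mini.IH show ?thesis by blast
  qed
qed (auto simp: reval_Zero_iff reval_Succ_iff reval_Proj_iff)

text \<open>Only arguments of length n are constrained. Elsewhere f is arbitrary, so identities that
  hold just for lists of that length can be used through \<open>recursive_cong\<close>.\<close>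

definition recursive :: "nat \<Rightarrow> (nat list \<Rightarrow> nat) \<Rightarrow> bool" where
  "recursive n f \<longleftrightarrow> (\<exists>r. \<forall>xs. length xs = n \<longrightarrow> reval r xs (f xs))"

lemma recursive_cong:
  "recursive n f \<Longrightarrow> (\<And>xs. length xs = n \<Longrightarrow> f xs = g xs) \<Longrightarrow> recursive n g"
  unfolding recursive_def by metis

lemma recursive_nth: "i < n \<Longrightarrow> recursive n (\<lambda>xs. xs ! i)"
  unfolding recursive_def by (rule exI[of _ "Proj i"]) (auto intro: reval.intros)

lemma recursive_comp:
  assumes "recursive (length gs) f" "\<And>g. g \<in> set gs \<Longrightarrow> recursive n g"
  shows "recursive n (\<lambda>xs. f (map (\<lambda>g. g xs) gs))"
proof -
  obtain r where r: "\<And>xs. length xs = length gs \<Longrightarrow> reval r xs (f xs)"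
    using assms(1) unfolding recursive_def by blast
  have "\<forall>g\<in>set gs. \<exists>s. \<forall>xs. length xs = n \<longrightarrow> reval s xs (g xs)"
    using assms(2) unfolding recursive_def by blast
  then obtain s where s: "\<And>g xs. g \<in> set gs \<Longrightarrow> length xs = n \<Longrightarrow> reval (s g) xs (g xs)"
    by metis
  show ?thesis unfolding recursive_def
    by (rule exI[of _ "Comp r (map s gs)"])
      (auto intro!: reval_comp[OF _ r] simp: list_all2_conv_all_nth s)
qed

lemma recursive_comp1:
  "recursive (Suc 0) (\<lambda>xs. F (xs ! 0)) \<Longrightarrow> recursive n g \<Longrightarrow> recursive n (\<lambda>xs. F (g xs))"
  using recursive_comp[of "[g]" "\<lambda>xs. F (xs ! 0)" n] by simp

lemma recursive_comp2:
  "recursive (Suc (Suc 0)) (\<lambda>xs. F (xs ! 0) (xs ! Suc 0)) \<Longrightarrow> recursive n g \<Longrightarrow> recursive n h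
    \<Longrightarrow> recursive n (\<lambda>xs. F (g xs) (h xs))"
  using recursive_comp[of "[g, h]" "\<lambda>xs. F (xs ! 0) (xs ! 1)" n]
  by auto

lemma recursive_Suc: "recursive n g \<Longrightarrow> recursive n (\<lambda>xs. Suc (g xs))"
proof (rule recursive_comp1[of Suc])
  have "reval Succ xs (Suc (xs ! 0))" if "length xs = Suc 0" for xs
    using that by (cases xs) (auto intro: reval.intros)
  thus "recursive (Suc 0) (\<lambda>xs. Suc (xs ! 0))" unfolding recursive_def by blast
qed

lemma recursive_const: "recursive n (\<lambda>_. k)"
proof (induction k)
  case 0 show ?case unfolding recursive_def by (rule exI[of _ Zero]) (auto intro: reval.intros)
qed (rule recursive_Suc)

text \<open>\<open>Prim\<close> hands its step function the counter, the previous value and then the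
  parameters; hence the two entries in front and \<open>drop 2\<close>.\<close>

lemma recursive_prim:
  assumes "recursive n f" "recursive (Suc (Suc n)) (\<lambda>xs. g (xs ! 0) (xs ! 1) (drop 2 xs))"
  shows "recursive (Suc n) (\<lambda>xs. rec_nat (f (tl xs)) (\<lambda>k y. g k y (tl xs)) (xs ! 0))"
proof -
  obtain r where r: "\<And>xs. length xs = n \<Longrightarrow> reval r xs (f xs)"
    using assms(1) unfolding recursive_def by blast
  obtain s where s: "\<And>xs. length xs = Suc (Suc n) \<Longrightarrow> reval s xs (g (xs ! 0) (xs ! 1) (drop 2 xs))"
    using assms(2) unfolding recursive_def by blast
  have "reval (Prim r s) (k # xs) (rec_nat (f xs) (\<lambda>k y. g k y xs) k)" if l: "length xs = n" for k xs
  proof (induction k)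
    case 0 show ?case using r[OF l] by (auto intro: reval.intros)
  next
    case (Suc k)
    show ?case using s[of "k # rec_nat (f xs) (\<lambda>k y. g k y xs) k # xs"] l Suc
      by (auto intro: reval.intros simp: numeral_2_eq_2)
  qed
  thus ?thesis unfolding recursive_def
    by (intro exI[of _ "Prim r s"]) (auto simp: length_Suc_conv)
qed

lemma recursive_Least:
  assumes "recursive (Suc n) f" "\<And>xs. length xs = n \<Longrightarrow> \<exists>k. f (k # xs) = 0"
  shows "recursive n (\<lambda>xs. LEAST k. f (k # xs) = 0)"
proof -
  obtain r where r: "\<And>xs. length xs = Suc n \<Longrightarrow> reval r xs (f xs)"
    using assms(1) unfolding recursive_def by blast
  have "reval (Mini r) xs (LEAST k. f (k # xs) = 0)" if l: "length xs = n" for xs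
  proof -
    have "f ((LEAST k. f (k # xs) = 0) # xs) = 0" using assms(2)[OF l] by (rule LeastI_ex)
    moreover have "\<exists>y. reval r (m # xs) (Suc y)" if "m < (LEAST k. f (k # xs) = 0)" for m
      using r[of "m # xs"] l not_less_Least[OF that] by (cases "f (m # xs)") auto
    ultimately show ?thesis unfolding reval_Mini_iff
      using r[of "(LEAST k. f (k # xs) = 0) # xs"] l by simp
  qed
  thus ?thesis unfolding recursive_def by blast
qed

section \<open>Arithmetic and the Cantor pairing as recursive functions\<close>

lemma recursive_add: "recursive n f \<Longrightarrow> recursive n g \<Longrightarrow> recursive n (\<lambda>xs. f xs + g xs)"
proof (rule recursive_comp2[of "(+)"])
  have e: "rec_nat b (\<lambda>_. Suc) a = a + b" for a b :: nat by (induction a) auto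
  have "recursive (Suc (Suc 0)) (\<lambda>xs. rec_nat (tl xs ! 0) (\<lambda>k y. Suc y) (xs ! 0))"
    by (rule recursive_prim) (auto intro!: recursive_nth recursive_Suc)
  thus "recursive (Suc (Suc 0)) (\<lambda>xs. xs ! 0 + xs ! Suc 0)"
    by (rule recursive_cong) (auto simp: e length_Suc_conv)
qed

lemma recursive_pred: "recursive n f \<Longrightarrow> recursive n (\<lambda>xs. f xs - 1)"
proof (rule recursive_comp1[of "\<lambda>x. x - 1"])
  have e: "rec_nat 0 (\<lambda>k _. k) a = a - 1" for a :: nat by (induction a) auto
  have "recursive (Suc 0) (\<lambda>xs. rec_nat 0 (\<lambda>k y. k) (xs ! 0))"
    by (rule recursive_prim) (auto intro!: recursive_nth recursive_const)
  thus "recursive (Suc 0) (\<lambda>xs. xs ! 0 - 1)"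
    by (rule recursive_cong) (auto simp: e)
qed

lemma recursive_diff: "recursive n f \<Longrightarrow> recursive n g \<Longrightarrow> recursive n (\<lambda>xs. f xs - g xs)"
\<comment> \<open>\<open>Prim\<close> recurses on its first argument, so the subtrahend has to come
  first.\<close>
proof (rule recursive_comp2[of "\<lambda>b a. a - b", rotated])
  have e: "rec_nat a (\<lambda>_ y. y - Suc 0) b = a - b" for a b :: nat by (induction b) auto
  have "recursive (Suc (Suc 0)) (\<lambda>xs. rec_nat (tl xs ! 0) (\<lambda>k y. y - 1) (xs ! 0))"
    by (rule recursive_prim) (auto intro!: recursive_nth recursive_pred[simplified])
  thus "recursive (Suc (Suc 0)) (\<lambda>xs. xs ! Suc 0 - xs ! 0)"
    by (rule recursive_cong) (auto simp: e length_Suc_conv)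
qed

lemma recursive_mult: "recursive n f \<Longrightarrow> recursive n g \<Longrightarrow> recursive n (\<lambda>xs. f xs * g xs)"
proof (rule recursive_comp2[of "(*)"])
  have e: "rec_nat 0 (\<lambda>_ y. y + b) a = a * b" for a b :: nat by (induction a) auto
  have "recursive (Suc (Suc 0)) (\<lambda>xs. rec_nat 0 (\<lambda>k y. y + tl xs ! 0) (xs ! 0))"
    by (rule recursive_prim[of "Suc 0" "\<lambda>_. 0" "\<lambda>k y xs. y + xs ! 0"])
      (auto intro!: recursive_nth[of 2, THEN recursive_cong] recursive_nth recursive_add recursive_const simp: length_Suc_conv)
  thus "recursive (Suc (Suc 0)) (\<lambda>xs. xs ! 0 * xs ! Suc 0)"
    by (rule recursive_cong) (auto simp: e length_Suc_conv)
qed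

lemma recursive_triangle: "recursive n f \<Longrightarrow> recursive n (\<lambda>xs. triangle (f xs))"
proof (rule recursive_comp1[of triangle])
  have e: "rec_nat 0 (\<lambda>k y. y + Suc k) a = triangle a" for a :: nat by (induction a) auto
  have "recursive (Suc 0) (\<lambda>xs. rec_nat 0 (\<lambda>k y. y + Suc k) (xs ! 0))"
    by (rule recursive_prim) (auto intro!: recursive_nth recursive_const recursive_add recursive_Suc
        simp del: add_Suc_right)
  thus "recursive (Suc 0) (\<lambda>xs. triangle (xs ! 0))"
    by (simp only: e)
qed

text \<open>Inverts the Cantor pairing by search: the diagonal a + b of n is the least k whose next
  triangular number exceeds n. The comparison is written as a truncated difference being 0, the form
  that \<open>recursive_Least\<close> handles.\<close>

lemma prod_decode_conv:
  defines "t \<equiv> \<lambda>n. LEAST k. Suc n - triangle (Suc k) = 0"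
  shows "fst (prod_decode n) = n - triangle (t n)"
    "snd (prod_decode n) = t n - (n - triangle (t n))"
proof -
  obtain a b where ab: "prod_decode n = (a, b)" by fastforce
  hence n: "n = triangle (a + b) + a"
    using prod_decode_inverse[of n] by (simp add: prod_encode_def)
  have mono: "triangle i \<le> triangle j" if "i \<le> j" for i j
    using that by (induction rule: dec_induct) auto
  have "t n = a + b" unfolding t_def
  proof (rule Least_equality)
    fix k assume "Suc n - triangle (Suc k) = 0"
    hence "n < triangle (Suc k)" by simp
    thus "a + b \<le> k" using mono[of "Suc k" "a + b"] n by linarith
  qed (simp add: n)
  thus "fst (prod_decode n) = n - triangle (t n)" "snd (prod_decode n) = t n - (n - triangle (t n))"
    using n ab by auto
qed

lemma recursive_prod_decode:
  assumes "recursive n f"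
  shows "recursive n (\<lambda>xs. fst (prod_decode (f xs)))" "recursive n (\<lambda>xs. snd (prod_decode (f xs)))"
proof -
  have le: "k \<le> triangle k" for k by (induction k) auto
  have t: "recursive (Suc 0) (\<lambda>xs. LEAST k. (\<lambda>xs. Suc (xs ! 1) - triangle (Suc (xs ! 0))) (k # xs) = 0)"
  proof (rule recursive_Least)
    show "\<exists>k. Suc ((k # xs) ! 1) - triangle (Suc ((k # xs) ! 0)) = 0" for xs
      by (rule exI[of _ "xs ! 0"]) (use le in auto)
  qed (intro recursive_diff recursive_Suc recursive_triangle recursive_nth; simp)
  hence t: "recursive (Suc 0) (\<lambda>xs. LEAST k. Suc (xs ! 0) - triangle (Suc k) = 0)"
    by (simp only: nth_Cons_0 One_nat_def nth_Cons_Suc)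
  show "recursive n (\<lambda>xs. fst (prod_decode (f xs)))" "recursive n (\<lambda>xs. snd (prod_decode (f xs)))"
    unfolding prod_decode_conv
    by (intro recursive_diff recursive_triangle assms recursive_comp1[OF t assms])+
qed

lemma recursive_prod_encode:
  "recursive n f \<Longrightarrow> recursive n g \<Longrightarrow> recursive n (\<lambda>xs. prod_encode (f xs, g xs))"
  unfolding prod_encode_def case_prod_conv by (intro recursive_add recursive_triangle)

lemma computable_iff: "computable f \<longleftrightarrow> recursive (Suc 0) (\<lambda>xs. f (xs ! 0))"
proof
  assume "computable f"
  then obtain r where "\<forall>x. reval r [x] (f x)"
    unfolding computable_def partial_computable_def by auto
  thus "recursive (Suc 0) (\<lambda>xs. f (xs ! 0))"
    unfolding recursive_def by (intro exI[of _ r]) (auto simp: length_Suc_conv)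
next
  assume "recursive (Suc 0) (\<lambda>xs. f (xs ! 0))"
  then obtain r where r: "\<And>xs. length xs = Suc 0 \<Longrightarrow> reval r xs (f (xs ! 0))"
    unfolding recursive_def by blast
  have r: "reval r [x] (f x)" for x using r[of "[x]"] by simp
  thus "computable f" unfolding computable_def partial_computable_def
    by (intro exI[of _ r]) (auto simp: r dest: reval_det[OF r])
qed

lemma computable_id: "computable (\<lambda>x. x)"
  and computable_const: "computable (\<lambda>x. c)"
  and computable_Suc: "computable f \<Longrightarrow> computable (\<lambda>x. Suc (f x))"
  and computable_add: "computable f \<Longrightarrow> computable g \<Longrightarrow> computable (\<lambda>x. f x + g x)"
  and computable_diff: "computable f \<Longrightarrow> computable g \<Longrightarrow> computable (\<lambda>x. f x - g x)"
  and computable_mult: "computable f \<Longrightarrow> computable g \<Longrightarrow> computable (\<lambda>x. f x * g x)"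
  and computable_prod_encode:
    "computable f \<Longrightarrow> computable g \<Longrightarrow> computable (\<lambda>x. prod_encode (f x, g x))"
  and computable_fst: "computable f \<Longrightarrow> computable (\<lambda>x. fst (prod_decode (f x)))"
  and computable_snd: "computable f \<Longrightarrow> computable (\<lambda>x. snd (prod_decode (f x)))"
  unfolding computable_iff
  by (assumption | rule recursive_nth recursive_const recursive_Suc recursive_add recursive_diff
      recursive_mult recursive_prod_encode recursive_prod_decode lessI)+

lemma computable_comp: "computable f \<Longrightarrow> computable g \<Longrightarrow> computable (\<lambda>x. f (g x))"
  unfolding computable_iff by (rule recursive_comp1)

lemma computable_rec:
  assumes "computable f" "computable (\<lambda>e. g (fst (prod_decode e)) (fst (prod_decode (snd (prod_decode e))))
      (snd (prod_decode (snd (prod_decode e)))))" "computable h"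
  shows "computable (\<lambda>x. rec_nat (f x) (g x) (h x))"
proof -
  have "recursive (Suc (Suc 0)) (\<lambda>xs. rec_nat (f (tl xs ! 0)) (\<lambda>k y. g (tl xs ! 0) k y) (xs ! 0))"
  proof (rule recursive_prim)
    show "recursive (Suc 0) (\<lambda>xs. f (xs ! 0))" using assms(1) by (simp add: computable_iff)
    have "recursive 3 (\<lambda>xs. prod_encode (xs ! 2, prod_encode (xs ! 0, xs ! 1)))"
      by (intro recursive_prod_encode recursive_nth) auto
    from recursive_comp1[OF assms(2)[unfolded computable_iff] this]
    show "recursive (Suc (Suc (Suc 0))) (\<lambda>xs. g (drop 2 xs ! 0) (xs ! 0) (xs ! 1))"
      unfolding numeral_3_eq_3 by (rule recursive_cong) (auto simp: numeral_2_eq_2 length_Suc_conv)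
  qed
  hence "recursive (Suc (Suc 0)) (\<lambda>xs. rec_nat (f (xs ! Suc 0)) (g (xs ! Suc 0)) (xs ! 0))"
    by (rule recursive_cong) (auto simp: length_Suc_conv)
  from recursive_comp2[OF this, of "Suc 0" "\<lambda>xs. h (xs ! 0)" "\<lambda>xs. xs ! 0"] assms(3)
  show ?thesis unfolding computable_iff by (auto intro: recursive_nth)
qed

lemma computable_Least:
  assumes "computable f" "\<And>x. \<exists>k. f (prod_encode (x, k)) = 0"
  shows "computable (\<lambda>x. LEAST k. f (prod_encode (x, k)) = 0)"
proof -
  have "recursive (Suc 0) (\<lambda>xs. LEAST k. (\<lambda>xs. f (prod_encode (xs ! 1, xs ! 0))) (k # xs) = 0)"
  proof (rule recursive_Least)
    show "recursive (Suc (Suc 0)) (\<lambda>xs. f (prod_encode (xs ! 1, xs ! 0)))"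
      by (rule recursive_comp1[OF assms(1)[unfolded computable_iff]])
        (intro recursive_prod_encode recursive_nth; simp)
  qed (use assms(2) in auto)
  thus ?thesis unfolding computable_iff by simp
qed

section \<open>Computability over encoded types\<close>

text \<open>Encodings are bijections with the naturals: equality is then equality of codes, search
  over a type is search over numbers, and every number is a legitimate input. The instances repeat
  the codings \<open>int_decode\<close>, \<open>list_decode\<close> and \<open>prod_decode\<close>
  that the definitions of the theorem use.\<close>

class enc =
  fixes enc :: "'a \<Rightarrow> nat" and dcd :: "nat \<Rightarrow> 'a"
  assumes dcd_enc [simp]: "dcd (enc x) = x" and enc_dcd [simp]: "enc (dcd n) = n"

lemma enc_eq_iff [simp]: "enc x = enc y \<longleftrightarrow> x = y"
  by (metis dcd_enc)

instantiation nat :: enc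
begin
definition enc_nat :: "nat \<Rightarrow> nat" where [simp]: "enc_nat n = n"
definition dcd_nat :: "nat \<Rightarrow> nat" where [simp]: "dcd_nat n = n"
instance by standard auto
end

instantiation int :: enc
begin
definition enc_int :: "int \<Rightarrow> nat" where "enc_int = int_encode"
definition dcd_int :: "nat \<Rightarrow> int" where "dcd_int = int_decode"
instance by standard (auto simp: enc_int_def dcd_int_def)
end

instantiation prod :: (enc, enc) enc
begin
definition enc_prod :: "'a \<times> 'b \<Rightarrow> nat" where
  "enc_prod p = prod_encode (enc (fst p), enc (snd p))"
definition dcd_prod :: "nat \<Rightarrow> 'a \<times> 'b" where
  "dcd_prod n = (dcd (fst (prod_decode n)), dcd (snd (prod_decode n)))"
instance by standard (auto simp: enc_prod_def dcd_prod_def)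
end

instantiation list :: (enc) enc
begin
definition enc_list :: "'a list \<Rightarrow> nat" where "enc_list xs = list_encode (map enc xs)"
definition dcd_list :: "nat \<Rightarrow> 'a list" where "dcd_list n = map dcd (list_decode n)"
instance by standard (auto simp: enc_list_def dcd_list_def comp_def)
end

definition cmp :: "('a::enc \<Rightarrow> 'b::enc) \<Rightarrow> bool" where
  "cmp f \<longleftrightarrow> computable (\<lambda>n. enc (f (dcd n)))"

definition dec :: "('a::enc \<Rightarrow> bool) \<Rightarrow> bool" where
  "dec P \<longleftrightarrow> cmp (\<lambda>x. of_bool (P x) :: nat)"

text \<open>With these rules \<open>intro cmp\<close> follows the syntax of a term, so that
  computability of a definition is read off from its body. Functions fixed outside are supplied
  through \<open>cmp_o\<close> and its variants.\<close>

named_theorems cmp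

lemma cmp_nat_iff: "cmp (f :: nat \<Rightarrow> nat) \<longleftrightarrow> computable f"
  by (simp add: cmp_def)

lemma cmp_id [cmp]: "cmp (\<lambda>x. x)"
  by (simp add: cmp_def computable_id)

lemma cmp_const [cmp]: "cmp (\<lambda>x. c)"
  by (simp add: cmp_def computable_const)

lemma cmp_o: "cmp f \<Longrightarrow> cmp g \<Longrightarrow> cmp (\<lambda>x. f (g x))"
  unfolding cmp_def using computable_comp[of "\<lambda>n. enc (f (dcd n))" "\<lambda>n. enc (g (dcd n))"] by simp

lemma cmp_Pair [cmp]: "cmp f \<Longrightarrow> cmp g \<Longrightarrow> cmp (\<lambda>x. (f x, g x))"
  unfolding cmp_def by (simp add: enc_prod_def computable_prod_encode)

lemma cmp_fst [cmp]: "cmp f \<Longrightarrow> cmp (\<lambda>x. fst (f x))"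
  unfolding cmp_def using computable_fst[of "\<lambda>n. enc (f (dcd n))"] by (simp add: enc_prod_def)

lemma cmp_snd [cmp]: "cmp f \<Longrightarrow> cmp (\<lambda>x. snd (f x))"
  unfolding cmp_def using computable_snd[of "\<lambda>n. enc (f (dcd n))"] by (simp add: enc_prod_def)

lemma cmp_o2: "cmp (\<lambda>e. f (fst e) (snd e)) \<Longrightarrow> cmp g \<Longrightarrow> cmp h \<Longrightarrow> cmp (\<lambda>x. f (g x) (h x))"
  using cmp_o[OF _ cmp_Pair, of "\<lambda>e. f (fst e) (snd e)"] by simp

lemma cmp_o3:
  "cmp (\<lambda>e. g (fst e) (fst (snd e)) (snd (snd e))) \<Longrightarrow> cmp u \<Longrightarrow> cmp v \<Longrightarrow> cmp w
    \<Longrightarrow> cmp (\<lambda>e. g (u e) (v e) (w e))"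
  using cmp_o[OF _ cmp_Pair[OF _ cmp_Pair], of "\<lambda>e. g (fst e) (fst (snd e)) (snd (snd e))"] by simp

lemma cmp_enc [cmp]: "cmp f \<Longrightarrow> cmp (\<lambda>x. enc (f x))"
  by (simp add: cmp_def)

lemma cmp_dcd [cmp]: "cmp f \<Longrightarrow> cmp (\<lambda>x. dcd (f x))"
  by (simp add: cmp_def)

lemma cmp_of_enc: "cmp (\<lambda>x. enc (f x)) \<Longrightarrow> cmp f"
  by (simp add: cmp_def)

lemma cmp_Suc [cmp]: "cmp f \<Longrightarrow> cmp (\<lambda>x. Suc (f x))"
  and cmp_add [cmp]: "cmp f \<Longrightarrow> cmp g \<Longrightarrow> cmp (\<lambda>x. f x + g x :: nat)"
  and cmp_diff [cmp]: "cmp f \<Longrightarrow> cmp g \<Longrightarrow> cmp (\<lambda>x. f x - g x :: nat)"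
  and cmp_mult [cmp]: "cmp f \<Longrightarrow> cmp g \<Longrightarrow> cmp (\<lambda>x. f x * g x :: nat)"
  unfolding cmp_def enc_nat_def
  by (assumption | rule computable_Suc computable_add computable_diff computable_mult)+

lemma cmp_rec [cmp]:
  fixes f :: "'a::enc \<Rightarrow> 'b::enc"
  assumes f: "cmp f" and g: "cmp (\<lambda>e. g (fst e) (fst (snd e)) (snd (snd e)))" and h: "cmp h"
  shows "cmp (\<lambda>x. rec_nat (f x) (g x) (h x))"
proof -
  have e: "rec_nat (enc a) (\<lambda>k y. enc (b k (dcd y))) n = enc (rec_nat a b n)"
    for a :: 'b and b n by (induction n) auto
  show ?thesis unfolding cmp_def e[symmetric]
    by (rule computable_rec) (use f g h in \<open>simp_all add: cmp_def dcd_prod_def\<close>)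
qed

lemma dec_cmp_of_bool [cmp]: "dec P \<Longrightarrow> cmp (\<lambda>x. of_bool (P x) :: nat)"
  by (simp add: dec_def)

lemma dec_o: "dec P \<Longrightarrow> cmp f \<Longrightarrow> dec (\<lambda>x. P (f x))"
  unfolding dec_def by (rule cmp_o)

lemma dec_o2: "dec (\<lambda>e. P (fst e) (snd e)) \<Longrightarrow> cmp f \<Longrightarrow> cmp g \<Longrightarrow> dec (\<lambda>x. P (f x) (g x))"
  using dec_o[OF _ cmp_Pair, of "\<lambda>e. P (fst e) (snd e)"] by simp

lemma dec_not [cmp]: "dec P \<Longrightarrow> dec (\<lambda>x. \<not> P x)"
proof -
  assume "dec P"
  hence "cmp (\<lambda>x. 1 - (of_bool (P x) :: nat))" by (intro cmp)
  moreover have "(\<lambda>x. 1 - (of_bool (P x) :: nat)) = (\<lambda>x. of_bool (\<not> P x))" by auto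
  ultimately show ?thesis unfolding dec_def by simp
qed

lemma dec_conj [cmp]: "dec P \<Longrightarrow> dec Q \<Longrightarrow> dec (\<lambda>x. P x \<and> Q x)"
proof -
  assume "dec P" "dec Q"
  hence "cmp (\<lambda>x. of_bool (P x) * of_bool (Q x) :: nat)" by (intro cmp)
  thus ?thesis unfolding dec_def of_bool_conj .
qed

lemma dec_disj [cmp]: "dec P \<Longrightarrow> dec Q \<Longrightarrow> dec (\<lambda>x. P x \<or> Q x)"
  using dec_not[OF dec_conj[OF dec_not dec_not], of P Q] by simp

lemma dec_imp [cmp]: "dec P \<Longrightarrow> dec Q \<Longrightarrow> dec (\<lambda>x. P x \<longrightarrow> Q x)"
  unfolding imp_conv_disj by (intro dec_disj dec_not)

lemma dec_le [cmp]: "cmp f \<Longrightarrow> cmp g \<Longrightarrow> dec (\<lambda>x. f x \<le> (g x :: nat))"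
proof -
  assume "cmp f" "cmp g"
  hence "cmp (\<lambda>x. 1 - (f x - g x))" by (intro cmp)
  moreover have "(\<lambda>x. 1 - (f x - g x)) = (\<lambda>x. of_bool (f x \<le> g x))" by auto
  ultimately show ?thesis unfolding dec_def by simp
qed

lemma dec_less [cmp]: "cmp f \<Longrightarrow> cmp g \<Longrightarrow> dec (\<lambda>x. f x < (g x :: nat))"
  using dec_not[OF dec_le, of g f] by (simp add: not_le)

lemma dec_eq [cmp]: "cmp f \<Longrightarrow> cmp g \<Longrightarrow> dec (\<lambda>x. f x = g x)"
proof -
  assume "cmp f" "cmp g"
  hence "dec (\<lambda>x. enc (f x) \<le> enc (g x) \<and> enc (g x) \<le> enc (f x))" by (intro cmp)
  thus ?thesis by (simp add: order_antisym_conv antisym_conv eq_iff[symmetric])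
qed

lemma cmp_if [cmp]: "dec P \<Longrightarrow> cmp f \<Longrightarrow> cmp g \<Longrightarrow> cmp (\<lambda>x. if P x then f x else g x)"
proof (rule cmp_of_enc)
  assume "dec P" "cmp f" "cmp g"
  hence "cmp (\<lambda>x. of_bool (P x) * enc (f x) + (1 - of_bool (P x)) * enc (g x))" by (intro cmp)
  moreover have "(\<lambda>x. of_bool (P x) * enc (f x) + (1 - of_bool (P x)) * enc (g x)) =
    (\<lambda>x. enc (if P x then f x else g x))" by auto
  ultimately show "cmp (\<lambda>x. enc (if P x then f x else g x))" by simp
qed

lemma dec_All_less [cmp]:
  fixes f :: "'a::enc \<Rightarrow> nat"
  shows "dec (\<lambda>e. P (fst e) (snd e)) \<Longrightarrow> cmp f \<Longrightarrow> dec (\<lambda>x. \<forall>i<f x. P x i)"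
proof -
  assume P: "dec (\<lambda>e. P (fst e) (snd e))" and f: "cmp f"
  have "rec_nat 1 (\<lambda>i r. r * of_bool (P x i)) n = (of_bool (\<forall>i<n. P x i) :: nat)" for x n
    by (induction n) (auto simp: less_Suc_eq)
  moreover have "cmp (\<lambda>x. rec_nat (1::nat) (\<lambda>i r. r * of_bool (P x i)) (f x))"
    by (intro cmp f dec_o2[OF P])
  ultimately show ?thesis unfolding dec_def by simp
qed

lemma cmp_Least:
  fixes P :: "'a::enc \<Rightarrow> nat \<Rightarrow> bool"
  assumes "dec (\<lambda>e. P (fst e) (snd e))" "\<And>x. \<exists>k. P x k"
  shows "cmp (\<lambda>x. LEAST k. P x k)"
proof -
  define f where "f = (\<lambda>n. 1 - (of_bool (P (dcd (fst (prod_decode n))) (snd (prod_decode n))) :: nat))"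
  have "cmp (\<lambda>e. 1 - (of_bool (P (fst e) (snd e)) :: nat))" by (intro cmp assms(1))
  hence "computable f" unfolding f_def cmp_def by (simp add: dcd_prod_def)
  moreover have e: "f (prod_encode (x, k)) = 0 \<longleftrightarrow> P (dcd x) k" for x k
    by (auto simp: f_def)
  ultimately have "computable (\<lambda>x. LEAST k. f (prod_encode (x, k)) = 0)"
    using assms(2) by (intro computable_Least) auto
  thus ?thesis unfolding cmp_def e by simp
qed

lemma cmp_power [cmp]: "cmp f \<Longrightarrow> cmp g \<Longrightarrow> cmp (\<lambda>x. f x ^ g x :: nat)"
proof -
  assume f: "cmp f" "cmp g"
  have "rec_nat 1 (\<lambda>_ r. r * a) n = a ^ n" for a n :: nat by (induction n) auto
  moreover have "cmp (\<lambda>x. rec_nat 1 (\<lambda>_ r. r * f x) (g x))" by (intro cmp cmp_o[OF f(1)] f)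
  ultimately show ?thesis by simp
qed

lemma cmp_div [cmp]: "cmp f \<Longrightarrow> cmp g \<Longrightarrow> cmp (\<lambda>x. f x div g x :: nat)"
proof (rule cmp_o2[of "\<lambda>a b. a div b :: nat"])
  \<comment> \<open>The disjunct b = 0 keeps the search total; it then stops at 0, which agrees with
    division by zero.\<close>
  have "a div b = (LEAST q. b = 0 \<or> a < b * Suc q)" for a b :: nat
  proof (cases "b = 0")
    case False
    show ?thesis
    proof (rule Least_equality[symmetric])
      show "b = 0 \<or> a < b * Suc (a div b)" using dividend_less_times_div[of b a] False by simp
      show "a div b \<le> q" if "b = 0 \<or> a < b * Suc q" for q
      proof -
        have "a < Suc q * b" using that False by (subst mult.commute) blast
        from less_mult_imp_div_less[OF this] show ?thesis by simp
      qed
    qed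
  qed simp
  moreover have "cmp (\<lambda>e. LEAST q. snd e = 0 \<or> fst e < snd e * Suc q)"
  proof (rule cmp_Least)
    show "\<exists>q. snd x = 0 \<or> fst x < snd x * Suc q" for x :: "nat \<times> nat"
      by (rule exI[of _ "fst x div snd x"], cases "snd x = 0") (auto simp: dividend_less_times_div)
  qed (intro cmp)
  ultimately show "cmp (\<lambda>e. fst e div snd e :: nat)" by simp
qed

lemma cmp_mod [cmp]: "cmp f \<Longrightarrow> cmp g \<Longrightarrow> cmp (\<lambda>x. f x mod g x :: nat)"
  unfolding minus_mult_div_eq_mod[symmetric] by (intro cmp)

lemma dec_even [cmp]: "cmp f \<Longrightarrow> dec (\<lambda>x. even (f x :: nat))"
  unfolding even_iff_mod_2_eq_zero by (intro cmp)

subsection \<open>Integers\<close>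

lemma even_enc_int: "even (enc i) \<longleftrightarrow> 0 \<le> i" for i :: int
  by (simp add: enc_int_def int_encode_def sum_encode_def)

lemma enc_int_div_2: "enc i div 2 = (if 0 \<le> i then nat i else nat (- i - 1))" for i :: int
  by (simp add: enc_int_def int_encode_def sum_encode_def)

text \<open>Every integer i is \<open>nat i - nat (- i)\<close>. Sums, negatives and products
  therefore become differences of expressions over the naturals, and this rule handles them
  all.\<close>

lemma cmp_int_diff: "cmp f \<Longrightarrow> cmp g \<Longrightarrow> cmp (\<lambda>x. int (f x) - int (g x))"
proof (rule cmp_of_enc)
  assume "cmp f" "cmp g"
  hence "cmp (\<lambda>x. if g x \<le> f x then 2 * (f x - g x) else Suc (2 * (g x - f x - 1)))"
    by (intro cmp)
  moreover have "(\<lambda>x. if g x \<le> f x then 2 * (f x - g x) else Suc (2 * (g x - f x - 1))) =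
     (\<lambda>x. enc (int (f x) - int (g x)))"
    by (auto simp: enc_int_def int_encode_def sum_encode_def nat_diff_distrib)
  ultimately show "cmp (\<lambda>x. enc (int (f x) - int (g x)))" by simp
qed

lemma cmp_int [cmp]: "cmp f \<Longrightarrow> cmp (\<lambda>x. int (f x))"
  using cmp_int_diff[of f "\<lambda>_. 0"] by (simp add: cmp)

lemma cmp_nat [cmp]: "cmp f \<Longrightarrow> cmp (\<lambda>x. nat (f x))"
proof -
  assume "cmp f"
  hence "cmp (\<lambda>x. if even (enc (f x)) then enc (f x) div 2 else 0)" by (intro cmp)
  moreover have "(\<lambda>x. if even (enc (f x)) then enc (f x) div 2 else 0) = (\<lambda>x. nat (f x))"
    unfolding even_enc_int enc_int_div_2 by auto
  ultimately show ?thesis by simp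
qed

lemma cmp_nat_uminus: "cmp f \<Longrightarrow> cmp (\<lambda>x. nat (- f x))"
proof -
  assume "cmp f"
  hence "cmp (\<lambda>x. if even (enc (f x)) then 0 else Suc (enc (f x) div 2))" by (intro cmp)
  moreover have "(\<lambda>x. if even (enc (f x)) then 0 else Suc (enc (f x) div 2)) = (\<lambda>x. nat (- f x))"
    unfolding even_enc_int enc_int_div_2 by (rule ext) (simp, arith)
  ultimately show ?thesis by simp
qed

lemma cmp_add_int [cmp]: "cmp f \<Longrightarrow> cmp g \<Longrightarrow> cmp (\<lambda>x. f x + g x :: int)"
proof -
  assume "cmp f" "cmp g"
  hence "cmp (\<lambda>x. int (nat (f x) + nat (g x)) - int (nat (- f x) + nat (- g x)))"
    by (intro cmp cmp_int_diff cmp_nat_uminus)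
  moreover have "(\<lambda>x. int (nat (f x) + nat (g x)) - int (nat (- f x) + nat (- g x))) = (\<lambda>x. f x + g x)"
    by auto
  ultimately show ?thesis by simp
qed

lemma cmp_uminus_int [cmp]: "cmp f \<Longrightarrow> cmp (\<lambda>x. - f x :: int)"
proof -
  assume "cmp f"
  hence "cmp (\<lambda>x. int (nat (- f x)) - int (nat (f x)))" by (intro cmp cmp_int_diff cmp_nat_uminus)
  moreover have "(\<lambda>x. int (nat (- f x)) - int (nat (f x))) = (\<lambda>x. - f x)" by auto
  ultimately show ?thesis by simp
qed

lemma cmp_diff_int [cmp]: "cmp f \<Longrightarrow> cmp g \<Longrightarrow> cmp (\<lambda>x. f x - g x :: int)"
  using cmp_add_int[OF _ cmp_uminus_int, of f g] by simp

lemma cmp_mult_int [cmp]: "cmp f \<Longrightarrow> cmp g \<Longrightarrow> cmp (\<lambda>x. f x * g x :: int)"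
proof -
  assume "cmp f" "cmp g"
  hence "cmp (\<lambda>x. int (nat (f x) * nat (g x) + nat (- f x) * nat (- g x)) -
      int (nat (- f x) * nat (g x) + nat (f x) * nat (- g x)))"
    by (intro cmp cmp_int_diff cmp_nat_uminus)
  moreover have "int (nat a * nat b + nat (- a) * nat (- b)) -
      int (nat (- a) * nat b + nat a * nat (- b)) = a * b" for a b :: int
    by (cases "0 \<le> a"; cases "0 \<le> b") auto
  ultimately show ?thesis by simp
qed

lemma dec_le_int [cmp]: "cmp f \<Longrightarrow> cmp g \<Longrightarrow> dec (\<lambda>x. f x \<le> (g x :: int))"
proof -
  assume "cmp f" "cmp g"
  hence "dec (\<lambda>x. nat (f x - g x) = 0)" by (intro cmp)
  thus ?thesis by simp
qed

lemma dec_less_int [cmp]: "cmp f \<Longrightarrow> cmp g \<Longrightarrow> dec (\<lambda>x. f x < (g x :: int))"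
  using dec_not[OF dec_le_int, of g f] by (simp add: not_le)

lemma cmp_abs_int [cmp]: "cmp f \<Longrightarrow> cmp (\<lambda>x. \<bar>f x :: int\<bar>)"
  unfolding abs_if by (intro cmp)

subsection \<open>Lists\<close>

text \<open>Lets the code of a list serve as a number of rounds that is enough to walk through
  it.\<close>

lemma length_le_enc: "length xs \<le> enc xs"
proof (induction xs)
  case (Cons x xs)
  thus ?case using le_prod_encode_2[of "enc xs" "enc x"] by (simp add: enc_list_def)
qed simp

lemma enc_mem_less: "x \<in> set xs \<Longrightarrow> enc x < enc xs"
proof (induction xs)
  case (Cons a xs)
  thus ?case using le_prod_encode_2[of "enc xs" "enc a"] le_prod_encode_1[of "enc a" "enc xs"]
    by (auto simp: enc_list_def)
qed simp

lemma cmp_Cons [cmp]: "cmp f \<Longrightarrow> cmp g \<Longrightarrow> cmp (\<lambda>x. f x # g x)"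
proof (rule cmp_of_enc)
  assume "cmp f" "cmp g"
  hence "cmp (\<lambda>x. Suc (enc (enc (f x), enc (g x))))" by (intro cmp)
  thus "cmp (\<lambda>x. enc (f x # g x))" by (simp add: enc_list_def enc_prod_def)
qed

text \<open>Iterates on pairs of the code of the remaining list and the accumulator. The code of a
  nonempty list is the successor of a coded pair, hence \<open>fst p - 1\<close>; the code 0 of the
  empty list is a fixed point, so surplus rounds do no harm.\<close>

lemma cmp_fold [cmp]:
  fixes l :: "'a::enc \<Rightarrow> 'b::enc list" and a :: "'a \<Rightarrow> 'c::enc"
  assumes g: "cmp (\<lambda>e. g (fst e) (fst (snd e)) (snd (snd e)))" and l: "cmp l" and a: "cmp a"
  shows "cmp (\<lambda>x. fold (g x) (l x) (a x))"
proof -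
  define st where "st = (\<lambda>x (p :: nat \<times> 'c). if fst p = 0 then p else
     (snd (dcd (fst p - 1) :: 'b \<times> nat), g x (fst (dcd (fst p - 1) :: 'b \<times> nat)) (snd p)))"
  have 1: "rec_nat (0, c) (\<lambda>_. st x) n = (0, c)" for x c n
    by (induction n) (auto simp: st_def)
  have shift: "rec_nat p (\<lambda>_. st x) (Suc n) = rec_nat (st x p) (\<lambda>_. st x) n" for x p n
    by (induction n) auto
  have "length ys \<le> n \<Longrightarrow> rec_nat (enc ys, c) (\<lambda>_. st x) n = (0, fold (g x) ys c)" for x ys c n
  proof (induction n arbitrary: ys c)
    case (Suc n)
    show ?case
    proof (cases ys)
      case Nil thus ?thesis by (simp only: enc_list_def list.map list_encode.simps 1 fold_simps)
    next
      case (Cons y zs)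
      hence "st x (enc ys, c) = (enc zs, g x y c)"
        by (simp add: st_def enc_list_def dcd_prod_def)
      hence "rec_nat (enc ys, c) (\<lambda>_. st x) (Suc n) = rec_nat (enc zs, g x y c) (\<lambda>_. st x) n"
        by (simp only: shift)
      also have "\<dots> = (0, fold (g x) zs (g x y c))" using Suc.prems Cons by (intro Suc.IH) simp
      finally show ?thesis by (simp only: Cons fold_simps)
    qed
  qed (simp add: enc_list_def)
  hence eq: "snd (rec_nat (enc (l x), a x) (\<lambda>_. st x) (enc (l x))) = fold (g x) (l x) (a x)" for x
    by (simp add: length_le_enc)
  have "cmp (\<lambda>x. snd (rec_nat (enc (l x), a x) (\<lambda>_. st x) (enc (l x))))"
    unfolding st_def by (intro cmp l a cmp_o3[OF g])
  thus ?thesis unfolding eq .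
qed

lemma cmp_rev [cmp]:
  fixes f :: "'a::enc \<Rightarrow> 'd::enc list"
  shows "cmp f \<Longrightarrow> cmp (\<lambda>x. rev (f x))"
proof -
  assume "cmp f"
  hence "cmp (\<lambda>x. fold (\<lambda>y r. y # r) (f x) [])" by (intro cmp)
  moreover have "fold (\<lambda>y r. y # r) xs ys = rev xs @ ys" for xs ys :: "'d list"
    by (induction xs arbitrary: ys) auto
  ultimately show ?thesis by simp
qed

lemma cmp_foldr [cmp]:
  assumes "cmp (\<lambda>e. g (fst e) (fst (snd e)) (snd (snd e)))" and "cmp l" and "cmp a"
  shows "cmp (\<lambda>x. foldr (g x) (l x) (a x))"
  unfolding foldr_conv_fold by (intro cmp assms)

lemma cmp_map [cmp]:
  assumes g: "cmp (\<lambda>e. g (fst e) (snd e))" and "cmp l"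
  shows "cmp (\<lambda>x. map (g x) (l x))"
proof -
  have "cmp (\<lambda>x. foldr (\<lambda>y r. g x y # r) (l x) [])" by (intro cmp cmp_o2[OF g] assms)
  moreover have "foldr (\<lambda>y r. g x y # r) xs [] = map (g x) xs" for x xs by (induction xs) auto
  ultimately show ?thesis by simp
qed

lemma cmp_append [cmp]:
  fixes f :: "'a::enc \<Rightarrow> 'd::enc list"
  shows "cmp f \<Longrightarrow> cmp g \<Longrightarrow> cmp (\<lambda>x. f x @ g x)"
proof -
  assume "cmp f" "cmp g"
  hence "cmp (\<lambda>x. foldr (\<lambda>y r. y # r) (f x) (g x))" by (intro cmp)
  moreover have "foldr (\<lambda>y r. y # r) xs ys = xs @ ys" for xs ys :: "'d list" by (induction xs) auto
  ultimately show ?thesis by simp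
qed

lemma cmp_filter [cmp]:
  assumes P: "dec (\<lambda>e. P (fst e) (snd e))" and "cmp l"
  shows "cmp (\<lambda>x. filter (P x) (l x))"
proof -
  have "cmp (\<lambda>x. foldr (\<lambda>y r. if P x y then y # r else r) (l x) [])"
    by (intro cmp dec_o2[OF P] assms)
  moreover have "foldr (\<lambda>y r. if P x y then y # r else r) xs [] = filter (P x) xs" for x xs
    by (induction xs) auto
  ultimately show ?thesis by simp
qed

lemma cmp_length [cmp]:
  fixes f :: "'a::enc \<Rightarrow> 'd::enc list"
  shows "cmp f \<Longrightarrow> cmp (\<lambda>x. length (f x))"
proof -
  assume "cmp f"
  hence "cmp (\<lambda>x. foldr (\<lambda>_. Suc) (f x) 0)" by (intro cmp)
  moreover have "foldr (\<lambda>_. Suc) xs 0 = length xs" for xs :: "'d list" by (induction xs) auto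
  ultimately show ?thesis by simp
qed

lemma cmp_upt [cmp]: "cmp f \<Longrightarrow> cmp g \<Longrightarrow> cmp (\<lambda>x. [f x..<g x])"
proof -
  assume f: "cmp f" "cmp g"
  have "rec_nat [] (\<lambda>k r. r @ [a + k]) n = [a..<a + n]" for a n by (induction n) auto
  hence "rec_nat [] (\<lambda>k r. r @ [a + k]) (b - a) = [a..<b]" for a b
    by (cases "a \<le> b") auto
  moreover have "cmp (\<lambda>x. rec_nat [] (\<lambda>k r. r @ [f x + k]) (g x - f x))"
    by (intro cmp f cmp_o[OF f(1)])
  ultimately show ?thesis by simp
qed

lemma dec_Ball_set [cmp]:
  assumes P: "dec (\<lambda>e. P (fst e) (snd e))" and "cmp l"
  shows "dec (\<lambda>x. \<forall>y\<in>set (l x). P x y)"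
proof -
  have "dec (\<lambda>x. filter (\<lambda>y. \<not> P x y) (l x) = [])" by (intro cmp dec_o2[OF P] assms)
  thus ?thesis by (simp add: filter_empty_conv)
qed

lemma dec_Bex_set [cmp]:
  assumes P: "dec (\<lambda>e. P (fst e) (snd e))" and "cmp l"
  shows "dec (\<lambda>x. \<exists>y\<in>set (l x). P x y)"
  using dec_not[OF dec_Ball_set[OF dec_not[OF P] assms(2)]] by (simp del: cmp)

text \<open>Out-of-range indices yield a fixed default, which makes the operation total and computable.\<close>
definition nthd :: "'a::enc list \<Rightarrow> nat \<Rightarrow> 'a" where
  "nthd xs i = (if i < length xs then xs ! i else dcd 0)"

lemma nthd_nth [simp]: "i < length xs \<Longrightarrow> nthd xs i = xs ! i"
  by (simp add: nthd_def)

lemma cmp_nthd [cmp]: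
  fixes f :: "'a::enc \<Rightarrow> 'd::enc list"
  shows "cmp f \<Longrightarrow> cmp g \<Longrightarrow> cmp (\<lambda>x. nthd (f x) (g x))"
proof -
  assume f: "cmp f" "cmp g"
  have "fold (\<lambda>y p. (Suc (fst p), if fst p = i then y else snd p)) xs (k, d) =
    (k + length xs, if k \<le> i \<and> i < k + length xs then xs ! (i - k) else d)" for i k d and xs :: "'d list"
    by (induction xs arbitrary: k d)  (auto simp: nth_Cons')
  hence "nthd xs i = snd (fold (\<lambda>y p. (Suc (fst p), if fst p = i then y else snd p)) xs (0, dcd 0))"
    for i and xs :: "'d::enc list" by (simp add: nthd_def)
  moreover have "cmp (\<lambda>x. snd (fold (\<lambda>y p. (Suc (fst p), if fst p = g x then y else snd p)) (f x) (0, dcd 0)))"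
    by (intro cmp f cmp_o[OF f(2)])
  ultimately show ?thesis by simp
qed

lemma cmp_sum_list_nat [cmp]: "cmp f \<Longrightarrow> cmp (\<lambda>x. sum_list (f x :: nat list))"
  unfolding sum_list.eq_foldr by (intro cmp)

lemma dec_set_decode [cmp]: "cmp f \<Longrightarrow> cmp g \<Longrightarrow> dec (\<lambda>x. f x \<in> set_decode (g x))"
  unfolding set_decode_def mem_Collect_eq by (intro cmp)

subsection \<open>Semidecidable predicates\<close>

text \<open>The Sigma-1 predicates. Describing a result by such a predicate replaces computing it by
  checking a certificate for it.\<close>

definition sig :: "('a::enc \<Rightarrow> bool) \<Rightarrow> bool" where
  "sig P \<longleftrightarrow> (\<exists>R. dec R \<and> (\<forall>x. P x \<longleftrightarrow> (\<exists>w::nat. R (x, w))))"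

lemma sig_dec: "dec P \<Longrightarrow> sig P"
  unfolding sig_def by (intro exI[of _ "\<lambda>e. P (fst e)"]) (simp add: dec_o cmp)

lemma sig_o: "sig P \<Longrightarrow> cmp f \<Longrightarrow> sig (\<lambda>x. P (f x))"
proof -
  assume "sig P" and f: "cmp f"
  then obtain R where R': "dec R" and R: "\<And>x. P x \<longleftrightarrow> (\<exists>w::nat. R (x, w))" unfolding sig_def by blast
  have "dec (\<lambda>e. R (f (fst e), snd e :: nat))" by (intro dec_o[OF R'] cmp cmp_o[OF f])
  thus ?thesis unfolding sig_def using R by (intro exI[of _ "\<lambda>e. R (f (fst e), snd e)"]) simp
qed

lemma sig_o2: "sig (\<lambda>e. P (fst e) (snd e)) \<Longrightarrow> cmp f \<Longrightarrow> cmp g \<Longrightarrow> sig (\<lambda>x. P (f x) (g x))"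
  using sig_o[OF _ cmp_Pair, of "\<lambda>e. P (fst e) (snd e)"] by simp

lemma sig_ex:
  fixes P :: "'a::enc \<Rightarrow> 'b::enc \<Rightarrow> bool"
  assumes "sig (\<lambda>e. P (fst e) (snd e))"
  shows "sig (\<lambda>x. \<exists>y. P x y)"
proof -
  obtain R where "dec R" and R: "\<And>x. P (fst x) (snd x) \<longleftrightarrow> (\<exists>w::nat. R (x, w))"
    using assms unfolding sig_def by blast
  define S where "S = (\<lambda>e. R ((fst e, fst (dcd (snd e) :: 'b \<times> nat)), snd (dcd (snd e) :: 'b \<times> nat)))"
  have "dec S" unfolding S_def by (intro dec_o[OF \<open>dec R\<close>] cmp)
  moreover have "(\<exists>y. P x y) \<longleftrightarrow> (\<exists>w. S (x, w))" for x
  proof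
    assume "\<exists>y. P x y"
    then obtain y w where "R ((x, y), w)" using R[of "(x, _)"] by auto
    hence "S (x, enc (y, w))" by (simp add: S_def)
    thus "\<exists>w. S (x, w)" by blast
  next
    assume "\<exists>w. S (x, w)"
    thus "\<exists>y. P x y" using R[of "(x, _)"] by (auto simp: S_def)
  qed
  ultimately show ?thesis unfolding sig_def by blast
qed

lemma sig_conj: "sig P \<Longrightarrow> sig Q \<Longrightarrow> sig (\<lambda>x. P x \<and> Q x)"
proof -
  assume "sig P" "sig Q"
  then obtain R S where R: "dec R" "\<And>x. P x \<longleftrightarrow> (\<exists>w::nat. R (x, w))"
    and S: "dec S" "\<And>x. Q x \<longleftrightarrow> (\<exists>w::nat. S (x, w))" unfolding sig_def by metis
  have "sig (\<lambda>x. \<exists>p :: nat \<times> nat. R (x, fst p) \<and> S (x, snd p))"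
    by (intro sig_ex sig_dec cmp dec_o[OF R(1)] dec_o[OF S(1)])
  moreover have "(\<exists>p :: nat \<times> nat. R (x, fst p) \<and> S (x, snd p)) \<longleftrightarrow> P x \<and> Q x" for x
    using R(2) S(2) by auto
  ultimately show ?thesis by simp
qed

text \<open>The witnesses of the finitely many instances are collected in one list, which becomes a
  single witness.\<close>

lemma sig_All_less:
  fixes f :: "'a::enc \<Rightarrow> nat"
  assumes "sig (\<lambda>e. P (fst e) (snd e))" and f: "cmp f"
  shows "sig (\<lambda>x. \<forall>i<f x. P x i)"
proof -
  obtain R where "dec R" and R: "\<And>e. P (fst e) (snd e) \<longleftrightarrow> (\<exists>w::nat. R (e, w))"
    using assms(1) unfolding sig_def by blast
  have "sig (\<lambda>x. \<exists>ws :: nat list. \<forall>i<f x. R ((x, i), nthd ws i))"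
    by (intro sig_ex sig_dec cmp dec_o[OF \<open>dec R\<close>] cmp_o[OF f])
  moreover have "(\<exists>ws :: nat list. \<forall>i<f x. R ((x, i), nthd ws i)) \<longleftrightarrow> (\<forall>i<f x. P x i)" for x
  proof
    assume "\<forall>i<f x. P x i"
    then obtain w where w: "\<And>i. i < f x \<Longrightarrow> R ((x, i), w i)"
      using R[of "(x, _)"] by (simp) metis
    show "\<exists>ws :: nat list. \<forall>i<f x. R ((x, i), nthd ws i)"
      by (rule exI[of _ "map w [0..<f x]"]) (simp add: w)
  qed (use R[of "(x, _)"] in auto)
  ultimately show ?thesis by simp
qed

text \<open>Uniformisation: the search runs over pairs of a value and its certificate, since only a
  certified pair can be recognised. The least such pair gives a total function.\<close>

lemma sig_select:
  fixes P :: "'a::enc \<Rightarrow> 'b::enc \<Rightarrow> bool"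
  assumes "sig (\<lambda>e. P (fst e) (snd e))" "\<And>x. \<exists>y. P x y"
  obtains f where "cmp f" "\<And>x. P x (f x)"
proof -
  obtain R where "dec R" and R: "\<And>e. P (fst e) (snd e) \<longleftrightarrow> (\<exists>w::nat. R (e, w))"
    using assms(1) unfolding sig_def by blast
  define S where "S = (\<lambda>x k. R ((x, fst (dcd k :: 'b \<times> nat)), snd (dcd k :: 'b \<times> nat)))"
  have ex: "\<exists>k. S x k" for x
  proof -
    obtain y w where "R ((x, y), w)" using assms(2)[of x] R[of "(x, _)"] by auto
    hence "S x (enc (y, w))" by (simp add: S_def)
    thus ?thesis by blast
  qed
  have "cmp (\<lambda>x. LEAST k. S x k)"
    unfolding S_def by (rule cmp_Least; (intro dec_o[OF \<open>dec R\<close>] cmp)?) (use ex in \<open>simp add: S_def\<close>)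
  hence "cmp (\<lambda>x. fst (dcd (LEAST k. S x k) :: 'b \<times> nat))" by (intro cmp)
  moreover have "P x (fst (dcd (LEAST k. S x k) :: 'b \<times> nat))" for x
    using LeastI_ex[OF ex[of x]] R[of "(x, _)"] by (auto simp: S_def)
  ultimately show ?thesis using that by blast
qed

text \<open>Normal form in the manner of Kleene, by induction on the function instead of through a
  step-counting interpreter. The witness for a composition is the list of inner values, for a
  primitive recursion the list of all intermediate values.\<close>

lemma sig_reval: "sig (\<lambda>e. reval f (fst e) (snd e))"
proof (induction f)
  case Zero
  show ?case unfolding reval_Zero_iff by (intro sig_dec cmp)
next
  case Succ
  have "xs \<noteq> [] \<and> y = Suc (hd xs) \<longleftrightarrow> length xs \<noteq> 0 \<and> y = Suc (nthd xs 0)" for xs :: "nat list" and y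
    by (cases xs) auto
  thus ?case unfolding reval_Succ_iff by (simp only:) (intro sig_dec cmp)
next
  case (Proj i)
  have "i < length xs \<and> y = xs ! i \<longleftrightarrow> i < length xs \<and> y = nthd xs i" for xs :: "nat list" and y
    by auto
  thus ?case unfolding reval_Proj_iff by (simp only:) (intro sig_dec cmp)
next
  case (Comp f gs)
  have 1: "sig (\<lambda>e. list_all2 (\<lambda>g y. reval g (fst e) y) gs (snd e))"
    using Comp(2)
  proof (induction gs)
    case Nil show ?case by (simp) (intro sig_dec cmp)
  next
    case (Cons g gs)
    have IH: "sig (\<lambda>e. list_all2 (\<lambda>g y. reval g (fst e) y) gs (snd e))"
      using Cons by simp
    have "sig (\<lambda>e. \<exists>p :: nat \<times> nat list. (snd e = fst p # snd p) \<and> reval g (fst e) (fst p) \<and>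
       list_all2 (\<lambda>g y. reval g (fst e) y) gs (snd p))"
      by (intro sig_ex sig_conj sig_o2[OF Cons(2)[OF list.set_intros(1)]] sig_o2[OF IH])
        (intro sig_dec cmp)+
    thus ?case by (simp add: list_all2_Cons1)
  qed
  show ?case unfolding reval_Comp_iff by (intro sig_ex sig_conj sig_o2[OF 1] sig_o2[OF Comp(1)] cmp)
next
  case (Prim f g)
  \<comment> \<open>ys lists the values of the recursion at 0, ..., n. As \<open>nthd\<close> is
    total, its length can stay unspecified.\<close>
  have iff: "reval (Prim f g) (n # xs) y \<longleftrightarrow> (\<exists>ys. reval f xs (nthd ys 0) \<and>
      (\<forall>i<n. reval g (i # nthd ys i # xs) (nthd ys (Suc i))) \<and> y = nthd ys n)" for n xs y
  proof
    assume "reval (Prim f g) (n # xs) y"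
    \<comment> \<open>The length is carried through the induction so that appending the next value
      leaves the earlier entries in place.\<close>
    hence "\<exists>ys. length ys = Suc n \<and> reval f xs (nthd ys 0) \<and>
      (\<forall>i<n. reval g (i # nthd ys i # xs) (nthd ys (Suc i))) \<and> y = nthd ys n"
    proof (induction n arbitrary: y)
      case 0 thus ?case by (intro exI[of _ "[y]"]) (simp add: reval_Prim_0_iff)
    next
      case (Suc n)
      then obtain y' where y': "reval (Prim f g) (n # xs) y'" "reval g (n # y' # xs) y"
        unfolding reval_Prim_Suc_iff by blast
      from Suc.IH[OF y'(1)] obtain ys where "length ys = Suc n" "reval f xs (nthd ys 0)"
        "\<forall>i<n. reval g (i # nthd ys i # xs) (nthd ys (Suc i))" "y' = nthd ys n" by blast
      note ys = this
      have "nthd (ys @ [y]) i = nthd ys i" if "i \<le> n" for i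
        using that ys(1) by (simp add: nth_append)
      moreover have "nthd (ys @ [y]) (Suc n) = y" using ys(1) by (simp add: nth_append)
      ultimately show ?case using ys y'(2)
        by (intro exI[of _ "ys @ [y]"]) (auto simp: less_Suc_eq simp del: nthd_nth)
    qed
    thus "\<exists>ys. reval f xs (nthd ys 0) \<and>
      (\<forall>i<n. reval g (i # nthd ys i # xs) (nthd ys (Suc i))) \<and> y = nthd ys n" by blast
  next
    assume "\<exists>ys. reval f xs (nthd ys 0) \<and>
      (\<forall>i<n. reval g (i # nthd ys i # xs) (nthd ys (Suc i))) \<and> y = nthd ys n"
    then obtain ys where ys: "reval f xs (nthd ys 0)"
      "\<forall>i<n. reval g (i # nthd ys i # xs) (nthd ys (Suc i))" "y = nthd ys n" by blast
    have "i \<le> n \<Longrightarrow> reval (Prim f g) (i # xs) (nthd ys i)" for i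
      using ys by (induction i) (auto simp: reval_Prim_0_iff reval_Prim_Suc_iff)
    with ys show "reval (Prim f g) (n # xs) y" by simp
  qed
  have all: "reval (Prim f g) zs y \<longleftrightarrow> (\<exists>p :: (nat \<times> nat list) \<times> nat list.
      zs = fst (fst p) # snd (fst p) \<and> reval f (snd (fst p)) (nthd (snd p) 0) \<and>
      (\<forall>i<fst (fst p). reval g (i # nthd (snd p) i # snd (fst p)) (nthd (snd p) (Suc i))) \<and>
      y = nthd (snd p) (fst (fst p)))" for zs y
    by (cases zs) (auto simp: reval_Prim_Nil_iff iff)
  show ?case unfolding all
    by (intro sig_ex sig_conj sig_All_less sig_o2[OF Prim(1)] sig_o2[OF Prim(2)]) (intro sig_dec cmp)+
next
  case (Mini f)
  show ?case unfolding reval_Mini_iff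
    by (intro sig_ex sig_conj sig_All_less sig_o2[OF Mini] cmp)
qed

text \<open>In contrast to \<open>cmp_Least\<close> the search may diverge. This is how the machine
  built from a test is realised: look for the index that has the given codeword and output its
  set.\<close>

lemma recf_search:
  fixes f :: "nat \<Rightarrow> nat"
  assumes D: "dec (\<lambda>e. D (fst e) (snd e))" and f: "cmp f"
  obtains r where "\<And>x y. reval r [x] y \<longleftrightarrow> (\<exists>m. D x m \<and> (\<forall>m'<m. \<not> D x m') \<and> y = f m)"
proof -
  have "computable (\<lambda>n. of_bool (\<not> D (fst (prod_decode n)) (snd (prod_decode n))))"
    using dec_not[OF D] unfolding dec_def cmp_def by (simp add: dcd_prod_def)
  moreover have "recursive (Suc (Suc 0)) (\<lambda>xs. prod_encode (xs ! Suc 0, xs ! 0))"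
    by (intro recursive_prod_encode recursive_nth) auto
  ultimately have "recursive (Suc (Suc 0)) (\<lambda>xs. of_bool (\<not> D (fst (prod_decode (prod_encode (xs ! Suc 0, xs ! 0))))
      (snd (prod_decode (prod_encode (xs ! Suc 0, xs ! 0))))))"
    unfolding computable_iff by (rule recursive_comp1)
  then obtain s where s: "\<And>xs. length xs = Suc (Suc 0) \<Longrightarrow> reval s xs (of_bool (\<not> D (xs ! Suc 0) (xs ! 0)))"
    unfolding recursive_def by auto
  have s: "reval s [m, x] (of_bool (\<not> D x m))" for m x using s[of "[m, x]"] by simp
  have s_iff: "reval s [m, x] y \<longleftrightarrow> y = of_bool (\<not> D x m)" for m x y
    using s reval_det[OF s] by blast
  from f obtain t where t: "\<And>x. reval t [x] (f x)"
    unfolding cmp_nat_iff computable_def partial_computable_def by auto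
  have "reval (Comp t [Mini s]) [x] y \<longleftrightarrow> (\<exists>m. D x m \<and> (\<forall>m'<m. \<not> D x m') \<and> y = f m)" for x y
  proof -
    have "reval (Comp t [Mini s]) [x] y \<longleftrightarrow> (\<exists>m. reval (Mini s) [x] m \<and> y = f m)"
      unfolding reval_Comp_iff list_all2_Cons1 using t reval_det[OF t] by auto
    thus ?thesis unfolding reval_Mini_iff s_iff by auto
  qed
  thus ?thesis using that by blast
qed

section \<open>A lower bound for nonzero algebraic numbers\<close>

text \<open>\<open>\<gamma>\<close> acts on the vector \<open>u\<close> as an integer matrix divided by an integer. For a fixed \<open>u\<close>
  such numbers are closed under ring operations, with explicit control of the entries, and the
  characteristic polynomial of the matrix keeps a nonzero \<open>\<gamma>\<close> away from \<open>0\<close>.\<close>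
definition int_rep :: "'i set \<Rightarrow> ('i \<Rightarrow> complex) \<Rightarrow> real \<Rightarrow> complex \<Rightarrow> bool" where
  "int_rep I u K \<gamma> \<longleftrightarrow> (\<exists>(A :: 'i \<Rightarrow> 'i \<Rightarrow> int) (a :: int). a \<noteq> 0 \<and> \<bar>real_of_int a\<bar> \<le> K \<and>
     (\<forall>i\<in>I. (\<Sum>j\<in>I. \<bar>real_of_int (A i j)\<bar>) \<le> K) \<and>
     (\<forall>i\<in>I. (\<Sum>j\<in>I. of_int (A i j) * u j) = of_int a * \<gamma> * u i))"

lemma int_rep_ge_1: "int_rep I u K \<gamma> \<Longrightarrow> 1 \<le> K"
proof -
  assume "int_rep I u K \<gamma>"
  then obtain a :: int where "a \<noteq> 0" "\<bar>real_of_int a\<bar> \<le> K" unfolding int_rep_def by blast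
  moreover from this(1) have "1 \<le> \<bar>real_of_int a\<bar>" by linarith
  ultimately show ?thesis by linarith
qed

text \<open>Common denominator a * b, with the matrix b * A + a * B. The factor 2 accounts for the
  two products K * L in a row sum.\<close>

lemma int_rep_add:
  assumes "int_rep I u K \<gamma>" "int_rep I u L \<delta>"
  shows "int_rep I u (2 * K * L) (\<gamma> + \<delta>)"
proof -
  have KL: "1 \<le> K" "1 \<le> L" using assms int_rep_ge_1 by blast+
  obtain A a where a: "a \<noteq> 0" "\<bar>real_of_int a\<bar> \<le> K"
      "\<And>i. i \<in> I \<Longrightarrow> (\<Sum>j\<in>I. \<bar>real_of_int (A i j)\<bar>) \<le> K"
      "\<And>i. i \<in> I \<Longrightarrow> (\<Sum>j\<in>I. of_int (A i j) * u j) = of_int a * \<gamma> * u i"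
    using assms(1) unfolding int_rep_def by blast
  obtain B b where b: "b \<noteq> 0" "\<bar>real_of_int b\<bar> \<le> L"
      "\<And>i. i \<in> I \<Longrightarrow> (\<Sum>j\<in>I. \<bar>real_of_int (B i j)\<bar>) \<le> L"
      "\<And>i. i \<in> I \<Longrightarrow> (\<Sum>j\<in>I. of_int (B i j) * u j) = of_int b * \<delta> * u i"
    using assms(2) unfolding int_rep_def by blast
  have ab: "\<bar>real_of_int a\<bar> * \<bar>real_of_int b\<bar> \<le> K * L" using a b KL by (intro mult_mono) auto
  have "0 \<le> K * L" using KL by simp
  hence 1: "\<bar>real_of_int (a * b)\<bar> \<le> 2 * K * L" using ab by (simp add: abs_mult)
  have 2: "(\<Sum>j\<in>I. \<bar>real_of_int (b * A i j + a * B i j)\<bar>) \<le> 2 * K * L" if "i \<in> I" for i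
  proof -
    have "(\<Sum>j\<in>I. \<bar>real_of_int (b * A i j + a * B i j)\<bar>) \<le>
        (\<Sum>j\<in>I. \<bar>real_of_int b\<bar> * \<bar>real_of_int (A i j)\<bar> + \<bar>real_of_int a\<bar> * \<bar>real_of_int (B i j)\<bar>)"
    proof (intro sum_mono)
      fix j
      show "\<bar>real_of_int (b * A i j + a * B i j)\<bar> \<le>
          \<bar>real_of_int b\<bar> * \<bar>real_of_int (A i j)\<bar> + \<bar>real_of_int a\<bar> * \<bar>real_of_int (B i j)\<bar>"
        using abs_triangle_ineq[of "real_of_int b * real_of_int (A i j)" "real_of_int a * real_of_int (B i j)"]
        by (simp add: abs_mult)
    qed
    also have "\<dots> = \<bar>real_of_int b\<bar> * (\<Sum>j\<in>I. \<bar>real_of_int (A i j)\<bar>) +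
        \<bar>real_of_int a\<bar> * (\<Sum>j\<in>I. \<bar>real_of_int (B i j)\<bar>)"
      by (simp add: sum.distrib sum_distrib_left)
    also have "\<dots> \<le> L * K + K * L"
      using a b that KL by (intro add_mono mult_mono sum_nonneg) auto
    finally show ?thesis by simp
  qed
  have 3: "(\<Sum>j\<in>I. of_int (b * A i j + a * B i j) * u j) = of_int (a * b) * (\<gamma> + \<delta>) * u i"
    if "i \<in> I" for i
  proof -
    have "(\<Sum>j\<in>I. of_int (b * A i j + a * B i j) * u j) =
        of_int b * (\<Sum>j\<in>I. of_int (A i j) * u j) + of_int a * (\<Sum>j\<in>I. of_int (B i j) * u j)"
      unfolding sum_distrib_left sum.distrib[symmetric]
      by (intro sum.cong refl) (simp add: algebra_simps)
    thus ?thesis using a(4) b(4) that by (simp add: algebra_simps)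
  qed
  show ?thesis unfolding int_rep_def
    by (rule exI[of _ "\<lambda>i j. b * A i j + a * B i j"], rule exI[of _ "a * b"])
      (use 1 2 3 a(1) b(1) in auto)
qed

text \<open>Both matrices have the same u as an eigenvector, so the product of the matrices acts on
  u by the product of the eigenvalues.\<close>

lemma int_rep_mult:
  assumes "int_rep I u K \<gamma>" "int_rep I u L \<delta>" "finite I"
  shows "int_rep I u (K * L) (\<gamma> * \<delta>)"
proof -
  have KL: "1 \<le> K" "1 \<le> L" using assms int_rep_ge_1 by blast+
  obtain A a where a: "a \<noteq> 0" "\<bar>real_of_int a\<bar> \<le> K"
      "\<And>i. i \<in> I \<Longrightarrow> (\<Sum>j\<in>I. \<bar>real_of_int (A i j)\<bar>) \<le> K"
      "\<And>i. i \<in> I \<Longrightarrow> (\<Sum>j\<in>I. of_int (A i j) * u j) = of_int a * \<gamma> * u i"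
    using assms(1) unfolding int_rep_def by blast
  obtain B b where b: "b \<noteq> 0" "\<bar>real_of_int b\<bar> \<le> L"
      "\<And>i. i \<in> I \<Longrightarrow> (\<Sum>j\<in>I. \<bar>real_of_int (B i j)\<bar>) \<le> L"
      "\<And>i. i \<in> I \<Longrightarrow> (\<Sum>j\<in>I. of_int (B i j) * u j) = of_int b * \<delta> * u i"
    using assms(2) unfolding int_rep_def by blast
  have 1: "\<bar>real_of_int (a * b)\<bar> \<le> K * L" using a b KL by (auto simp: abs_mult intro!: mult_mono)
  have 2: "(\<Sum>k\<in>I. \<bar>real_of_int (\<Sum>j\<in>I. A i j * B j k)\<bar>) \<le> K * L" if "i \<in> I" for i
  proof -
    have "(\<Sum>k\<in>I. \<bar>real_of_int (\<Sum>j\<in>I. A i j * B j k)\<bar>) \<le>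
        (\<Sum>k\<in>I. \<Sum>j\<in>I. \<bar>real_of_int (A i j)\<bar> * \<bar>real_of_int (B j k)\<bar>)"
    proof (intro sum_mono)
      fix k
      show "\<bar>real_of_int (\<Sum>j\<in>I. A i j * B j k)\<bar> \<le> (\<Sum>j\<in>I. \<bar>real_of_int (A i j)\<bar> * \<bar>real_of_int (B j k)\<bar>)"
        using sum_abs[of "\<lambda>j. real_of_int (A i j) * real_of_int (B j k)" I] by (simp add: abs_mult)
    qed
    also have "\<dots> = (\<Sum>j\<in>I. \<bar>real_of_int (A i j)\<bar> * (\<Sum>k\<in>I. \<bar>real_of_int (B j k)\<bar>))"
      by (subst sum.swap) (simp add: sum_distrib_left)
    also have "\<dots> \<le> (\<Sum>j\<in>I. \<bar>real_of_int (A i j)\<bar> * L)"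
      using b by (intro sum_mono mult_left_mono) auto
    also have "\<dots> \<le> K * L" using a that KL by (simp add: sum_distrib_right[symmetric])
    finally show ?thesis .
  qed
  have 3: "(\<Sum>k\<in>I. of_int (\<Sum>j\<in>I. A i j * B j k) * u k) = of_int (a * b) * (\<gamma> * \<delta>) * u i"
    if "i \<in> I" for i
  proof -
    have "(\<Sum>k\<in>I. of_int (\<Sum>j\<in>I. A i j * B j k) * u k) =
        (\<Sum>j\<in>I. of_int (A i j) * (\<Sum>k\<in>I. of_int (B j k) * u k))"
      by (simp add: sum_distrib_left sum_distrib_right mult.assoc) (rule sum.swap)
    also have "\<dots> = (\<Sum>j\<in>I. of_int (A i j) * (of_int b * \<delta> * u j))"
      using b(4) by (intro sum.cong) auto
    also have "\<dots> = of_int b * \<delta> * (\<Sum>j\<in>I. of_int (A i j) * u j)"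
      by (simp add: sum_distrib_left algebra_simps)
    finally show ?thesis using a(4) that by simp
  qed
  show ?thesis unfolding int_rep_def
    by (rule exI[of _ "\<lambda>i k. \<Sum>j\<in>I. A i j * B j k"], rule exI[of _ "a * b"])
      (use 1 2 3 a(1) b(1) in auto)
qed

lemma int_rep_uminus: "int_rep I u K \<gamma> \<Longrightarrow> int_rep I u K (- \<gamma>)"
proof -
  assume "int_rep I u K \<gamma>"
  then obtain A a where a: "a \<noteq> 0" "\<bar>real_of_int a\<bar> \<le> K"
      "\<And>i. i \<in> I \<Longrightarrow> (\<Sum>j\<in>I. \<bar>real_of_int (A i j)\<bar>) \<le> K"
      "\<And>i. i \<in> I \<Longrightarrow> (\<Sum>j\<in>I. of_int (A i j) * u j) = of_int a * \<gamma> * u i"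
    unfolding int_rep_def by blast
  thus ?thesis unfolding int_rep_def
    by (intro exI[of _ "\<lambda>i j. - A i j"] exI[of _ a]) (simp add: sum_negf)
qed

text \<open>Kronecker product with the identity of size d. Extending u by powers of a further number
  in this way makes room for that number and keeps what was represented before, with the same
  bound.\<close>

lemma int_rep_lift:
  assumes "int_rep I u K \<gamma>" "finite I"
  shows "int_rep (I \<times> {..<d::nat}) (\<lambda>p. u (fst p) * \<beta> ^ snd p) K \<gamma>"
proof -
  obtain A a where a: "a \<noteq> 0" "\<bar>real_of_int a\<bar> \<le> K"
      "\<And>i. i \<in> I \<Longrightarrow> (\<Sum>j\<in>I. \<bar>real_of_int (A i j)\<bar>) \<le> K"
      "\<And>i. i \<in> I \<Longrightarrow> (\<Sum>j\<in>I. of_int (A i j) * u j) = of_int a * \<gamma> * u i"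
    using assms(1) unfolding int_rep_def by blast
  let ?B = "\<lambda>p q. if snd p = snd q then A (fst p) (fst q) else 0"
  have "(\<Sum>q\<in>I \<times> {..<d}. \<bar>real_of_int (?B p q)\<bar>) \<le> K" if "p \<in> I \<times> {..<d}" for p
  proof -
    have "(\<Sum>q\<in>I \<times> {..<d}. \<bar>real_of_int (?B p q)\<bar>) =
        (\<Sum>j\<in>I. \<Sum>t<d. if snd p = t then \<bar>real_of_int (A (fst p) j)\<bar> else 0)"
      unfolding sum.cartesian_product by (intro sum.cong) auto
    also have "\<dots> = (\<Sum>j\<in>I. \<bar>real_of_int (A (fst p) j)\<bar>)" using that by (simp add: sum.delta mem_Times_iff)
    finally show ?thesis using a(3) that by auto
  qed
  moreover have "(\<Sum>q\<in>I \<times> {..<d}. of_int (?B p q) * (u (fst q) * \<beta> ^ snd q)) =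
      of_int a * \<gamma> * (u (fst p) * \<beta> ^ snd p)" if "p \<in> I \<times> {..<d}" for p
  proof -
    have "(\<Sum>q\<in>I \<times> {..<d}. of_int (?B p q) * (u (fst q) * \<beta> ^ snd q)) =
        (\<Sum>j\<in>I. \<Sum>t<d. if snd p = t then of_int (A (fst p) j) * (u j * \<beta> ^ t) else 0)"
      unfolding sum.cartesian_product by (intro sum.cong) auto
    also have "\<dots> = (\<Sum>j\<in>I. of_int (A (fst p) j) * u j) * \<beta> ^ snd p"
      using that by (simp add: sum.delta mem_Times_iff sum_distrib_right mult.assoc)
    finally show ?thesis using a(4)[of "fst p"] that by (auto simp: mult.assoc)
  qed
  ultimately show ?thesis unfolding int_rep_def using a(1,2)
    by (intro exI[of _ ?B] exI[of _ a]) blast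
qed

text \<open>The companion matrix, with denominator the leading coefficient.\<close>
lemma int_rep_root:
  fixes p :: "int poly"
  assumes "p \<noteq> 0" "poly (map_poly of_int p) \<beta> = 0" "(\<Sum>k\<le>degree p. \<bar>real_of_int (coeff p k)\<bar>) \<le> K" "finite I"
  shows "int_rep (I \<times> {..<degree p}) (\<lambda>p. u (fst p) * \<beta> ^ snd p) K \<beta>"
proof -
  define d where "d = degree p"
  define c where "c = coeff p"
  have cd: "c d \<noteq> 0" using assms(1) by (simp add: c_def d_def)
  have "poly (map_poly of_int p) \<beta> = (\<Sum>k\<le>d. of_int (c k) * \<beta> ^ k)"
    by (simp add: poly_altdef c_def d_def)
  hence root: "of_int (c d) * \<beta> ^ d = - (\<Sum>k<d. of_int (c k) * \<beta> ^ k)"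
    using assms(2) by (simp add: lessThan_Suc_atMost[symmetric] add_eq_0_iff)
  have K: "\<bar>real_of_int (c d)\<bar> + (\<Sum>k<d. \<bar>real_of_int (c k)\<bar>) \<le> K"
    using assms(3) by (simp add: lessThan_Suc_atMost[symmetric] c_def d_def)
  have K': "\<bar>real_of_int (c d)\<bar> \<le> K" "(\<Sum>k<d. \<bar>real_of_int (c k)\<bar>) \<le> K"
  proof -
    have "0 \<le> (\<Sum>k<d. \<bar>real_of_int (c k)\<bar>)" by (intro sum_nonneg) auto
    thus "\<bar>real_of_int (c d)\<bar> \<le> K" "(\<Sum>k<d. \<bar>real_of_int (c k)\<bar>) \<le> K" using K by linarith+
  qed
  define B where "B = (\<lambda>p q. if fst p = (fst q :: 'a) then
      (if Suc (snd p) < d then (if snd q = Suc (snd p) then c d else 0) else - c (snd q)) else 0)"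
  have "(\<Sum>q\<in>I \<times> {..<d}. \<bar>real_of_int (B p q)\<bar>) \<le> K" if "p \<in> I \<times> {..<d}" for p
  proof -
    have "(\<Sum>q\<in>I \<times> {..<d}. \<bar>real_of_int (B p q)\<bar>) =
        (\<Sum>j\<in>I. \<Sum>t<d. \<bar>real_of_int (B p (j, t))\<bar>)"
      unfolding sum.cartesian_product by (intro sum.cong) auto
    also have "\<dots> = (\<Sum>j\<in>I. if fst p = j then \<Sum>t<d. \<bar>real_of_int
        (if Suc (snd p) < d then (if t = Suc (snd p) then c d else 0) else - c t)\<bar> else 0)"
      unfolding B_def fst_conv snd_conv by (intro sum.cong refl) auto
    also have "\<dots> = (\<Sum>t<d. \<bar>real_of_int
        (if Suc (snd p) < d then (if t = Suc (snd p) then c d else 0) else - c t)\<bar>)"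
      using that assms(4) by (subst sum.delta') auto
    also have "\<dots> \<le> K"
    proof (cases "Suc (snd p) < d")
      case True
      have "(\<Sum>t<d. \<bar>real_of_int (if Suc (snd p) < d then (if t = Suc (snd p) then c d else 0) else - c t)\<bar>)
          = (\<Sum>t<d. if t = Suc (snd p) then \<bar>real_of_int (c d)\<bar> else 0)"
        using True by (intro sum.cong) auto
      thus ?thesis using True K' by (simp add: sum.delta')
    qed (use K' in simp)
    finally show ?thesis .
  qed
  moreover have "(\<Sum>q\<in>I \<times> {..<d}. of_int (B p q) * (u (fst q) * \<beta> ^ snd q)) =
      of_int (c d) * \<beta> * (u (fst p) * \<beta> ^ snd p)" if "p \<in> I \<times> {..<d}" for p
  proof -
    have "(\<Sum>q\<in>I \<times> {..<d}. of_int (B p q) * (u (fst q) * \<beta> ^ snd q)) =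
        (\<Sum>j\<in>I. \<Sum>t<d. of_int (B p (j, t)) * (u j * \<beta> ^ t))"
      unfolding sum.cartesian_product by (intro sum.cong) auto
    also have "\<dots> = (\<Sum>j\<in>I. if fst p = j then \<Sum>t<d. of_int
        (if Suc (snd p) < d then (if t = Suc (snd p) then c d else 0) else - c t) * (u j * \<beta> ^ t) else 0)"
      unfolding B_def fst_conv snd_conv by (intro sum.cong refl) auto
    also have "\<dots> = (\<Sum>t<d. of_int
        (if Suc (snd p) < d then (if t = Suc (snd p) then c d else 0) else - c t) * (u (fst p) * \<beta> ^ t))"
      using that assms(4) by (subst sum.delta') auto
    also have "\<dots> = of_int (c d) * \<beta> * (u (fst p) * \<beta> ^ snd p)"
    proof (cases "Suc (snd p) < d")
      case True
      have "(\<Sum>t<d. of_int (if Suc (snd p) < d then (if t = Suc (snd p) then c d else 0) else - c t) *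
          (u (fst p) * \<beta> ^ t)) = (\<Sum>t<d. if t = Suc (snd p) then of_int (c d) * (u (fst p) * \<beta> ^ t) else 0)"
        using True by (intro sum.cong) auto
      thus ?thesis using True by (simp add: sum.delta')
    next
      case False
      hence sp: "Suc (snd p) = d" using that by auto
      have "(\<Sum>t<d. of_int (- c t) * (u (fst p) * \<beta> ^ t)) = u (fst p) * - (\<Sum>t<d. of_int (c t) * \<beta> ^ t)"
        by (simp add: sum_distrib_left sum_negf algebra_simps)
      also have "\<dots> = u (fst p) * (of_int (c d) * (\<beta> * \<beta> ^ snd p))"
        unfolding root[symmetric] by (simp add: sp[symmetric])
      finally show ?thesis using False by (simp add: algebra_simps)
    qed
    finally show ?thesis .
  qed
  ultimately show ?thesis unfolding int_rep_def d_def[symmetric] using cd K'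
    by (intro exI[of _ B] exI[of _ "c d"]) blast
qed

section \<open>Spectral bounds for integer matrices\<close>

lemma norm_prod_list_le:
  fixes ys :: "'a::{real_normed_algebra_1} list"
  assumes "\<And>y. y \<in> set ys \<Longrightarrow> norm y \<le> K"
  shows "norm (prod_list ys) \<le> K ^ length ys"
  using assms
proof (induction ys)
  case (Cons y ys)
  have "norm (y * prod_list ys) \<le> norm y * norm (prod_list ys)" by (rule norm_mult_ineq)
  also have "\<dots> \<le> K * K ^ length ys"
  proof (intro mult_mono)
    show "0 \<le> K" using Cons.prems[of y] norm_ge_zero[of y] by (simp del: norm_ge_zero)
  qed (use Cons in auto)
  finally show ?case by simp
qed simp

text \<open>Read the eigenvalue equation at an entry of v of maximal modulus: the largest absolute
  row sum dominates every eigenvalue.\<close>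

lemma eigenvalue_norm_le:
  fixes M :: "complex mat"
  assumes M: "M \<in> carrier_mat n n" and "eigenvalue M x"
    and row: "\<And>i. i < n \<Longrightarrow> (\<Sum>j<n. norm (M $$ (i, j))) \<le> K"
  shows "norm x \<le> K"
proof -
  obtain v where v: "v \<in> carrier_vec n" "v \<noteq> 0\<^sub>v n" "M *\<^sub>v v = x \<cdot>\<^sub>v v"
    using assms(2) M unfolding eigenvalue_def eigenvector_def by auto
  have n: "n \<noteq> 0" using v by (auto simp: vec_eq_iff)
  obtain i where i: "i < n" and max: "\<And>j. j < n \<Longrightarrow> norm (v $ j) \<le> norm (v $ i)"
  proof -
    have "Max ((\<lambda>j. norm (v $ j)) ` {..<n}) \<in> (\<lambda>j. norm (v $ j)) ` {..<n}" using n by (intro Max_in) auto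
    then obtain i where "i < n" "norm (v $ i) = Max ((\<lambda>j. norm (v $ j)) ` {..<n})" by auto
    thus ?thesis using that[of i] by (auto intro!: Max_ge)
  qed
  obtain k where "k < n" "v $ k \<noteq> 0" using v(1,2) by (metis carrier_vecD eq_vecI index_zero_vec)
  have "0 < norm (v $ k)" using \<open>v $ k \<noteq> 0\<close> by simp
  also have "\<dots> \<le> norm (v $ i)" by (rule max) fact
  finally have pos: "0 < norm (v $ i)" .
  have "x * v $ i = (\<Sum>j<n. M $$ (i, j) * v $ j)"
    using arg_cong[OF v(3), of "\<lambda>w. w $ i"] i M v(1)
    by (auto simp: scalar_prod_def atLeast0LessThan)
  hence "norm x * norm (v $ i) = norm (\<Sum>j<n. M $$ (i, j) * v $ j)"
    unfolding norm_mult[symmetric] by (rule arg_cong)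
  also have "\<dots> \<le> (\<Sum>j<n. norm (M $$ (i, j)) * norm (v $ i))"
    by (intro sum_norm_le) (auto simp: norm_mult intro!: mult_left_mono max)
  also have "\<dots> \<le> K * norm (v $ i)"
    unfolding sum_distrib_right[symmetric] using row[OF i] by (intro mult_right_mono) auto
  finally show ?thesis using pos by simp
qed

text \<open>With a the denominator, \<open>a * \<gamma>\<close> is an eigenvalue, and no eigenvalue
  exceeds K in norm. The product of the nonzero eigenvalues is up to sign a nonzero integer; as all
  factors but one are at most K, that one cannot be small.\<close>

lemma int_rep_bounds:
  assumes rep: "int_rep I u K \<gamma>" and fin: "finite I" and nz: "\<exists>i\<in>I. u i \<noteq> 0"
  shows "norm \<gamma> \<le> K" "\<gamma> \<noteq> 0 \<Longrightarrow> 1 \<le> norm \<gamma> * K ^ card I" "algebraic \<gamma>"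
proof -
  obtain A a where a: "a \<noteq> 0" "\<bar>real_of_int a\<bar> \<le> K"
      "\<And>i. i \<in> I \<Longrightarrow> (\<Sum>j\<in>I. \<bar>real_of_int (A i j)\<bar>) \<le> K"
      "\<And>i. i \<in> I \<Longrightarrow> (\<Sum>j\<in>I. of_int (A i j) * u j) = of_int a * \<gamma> * u i"
    using rep unfolding int_rep_def by blast
  have a1: "1 \<le> \<bar>real_of_int a\<bar>" using a(1) by linarith
  have K1: "1 \<le> K" using a1 a(2) by linarith
  define N where "N = card I"
  obtain h where "bij_betw h {0..<N} I" using ex_bij_betw_nat_finite[OF fin] unfolding N_def by blast
  hence h: "bij_betw h {..<N} I" by (simp add: atLeast0LessThan)
  have hI: "h i \<in> I" if "i < N" for i using h that by (auto simp: bij_betw_def)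
  note reix = sum.reindex_bij_betw[OF h, symmetric]
  define M where "M = mat N N (\<lambda>(i, j). A (h i) (h j))"
  define MC where "MC = map_mat (of_int :: int \<Rightarrow> complex) M"
  define lam where "lam = of_int a * \<gamma>"
  have M: "M \<in> carrier_mat N N" and MC: "MC \<in> carrier_mat N N" by (auto simp: M_def MC_def)
  have "eigenvector MC (vec N (u \<circ> h)) lam"
    unfolding eigenvector_def
  proof (intro conjI)
    show "vec N (u \<circ> h) \<noteq> 0\<^sub>v (dim_row MC)"
    proof
      assume eq: "vec N (u \<circ> h) = 0\<^sub>v (dim_row MC)"
      obtain i where "i < N" "u (h i) \<noteq> 0" using nz h by (auto simp: bij_betw_def)
      thus False using arg_cong[OF eq, of "\<lambda>w. w $ i"] MC by simp
    qed
    show "MC *\<^sub>v vec N (u \<circ> h) = lam \<cdot>\<^sub>v vec N (u \<circ> h)"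
    proof (rule eq_vecI)
      fix i assume "i < dim_vec (lam \<cdot>\<^sub>v vec N (u \<circ> h))"
      hence i: "i < N" by simp
      have "(MC *\<^sub>v vec N (u \<circ> h)) $ i = (\<Sum>j<N. of_int (A (h i) (h j)) * u (h j))"
        using i by (simp add: MC_def M_def scalar_prod_def atLeast0LessThan)
      also have "\<dots> = lam * u (h i)" using a(4)[OF hI[OF i]] unfolding reix lam_def .
      finally show "(MC *\<^sub>v vec N (u \<circ> h)) $ i = (lam \<cdot>\<^sub>v vec N (u \<circ> h)) $ i" using i by simp
    qed (use MC in auto)
  qed (use MC in auto)
  hence ev: "eigenvalue MC lam" unfolding eigenvalue_def by blast
  have row: "(\<Sum>j<N. norm (MC $$ (i, j))) \<le> K" if "i < N" for i
    using a(3)[OF hI[OF that]] that by (simp add: reix MC_def M_def)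
  have evle: "norm x \<le> K" if "eigenvalue MC x" for x
    by (rule eigenvalue_norm_le[OF MC that row])
  have nlam: "norm lam = \<bar>real_of_int a\<bar> * norm \<gamma>" by (simp add: lam_def norm_mult)
  show "norm \<gamma> \<le> K"
  proof -
    have "1 * norm \<gamma> \<le> \<bar>real_of_int a\<bar> * norm \<gamma>" using a1 by (intro mult_right_mono) auto
    thus ?thesis using evle[OF ev] nlam by linarith
  qed
  define \<chi> where "\<chi> = char_poly M"
  have cpC: "char_poly MC = map_poly of_int \<chi>"
    unfolding MC_def \<chi>_def by (rule of_int_hom.char_poly_hom[OF M])
  have \<chi>0: "\<chi> \<noteq> 0" using degree_monic_char_poly[OF M] unfolding \<chi>_def by auto
  have root: "poly (map_poly of_int \<chi>) lam = 0"
    using ev unfolding eigenvalue_root_char_poly[OF MC] cpC .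
  show "algebraic \<gamma>"
  proof -
    have "algebraic lam"
      by (rule algebraicI[OF _ _ root]) (use \<chi>0 in auto)
    hence "algebraic lam" "a \<noteq> 0" using a by auto
    then obtain p where p: "\<And>i. coeff p i \<in> \<int>" "p \<noteq> 0" "poly p lam = 0" by (elim algebraicE) auto
    \<comment> \<open>If p vanishes at a * x, then the polynomial p(a X), which again has integer
      coefficients, vanishes at x.\<close>
    have "poly (p \<circ>\<^sub>p [:0, of_int a:]) \<gamma> = 0" using p(3) by (simp add: poly_pcompose lam_def mult.commute)
    moreover have "p \<circ>\<^sub>p [:0, of_int a:] \<noteq> 0" using p(2) a(1) by (simp add: pcompose_eq_0_iff)
    moreover have "coeff (p \<circ>\<^sub>p [:0, of_int a:]) i \<in> \<int>" for i
      using p(1) by (simp add: coeff_pcompose_linear)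
    ultimately show ?thesis by (intro algebraicI)
  qed
  show "1 \<le> norm \<gamma> * K ^ card I" if "\<gamma> \<noteq> 0"
  proof -
    obtain as :: "complex list" where as: "map_poly of_int \<chi> = (\<Prod>x\<leftarrow>as. [:- x, 1:])" and len: "length as = N"
      using char_poly_factorized[OF MC] unfolding cpC by blast
    have as_root: "poly (map_poly of_int \<chi>) x = 0 \<longleftrightarrow> x \<in> set as" for x :: complex
      unfolding as by (auto simp: poly_prod_list prod_list_zero_iff image_iff)
    define bs where "bs = filter (\<lambda>x. x \<noteq> 0) as"
    have split: "(\<Prod>x\<leftarrow>xs. [:- x, 1:]) = monom 1 (length (filter (\<lambda>x. x = 0) xs)) *
        (\<Prod>x\<leftarrow>filter (\<lambda>x. x \<noteq> 0) xs. [:- x, 1:])" for xs :: "complex list"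
      by (induction xs) (auto simp: monom_Suc algebra_simps)
    define z where "z = length (filter (\<lambda>x. x = 0) as)"
    \<comment> \<open>z is the multiplicity of the root 0, so this coefficient is the product of the
      negated nonzero eigenvalues.\<close>
    have "coeff (map_poly of_int \<chi> :: complex poly) z = coeff (\<Prod>x\<leftarrow>bs. [:- x, 1:]) 0"
      unfolding as split[of as] z_def bs_def by (simp add: coeff_monom_mult)
    also have "\<dots> = (\<Prod>x\<leftarrow>bs. - x)" by (simp add: poly_0_coeff_0[symmetric] poly_prod_list comp_def)
    finally have cz: "of_int (coeff \<chi> z) = (\<Prod>x\<leftarrow>bs. - x)" by simp
    hence "coeff \<chi> z \<noteq> 0" by (auto simp: bs_def prod_list_zero_iff dest!: sym[of "0::complex"])
    hence "1 \<le> \<bar>real_of_int (coeff \<chi> z)\<bar>" by linarith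
    also have "\<dots> = norm (of_int (coeff \<chi> z) :: complex)" by simp
    also have "\<dots> = norm (prod_list bs)"
      unfolding cz by (induction bs) (auto simp: norm_mult)
    also have "\<dots> = norm lam * norm (prod_list (remove1 lam bs))"
    proof -
      have "lam \<in> set bs" using root as_root that a(1) by (auto simp: bs_def lam_def)
      hence "prod_list bs = lam * prod_list (remove1 lam bs)" by (induction bs) auto
      thus ?thesis by (simp add: norm_mult)
    qed
    \<comment> \<open>Splitting off one occurrence of lam leaves at most N - 1 eigenvalues; the
      missing factor K returns when |a| is bounded by K below.\<close>
    also have "\<dots> \<le> norm lam * K ^ (N - 1)"
    proof (intro mult_left_mono)
      have l: "lam \<in> set bs" using root as_root that a(1) by (auto simp: bs_def lam_def)
      have "norm y \<le> K" if "y \<in> set (remove1 lam bs)" for y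
      proof (rule evle)
        have "y \<in> set as" using that notin_set_remove1[of y bs lam] by (auto simp: bs_def)
        thus "eigenvalue MC y" unfolding eigenvalue_root_char_poly[OF MC] cpC as_root .
      qed
      hence "norm (prod_list (remove1 lam bs)) \<le> K ^ length (remove1 lam bs)" by (rule norm_prod_list_le)
      also have "\<dots> \<le> K ^ (N - 1)"
      proof (rule power_increasing[OF _ K1])
        have "length bs \<le> N" using len by (auto simp: bs_def)
        thus "length (remove1 lam bs) \<le> N - 1" using l by (simp add: length_remove1)
      qed
      finally show "norm (prod_list (remove1 lam bs)) \<le> K ^ (N - 1)" .
    qed auto
    also have "\<dots> \<le> (K * norm \<gamma>) * K ^ (N - 1)"
      unfolding nlam using a(2) K1 by (intro mult_right_mono) auto
    also have "\<dots> = norm \<gamma> * K ^ N"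
    proof -
      have "N \<noteq> 0" using nz fin by (auto simp: N_def)
      then obtain N' where "N = Suc N'" by (cases N) auto
      thus ?thesis by simp
    qed
    finally show ?thesis by (simp add: N_def)
  qed
qed

text \<open>A crude height: one number bounds the degree, hence the size of the companion matrix,
  and the coefficients, hence its entries.\<close>

definition root_bound :: "nat \<Rightarrow> complex \<Rightarrow> bool" where
  "root_bound m \<alpha> \<longleftrightarrow> (\<exists>p :: int poly. p \<noteq> 0 \<and> degree p \<le> m \<and>
     (\<Sum>k\<le>degree p. \<bar>real_of_int (coeff p k)\<bar>) \<le> real m \<and> poly (map_poly of_int p) \<alpha> = 0)"

lemma root_bound_mono: "root_bound m \<alpha> \<Longrightarrow> m \<le> n \<Longrightarrow> root_bound n \<alpha>"
  unfolding root_bound_def by (meson of_nat_mono order_trans)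

text \<open>Adjoins one root: the dimension is multiplied by the degree, and everything represented
  so far stays represented.\<close>

lemma int_rep_extend:
  fixes u :: "'i \<Rightarrow> complex"
  assumes "root_bound m \<beta>" "finite I" "\<exists>i\<in>I. u i \<noteq> 0"
  shows "\<exists>(J :: ('i \<times> nat) set) u'. finite J \<and> card J \<le> card I * m \<and> (\<exists>i\<in>J. u' i \<noteq> 0) \<and>
    int_rep J u' (real m) \<beta> \<and> (\<forall>K \<gamma>. int_rep I u K \<gamma> \<longrightarrow> int_rep J u' K \<gamma>)"
proof -
  obtain p :: "int poly" where p: "p \<noteq> 0" "degree p \<le> m"
    "(\<Sum>k\<le>degree p. \<bar>real_of_int (coeff p k)\<bar>) \<le> real m" "poly (map_poly of_int p) \<beta> = 0"
    using assms(1) unfolding root_bound_def by blast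
  \<comment> \<open>A nonzero constant has no root. Positive degree provides the index (i, 0), where
    the new vector has the entry u i.\<close>
  have "degree p \<noteq> 0"
  proof
    assume "degree p = 0"
    then obtain c where "p = [:c:]" by (rule degree_eq_zeroE)
    thus False using p by simp
  qed
  let ?J = "I \<times> {..<degree p}" and ?u = "\<lambda>p. u (fst p) * \<beta> ^ snd p"
  have "\<exists>i\<in>?J. ?u i \<noteq> 0"
  proof -
    from assms(3) obtain i where "i \<in> I" "u i \<noteq> 0" by blast
    thus ?thesis using \<open>degree p \<noteq> 0\<close> by (intro bexI[of _ "(i, 0)"]) auto
  qed
  moreover have "int_rep ?J ?u (real m) \<beta>" by (rule int_rep_root[OF p(1,4,3) assms(2)])
  moreover have "finite ?J" "card ?J \<le> card I * m" using assms(2) p(2) by (auto simp: card_cartesian_product)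
  moreover have "\<forall>K \<gamma>. int_rep I u K \<gamma> \<longrightarrow> int_rep ?J ?u K \<gamma>"
    by (intro allI impI int_rep_lift assms(2))
  ultimately show ?thesis by (intro exI[of _ ?J] exI[of _ ?u] conjI)
qed

text \<open>Four is the number of roots in the identities a + b * c = e and a + b = c + e: the first
  is the arithmetic to be decided, the second compares real parts. The tower starts from the
  one-dimensional vector 1.\<close>

lemma int_rep_four:
  assumes "root_bound m a" "root_bound m b" "root_bound m c" "root_bound m e"
  obtains J :: "((((unit \<times> nat) \<times> nat) \<times> nat) \<times> nat) set" and u where
    "finite J" "card J \<le> m ^ 4" "\<exists>i\<in>J. u i \<noteq> 0"
    "int_rep J u (real m) a" "int_rep J u (real m) b" "int_rep J u (real m) c" "int_rep J u (real m) e"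
proof -
  have un: "finite (UNIV :: unit set)" "\<exists>i\<in>UNIV :: unit set. (\<lambda>_. 1 :: complex) i \<noteq> 0" by auto
  obtain J1 :: "(unit \<times> nat) set" and u1 where 1: "finite J1" "card J1 \<le> card (UNIV :: unit set) * m" "\<exists>i\<in>J1. u1 i \<noteq> 0"
    "int_rep J1 u1 (real m) a"
    using int_rep_extend[OF assms(1) un] by blast
  obtain J2 :: "((unit \<times> nat) \<times> nat) set" and u2 where 2: "finite J2" "card J2 \<le> card J1 * m"
    "\<exists>i\<in>J2. u2 i \<noteq> 0" "int_rep J2 u2 (real m) b" "\<And>K \<gamma>. int_rep J1 u1 K \<gamma> \<Longrightarrow> int_rep J2 u2 K \<gamma>"
    using int_rep_extend[OF assms(2) 1(1,3)] by blast
  obtain J3 :: "(((unit \<times> nat) \<times> nat) \<times> nat) set" and u3 where 3: "finite J3" "card J3 \<le> card J2 * m"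
    "\<exists>i\<in>J3. u3 i \<noteq> 0" "int_rep J3 u3 (real m) c" "\<And>K \<gamma>. int_rep J2 u2 K \<gamma> \<Longrightarrow> int_rep J3 u3 K \<gamma>"
    using int_rep_extend[OF assms(3) 2(1,3)] by blast
  obtain J4 :: "((((unit \<times> nat) \<times> nat) \<times> nat) \<times> nat) set" and u4 where 4: "finite J4" "card J4 \<le> card J3 * m"
    "\<exists>i\<in>J4. u4 i \<noteq> 0" "int_rep J4 u4 (real m) e" "\<And>K \<gamma>. int_rep J3 u3 K \<gamma> \<Longrightarrow> int_rep J4 u4 K \<gamma>"
    using int_rep_extend[OF assms(4) 3(1,3)] by blast
  have "card J4 \<le> m * m * m * m"
  proof -
    have "card J1 \<le> m" using 1(2) by simp
    hence "card J2 \<le> m * m" using 2(2) mult_le_mono1[of "card J1" m m] by linarith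
    hence "card J3 \<le> m * m * m" using 3(2) mult_le_mono1[of "card J2" "m * m" m] by linarith
    thus ?thesis using 4(2) mult_le_mono1[of "card J3" "m * m * m" m] by linarith
  qed
  thus ?thesis using that[of J4 u4] 1 2 3 4 by (auto simp: power4_eq_xxxx)
qed

text \<open>Entry bound to the power of the dimension: the expressions in four roots of height m
  occurring below have representations with bound at most 8 * m ^ 4 on at most m ^ 4
  indices.\<close>

definition sep :: "nat \<Rightarrow> nat" where
  "sep m = (8 * m ^ 4) ^ (m ^ 4)"

lemma root_bound_norm_le: "root_bound m a \<Longrightarrow> norm a \<le> real m"
  by (rule int_rep_four[of m a a a a]) (auto intro: int_rep_bounds(1))

lemma root_bound_separation:
  assumes "root_bound m a" "root_bound m b" "root_bound m c" "root_bound m e"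
  shows "a + b * c \<noteq> e \<Longrightarrow> 1 \<le> norm (a + b * c - e) * real (sep m)"
    "a + b \<noteq> c + e \<Longrightarrow> 1 \<le> norm (a + b - (c + e)) * real (sep m)"
    "algebraic (a + b * c)"
proof -
  obtain J :: "((((unit \<times> nat) \<times> nat) \<times> nat) \<times> nat) set" and u where J:
    "finite J" "card J \<le> m ^ 4" "\<exists>i\<in>J. u i \<noteq> 0"
    "int_rep J u (real m) a" "int_rep J u (real m) b" "int_rep J u (real m) c" "int_rep J u (real m) e"
    by (rule int_rep_four[OF assms])
  have m: "1 \<le> real m" by (rule int_rep_ge_1[OF J(4)])
  have bound: "1 \<le> norm x * real (sep m)" if "int_rep J u K x" "K \<le> 8 * real m ^ 4" "x \<noteq> 0" for x and K :: real
  proof -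
    have K: "1 \<le> K" by (rule int_rep_ge_1[OF that(1)])
    have "1 \<le> norm x * K ^ card J" by (rule int_rep_bounds(2)[OF that(1) J(1,3) that(3)])
    also have "K ^ card J \<le> K ^ (m ^ 4)" by (rule power_increasing[OF J(2) K])
    also have "\<dots> \<le> (8 * real m ^ 4) ^ (m ^ 4)" using that(2) K by (intro power_mono) auto
    finally show ?thesis by (simp add: sep_def mult_left_mono)
  qed
  have r1: "int_rep J u (2 * real m * (real m * real m)) (a + b * c)"
    using int_rep_add[OF J(4) int_rep_mult[OF J(5,6,1)]] by simp
  show "algebraic (a + b * c)" by (rule int_rep_bounds(3)[OF r1 J(1,3)])
  have "int_rep J u (2 * (2 * real m * (real m * real m)) * real m) (a + b * c - e)"
    using int_rep_add[OF r1 int_rep_uminus[OF J(7)]] by simp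
  moreover have "2 * (2 * real m * (real m * real m)) * real m \<le> 8 * real m ^ 4"
    by (simp add: power4_eq_xxxx)
  ultimately show "a + b * c \<noteq> e \<Longrightarrow> 1 \<le> norm (a + b * c - e) * real (sep m)" using bound by auto
  have "int_rep J u (2 * (2 * real m * real m) * (2 * real m * real m)) (a + b - (c + e))"
    unfolding diff_conv_add_uminus
    by (rule int_rep_add[OF int_rep_add[OF J(4,5)] int_rep_uminus[OF int_rep_add[OF J(6,7)]]])
  moreover have "2 * (2 * real m * real m) * (2 * real m * real m) \<le> 8 * real m ^ 4"
    by (simp add: power4_eq_xxxx)
  ultimately show "a + b \<noteq> c + e \<Longrightarrow> 1 \<le> norm (a + b - (c + e)) * real (sep m)" using bound by auto
qed

section \<open>Coded algebraic numbers\<close>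

lemma clex_less_linear: "w \<noteq> z \<Longrightarrow> clex_less w z \<or> clex_less z w"
  unfolding clex_less_def by (auto simp: complex_eq_iff)

lemma clex_less_irrefl: "\<not> clex_less z z"
  and clex_less_trans: "clex_less u w \<Longrightarrow> clex_less w z \<Longrightarrow> clex_less u z"
  unfolding clex_less_def by auto

definition below :: "complex set \<Rightarrow> complex \<Rightarrow> complex set" where
  "below A z = {w \<in> A. clex_less w z}"

lemma card_below_mono: "finite A \<Longrightarrow> w \<in> A \<Longrightarrow> clex_less w z \<Longrightarrow> card (below A w) < card (below A z)"
proof (rule psubset_card_mono)
  assume w: "w \<in> A" "clex_less w z"
  have "below A w \<subseteq> below A z" using w(2) by (auto simp: below_def intro: clex_less_trans)
  moreover have "w \<in> below A z" "w \<notin> below A w" using w by (auto simp: below_def clex_less_irrefl)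
  ultimately show "below A w \<subset> below A z" by blast
qed (auto simp: below_def)

lemma card_below_inj:
  "finite A \<Longrightarrow> w \<in> A \<Longrightarrow> z \<in> A \<Longrightarrow> card (below A w) = card (below A z) \<Longrightarrow> w = z"
  using card_below_mono[of A w z] card_below_mono[of A z w] clex_less_linear[of w z] by fastforce

lemma card_below_less: "finite A \<Longrightarrow> z \<in> A \<Longrightarrow> card (below A z) < card A"
proof (rule psubset_card_mono)
  assume z: "z \<in> A"
  have "below A z \<subseteq> A" by (auto simp: below_def)
  moreover have "z \<notin> below A z" by (auto simp: below_def clex_less_irrefl)
  ultimately show "below A z \<subset> A" using z by blast
qed

text \<open>Ranks are distinct and smaller than the cardinality, so by counting they exhaust it.
  Hence an index names no root only if it is at least the number of roots, a fact that a certificate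
  can establish.\<close>

lemma card_below_surj:
  assumes "finite A" "k < card A"
  shows "\<exists>z\<in>A. card (below A z) = k"
proof -
  have "inj_on (\<lambda>z. card (below A z)) A"
    by (rule inj_onI) (rule card_below_inj[OF assms(1)])
  hence "card ((\<lambda>z. card (below A z)) ` A) = card {..<card A}" by (simp add: card_image)
  moreover have "(\<lambda>z. card (below A z)) ` A \<subseteq> {..<card A}" using card_below_less[OF assms(1)] by auto
  ultimately have "(\<lambda>z. card (below A z)) ` A = {..<card A}" by (intro card_subset_eq) auto
  hence "k \<in> (\<lambda>z. card (below A z)) ` A" using assms(2) by simp
  thus ?thesis by auto
qed

definition code_coeffs :: "nat \<Rightarrow> int list" where
  "code_coeffs c = dcd (fst (prod_decode c))"

definition code_index :: "nat \<Rightarrow> nat" where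
  "code_index c = snd (prod_decode c)"

lemma cmp_code_coeffs [cmp]: "cmp f \<Longrightarrow> cmp (\<lambda>x. code_coeffs (f x))"
  and cmp_code_index [cmp]: "cmp f \<Longrightarrow> cmp (\<lambda>x. code_index (f x))"
proof -
  have *: "prod_decode n = (dcd n :: nat \<times> nat)" for n by (simp add: dcd_prod_def)
  show "cmp f \<Longrightarrow> cmp (\<lambda>x. code_coeffs (f x))" "cmp f \<Longrightarrow> cmp (\<lambda>x. code_index (f x))"
    unfolding code_coeffs_def code_index_def * by (intro cmp; assumption)+
qed

definition croots :: "int list \<Rightarrow> complex set" where
  "croots cs = {z. poly (Poly (map of_int cs)) z = 0}"

lemma Poly_of_int: "Poly (map of_int cs) = map_poly (of_int :: int \<Rightarrow> complex) (Poly cs)"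
  by (rule poly_eqI) (simp add: coeff_Poly_eq coeff_map_poly nth_default_def)

lemma Poly_of_int_eq_0_iff: "Poly (map of_int cs) = (0 :: complex poly) \<longleftrightarrow> (\<forall>a\<in>set cs. a = 0)"
  by (induction cs) auto

lemma finite_croots: "Poly (map of_int cs) \<noteq> (0 :: complex poly) \<Longrightarrow> finite (croots cs)"
  unfolding croots_def by (rule poly_roots_finite)

lemma alg_decode_altdef:
  "alg_decode c = (let A = croots (code_coeffs c) in
     if (\<exists>a\<in>set (code_coeffs c). a \<noteq> 0) \<and> (\<exists>z\<in>A. card (below A z) = code_index c)
     then THE z. z \<in> A \<and> card (below A z) = code_index c else 0)"
proof -
  have 1: "int_poly_decode (fst (prod_decode c)) = Poly (map of_int (code_coeffs c))"
    by (simp add: int_poly_decode_def code_coeffs_def dcd_list_def dcd_int_def comp_def)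
  have 2: "{w. poly (Poly (map of_int cs)) w = 0 \<and> clex_less w z} = below (croots cs) z" for cs z
    by (auto simp: below_def croots_def)
  show ?thesis
    unfolding alg_decode_def Let_def case_prod_unfold 1 2 Poly_of_int_eq_0_iff
    by (auto simp: croots_def code_index_def Bex_def)
qed

lemma alg_decode_eqI:
  assumes "\<exists>a\<in>set (code_coeffs c). a \<noteq> 0" "z \<in> croots (code_coeffs c)"
    "card (below (croots (code_coeffs c)) z) = code_index c"
  shows "alg_decode c = z"
proof -
  have fin: "finite (croots (code_coeffs c))"
    using assms(1) by (intro finite_croots) (auto simp: Poly_of_int_eq_0_iff)
  have "(THE z. z \<in> croots (code_coeffs c) \<and> card (below (croots (code_coeffs c)) z) = code_index c) = z"
    using assms card_below_inj[OF fin] by (intro the_equality) auto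
  thus ?thesis unfolding alg_decode_altdef Let_def using assms by auto
qed

text \<open>The default 0 arises in two ways, from the zero polynomial and from an index out of
  range, which have to be certified differently.\<close>

lemma alg_decode_cases:
  obtains (root) "\<exists>a\<in>set (code_coeffs c). a \<noteq> 0" "alg_decode c \<in> croots (code_coeffs c)"
    "card (below (croots (code_coeffs c)) (alg_decode c)) = code_index c"
  | (zero) "\<forall>a\<in>set (code_coeffs c). a = 0" "alg_decode c = 0"
  | (none) "\<exists>a\<in>set (code_coeffs c). a \<noteq> 0" "card (croots (code_coeffs c)) \<le> code_index c" "alg_decode c = 0"
proof -
  let ?A = "croots (code_coeffs c)"
  show ?thesis
  proof (cases "\<exists>a\<in>set (code_coeffs c). a \<noteq> 0")
    case nz: True
    hence fin: "finite ?A" by (intro finite_croots) (auto simp: Poly_of_int_eq_0_iff)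
    show ?thesis
    proof (cases "\<exists>z\<in>?A. card (below ?A z) = code_index c")
      case True
      then obtain z where "z \<in> ?A" "card (below ?A z) = code_index c" by blast
      with alg_decode_eqI[OF nz this] show ?thesis using root nz by simp
    next
      case False
      moreover from this have "card ?A \<le> code_index c" using card_below_surj[OF fin] not_le by blast
      ultimately show ?thesis using none nz by (simp add: alg_decode_altdef Let_def)
    qed
  next
    case False
    thus ?thesis using zero by (simp add: alg_decode_altdef Let_def)
  qed
qed

lemma algebraic_croots:
  "\<exists>a\<in>set cs. a \<noteq> 0 \<Longrightarrow> z \<in> croots cs \<Longrightarrow> algebraic z"
proof (rule algebraicI[of "Poly (map of_int cs)"])
  assume "\<exists>a\<in>set cs. a \<noteq> 0"
  thus "Poly (map of_int cs) \<noteq> (0 :: complex poly)" unfolding Poly_of_int_eq_0_iff by blast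
qed (simp_all add: croots_def Poly_of_int coeff_map_poly)

lemma algebraic_alg_decode: "algebraic (alg_decode c)"
  by (cases c rule: alg_decode_cases) (auto intro: algebraic_croots)

text \<open>Take any integer polynomial with root z and the rank of z among its roots. Surjectivity
  guarantees that a search for the code of an algebraic result succeeds.\<close>

lemma alg_decode_surj:
  assumes "algebraic z"
  shows "\<exists>c. alg_decode c = z"
proof -
  obtain p where p: "\<And>i. coeff p i \<in> \<int>" "p \<noteq> 0" "poly p z = 0"
    using assms by (elim algebraicE) auto
  define cs :: "int list" where "cs = map (\<lambda>a. SOME i. a = of_int i) (coeffs p)"
  have cs: "map of_int cs = coeffs p"
  proof -
    have "of_int (SOME i. coeff p k = of_int i) = coeff p k" for k
      using someI_ex[of "\<lambda>i. coeff p k = of_int i"] p(1)[of k] by (auto elim: Ints_cases)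
    thus ?thesis by (auto simp: cs_def coeffs_def)
  qed
  hence P: "Poly (map of_int cs) = p" by simp
  let ?c = "prod_encode (enc cs, card (below (croots cs) z))"
  have "code_coeffs ?c = cs" "code_index ?c = card (below (croots cs) z)"
    by (simp_all add: code_coeffs_def code_index_def)
  hence "alg_decode ?c = z"
    using p P Poly_of_int_eq_0_iff[of cs] by (intro alg_decode_eqI) (auto simp: croots_def)
  thus ?thesis by blast
qed

text \<open>A code up to m contains a list of at most m coefficients, each of absolute value at most
  m, because codes of entries do not exceed the code of a list. This bounds both the number and the
  total size of the coefficients.\<close>

definition hgt :: "nat \<Rightarrow> nat" where "hgt m = (Suc m)\<^sup>2"

lemma sum_list_abs_code_coeffs:
  assumes "c \<le> m"
  shows "sum_list (map abs (code_coeffs c)) \<le> int (hgt m)" "length (code_coeffs c) \<le> hgt m"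
proof -
  have "enc (code_coeffs c) \<le> c"
    using le_prod_encode_1[of "fst (prod_decode c)" "snd (prod_decode c)"] by (simp add: code_coeffs_def)
  hence e: "enc (code_coeffs c) \<le> m" using assms by simp
  have abs_le: "\<bar>i\<bar> \<le> int (enc i)" for i :: int
    by (auto simp: enc_int_def int_encode_def sum_encode_def)
  have l: "length (code_coeffs c) \<le> m" using length_le_enc[of "code_coeffs c"] e by linarith
  have "sum_list (map abs xs) \<le> int (length xs) * int m" if "\<And>x. x \<in> set xs \<Longrightarrow> \<bar>x\<bar> \<le> int m" for xs :: "int list"
    using that by (induction xs) (auto simp: algebra_simps intro: add_mono)
  moreover have "\<bar>x\<bar> \<le> int m" if "x \<in> set (code_coeffs c)" for x
    using enc_mem_less[OF that] abs_le[of x] e by linarith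
  ultimately have "sum_list (map abs (code_coeffs c)) \<le> int (length (code_coeffs c)) * int m" by blast
  also have "\<dots> \<le> int m * int m" using l by (intro mult_right_mono) auto
  also have "\<dots> \<le> int (hgt m)" by (simp add: hgt_def power2_eq_square)
  finally show "sum_list (map abs (code_coeffs c)) \<le> int (hgt m)" .
  show "length (code_coeffs c) \<le> hgt m" using l by (simp add: hgt_def power2_eq_square)
qed

lemma root_bound_croots:
  assumes "\<exists>a\<in>set (code_coeffs c). a \<noteq> 0" "z \<in> croots (code_coeffs c)" "c \<le> m"
  shows "root_bound (hgt m) z"
proof -
  let ?cs = "code_coeffs c" and ?p = "Poly (code_coeffs c)"
  have nz: "map_poly of_int ?p \<noteq> (0 :: complex poly)"
    using assms(1) unfolding Poly_of_int[symmetric] Poly_of_int_eq_0_iff by auto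
  have deg: "degree ?p < length ?cs"
  proof -
    have "?cs \<noteq> []" using assms(1) by auto
    thus ?thesis by (intro le_less_trans[OF degree_le, of "length ?cs - 1"])
        (auto simp: coeff_Poly_eq nth_default_def)
  qed
  have "(\<Sum>k\<le>degree ?p. \<bar>coeff ?p k\<bar>) \<le> (\<Sum>k<length ?cs. \<bar>coeff ?p k\<bar>)"
    using deg by (intro sum_mono2) auto
  also have "\<dots> = sum_list (map abs ?cs)"
    unfolding sum_list_sum_nth by (intro sum.cong) (auto simp: coeff_Poly_eq nth_default_def)
  also have "\<dots> \<le> int (hgt m)" by (rule sum_list_abs_code_coeffs(1)[OF assms(3)])
  finally have "real_of_int (\<Sum>k\<le>degree ?p. \<bar>coeff ?p k\<bar>) \<le> real_of_int (int (hgt m))"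
    by (rule of_int_le_iff[THEN iffD2])
  hence "(\<Sum>k\<le>degree ?p. \<bar>real_of_int (coeff ?p k)\<bar>) \<le> real (hgt m)" by simp
  thus ?thesis unfolding root_bound_def
    using nz deg sum_list_abs_code_coeffs(2)[OF assms(3)] assms(2)
    by (intro exI[of _ ?p]) (auto simp: croots_def Poly_of_int)
qed

lemma root_bound_0: "1 \<le> m \<Longrightarrow> root_bound m 0"
  unfolding root_bound_def by (intro exI[of _ "[:0, 1:]"]) auto

lemma root_bound_alg_decode: "c \<le> m \<Longrightarrow> root_bound (hgt m) (alg_decode c)"
proof -
  assume "c \<le> m"
  have "root_bound (hgt m) 0" by (rule root_bound_0) (simp add: hgt_def)
  thus ?thesis using \<open>c \<le> m\<close> by (cases c rule: alg_decode_cases) (auto intro: root_bound_croots)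
qed

lemma root_bound_cnj: "root_bound m z \<Longrightarrow> root_bound m (cnj z)"
proof -
  have "poly (map_poly of_int p) (cnj z) = cnj (poly (map_poly of_int p) z)" for p :: "int poly"
    by (simp add: poly_altdef)
  thus "root_bound m z \<Longrightarrow> root_bound m (cnj z)" unfolding root_bound_def by auto
qed

lemma algebraic_root_bound: "algebraic z \<Longrightarrow> \<exists>m. root_bound m z"
  using alg_decode_surj root_bound_alg_decode by blast

text \<open>The integer matrices built for the separation bound also give closure of the algebraic
  numbers under ring operations, through their characteristic polynomials.\<close>

lemma algebraic_add_mult:
  assumes "algebraic a" "algebraic b" "algebraic c"
  shows "algebraic (a + b * c :: complex)"
proof -
  obtain m1 m2 m3 where "root_bound m1 a" "root_bound m2 b" "root_bound m3 c"
    using assms[THEN algebraic_root_bound] by blast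
  hence "root_bound (m1 + m2 + m3) a" "root_bound (m1 + m2 + m3) b" "root_bound (m1 + m2 + m3) c"
    by (auto elim!: root_bound_mono)
  from root_bound_separation(3)[OF this this(3)] show ?thesis .
qed

lemma algebraic_mult: "algebraic b \<Longrightarrow> algebraic c \<Longrightarrow> algebraic (b * c :: complex)"
  using algebraic_add_mult[of 0 b c] by simp

lemma algebraic_add: "algebraic a \<Longrightarrow> algebraic b \<Longrightarrow> algebraic (a + b :: complex)"
  using algebraic_add_mult[of a b 1] by simp

lemma algebraic_diff: "algebraic a \<Longrightarrow> algebraic b \<Longrightarrow> algebraic (a - b :: complex)"
  using algebraic_add[of a "- b"] by auto

lemma algebraic_sum: "(\<And>i. i \<in> A \<Longrightarrow> algebraic (f i :: complex)) \<Longrightarrow> algebraic (\<Sum>i\<in>A. f i)"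
  by (induction A rule: infinite_finite_induct) (auto intro: algebraic_add)

section \<open>Approximating coded algebraic numbers\<close>

text \<open>Horner's scheme at the point q / D with denominators cleared: the state holds the real
  and the imaginary part of D^k times the value, together with D^k, where k coefficients have been
  consumed.\<close>

definition horner :: "int \<Rightarrow> int \<times> int \<Rightarrow> int list \<Rightarrow> (int \<times> int) \<times> int" where
  "horner D q cs = foldr (\<lambda>a s. ((a * snd s * D + fst q * fst (fst s) - snd q * snd (fst s),
     fst q * snd (fst s) + snd q * fst (fst s)), snd s * D)) cs ((0, 0), 1)"

lemma horner:
  assumes "D \<noteq> 0"
  shows "snd (horner D q cs) = D ^ length cs"
    "Complex (of_int (fst (fst (horner D q cs)))) (of_int (snd (fst (horner D q cs)))) =
     of_int D ^ length cs * poly (Poly (map of_int cs)) (Complex (of_int (fst q) / of_int D) (of_int (snd q) / of_int D))"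
proof (induction cs)
  case Nil
  show "snd (horner D q []) = D ^ length []" by (simp add: horner_def)
  show "Complex (of_int (fst (fst (horner D q [])))) (of_int (snd (fst (horner D q [])))) =
     of_int D ^ length [] * poly (Poly (map of_int [])) (Complex (of_int (fst q) / of_int D) (of_int (snd q) / of_int D))"
    by (simp add: horner_def complex_eq_iff)
next
  case (Cons a cs)
  let ?s = "horner D q cs" and ?z = "Complex (of_int (fst q) / of_int D) (of_int (snd q) / of_int D)"
  have step: "horner D q (a # cs) = ((a * snd ?s * D + fst q * fst (fst ?s) - snd q * snd (fst ?s),
     fst q * snd (fst ?s) + snd q * fst (fst ?s)), snd ?s * D)" by (simp add: horner_def)
  show "snd (horner D q (a # cs)) = D ^ length (a # cs)" by (simp add: step Cons)
  have z: "of_int D * ?z = Complex (of_int (fst q)) (of_int (snd q))"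
    using assms by (simp add: complex_eq_iff)
  have "of_int D ^ length (a # cs) * poly (Poly (map of_int (a # cs))) ?z =
      of_int a * of_int D ^ length cs * of_int D + (of_int D * ?z) *
        (of_int D ^ length cs * poly (Poly (map of_int cs)) ?z)"
    by (simp add: algebra_simps)
  also have "\<dots> = Complex (of_int (fst (fst (horner D q (a # cs))))) (of_int (snd (fst (horner D q (a # cs)))))"
    unfolding z Cons(2)[symmetric] step Cons(1) by (simp add: complex_eq_iff Re_power_real Im_power_real flip: of_int_power)
  finally show "Complex (of_int (fst (fst (horner D q (a # cs))))) (of_int (snd (fst (horner D q (a # cs))))) =
     of_int D ^ length (a # cs) * poly (Poly (map of_int (a # cs))) ?z" by simp
qed

text \<open>The value at q is the leading coefficient times the product of the differences of q to
  the roots. If all of these were at least e in norm, the product would be at least e^n, as e is at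
  most 1.\<close>

lemma root_near:
  fixes p :: "complex poly"
  assumes "degree p \<le> n" "0 < e" "e \<le> 1" "1 \<le> norm (lead_coeff p)" "norm (poly p q) < e ^ n"
  shows "\<exists>a. poly p a = 0 \<and> norm (q - a) < e"
proof (rule ccontr)
  assume no: "\<not> ?thesis"
  obtain as where as: "smult (lead_coeff p) (\<Prod>a\<leftarrow>as. [:- a, 1:]) = p" "length as = degree p"
    using fundamental_theorem_algebra_factorized[of p] by blast
  have root: "poly p a = 0" if "a \<in> set as" for a
    by (subst as(1)[symmetric]) (use that in \<open>auto simp: poly_prod_list prod_list_zero_iff image_iff\<close>)
  have "e ^ length xs \<le> norm (\<Prod>a\<leftarrow>xs. q - a)" if "\<And>a. a \<in> set xs \<Longrightarrow> e \<le> norm (q - a)" for xs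
    using that
  proof (induction xs)
    case (Cons x xs)
    have "e * e ^ length xs \<le> norm (q - x) * norm (\<Prod>a\<leftarrow>xs. q - a)"
      using Cons assms(2) by (intro mult_mono) auto
    thus ?case by (simp add: norm_mult)
  qed simp
  from this[of as] have 1: "e ^ degree p \<le> norm (\<Prod>a\<leftarrow>as. q - a)"
    using no root as(2) by (auto simp: not_less)
  have "poly p q = lead_coeff p * (\<Prod>a\<leftarrow>as. q - a)"
    by (subst as(1)[symmetric]) (simp add: poly_prod_list comp_def)
  hence "norm (poly p q) = norm (lead_coeff p) * norm (\<Prod>a\<leftarrow>as. q - a)" by (simp add: norm_mult)
  moreover have "1 * norm (\<Prod>a\<leftarrow>as. q - a) \<le> norm (lead_coeff p) * norm (\<Prod>a\<leftarrow>as. q - a)"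
    using assms(4) by (intro mult_right_mono) auto
  moreover have "e ^ n \<le> e ^ degree p" using assms by (intro power_decreasing) auto
  ultimately show False using assms(5) 1 by linarith
qed

text \<open>A size and a Lipschitz estimate on the disc of radius R, proved together along Horner's
  scheme. The difference of a + x * P x at two points splits into q times the difference for P and
  (q - \<alpha>) times P \<alpha>; the size bound controls the latter.\<close>

lemma poly_bound:
  fixes q \<alpha> :: complex
  assumes "1 \<le> R" "norm q \<le> R" "norm \<alpha> \<le> R"
  shows "norm (poly (Poly (map of_int cs)) \<alpha>) \<le> of_int (sum_list (map abs cs)) * R ^ length cs"
    "norm (poly (Poly (map of_int cs)) q - poly (Poly (map of_int cs)) \<alpha>) \<le>
      norm (q - \<alpha>) * (of_int (sum_list (map abs cs)) * real (length cs) * R ^ length cs)"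
proof (induction cs)
  case (Cons a cs)
  define S where "S = real_of_int (sum_list (map abs cs))"
  define P where "P = (\<lambda>z. poly (Poly (map of_int cs)) z :: complex)"
  define L where "L = length cs"
  have S0: "0 \<le> S" proof -
    have "0 \<le> sum_list (map abs cs)" by (intro sum_list_nonneg) auto
    thus ?thesis by (simp add: S_def)
  qed
  have R0: "1 \<le> R ^ L" using assms(1) by simp
  have 1: "norm (P \<alpha>) \<le> S * R ^ L" and 2: "norm (P q - P \<alpha>) \<le> norm (q - \<alpha>) * (S * real L * R ^ L)"
    using Cons by (simp_all add: S_def P_def L_def)
  have sum: "real_of_int (sum_list (map abs (a # cs))) = \<bar>real_of_int a\<bar> + S" by (simp add: S_def)
  have poly: "poly (Poly (map of_int (a # cs))) z = of_int a + z * P z" for z by (simp add: P_def)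
  have len: "length (a # cs) = Suc L" by (simp add: L_def)
  have R1: "1 \<le> R * R ^ L" using assms(1) R0 mult_mono[of 1 R 1 "R ^ L"] by simp
  show "norm (poly (Poly (map of_int (a # cs))) \<alpha>) \<le> of_int (sum_list (map abs (a # cs))) * R ^ length (a # cs)"
    unfolding sum poly len
  proof -
    have "norm (of_int a + \<alpha> * P \<alpha>) \<le> norm (of_int a :: complex) + norm \<alpha> * norm (P \<alpha>)"
      unfolding norm_mult[symmetric] by (rule norm_triangle_ineq)
    also have "\<dots> \<le> \<bar>real_of_int a\<bar> * (R * R ^ L) + R * (S * R ^ L)"
    proof (rule add_mono)
      show "norm (of_int a :: complex) \<le> \<bar>real_of_int a\<bar> * (R * R ^ L)"
        using mult_left_mono[OF R1, of "\<bar>real_of_int a\<bar>"] by simp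
      show "norm \<alpha> * norm (P \<alpha>) \<le> R * (S * R ^ L)" using 1 assms by (intro mult_mono) auto
    qed
    finally show "norm (of_int a + \<alpha> * P \<alpha>) \<le> (\<bar>real_of_int a\<bar> + S) * R ^ Suc L" by (simp add: algebra_simps)
  qed
  show "norm (poly (Poly (map of_int (a # cs))) q - poly (Poly (map of_int (a # cs))) \<alpha>) \<le>
      norm (q - \<alpha>) * (of_int (sum_list (map abs (a # cs))) * real (length (a # cs)) * R ^ length (a # cs))"
    unfolding sum poly len
  proof -
    have "of_int a + q * P q - (of_int a + \<alpha> * P \<alpha>) = q * (P q - P \<alpha>) + (q - \<alpha>) * P \<alpha>" by (simp add: algebra_simps)
    hence "norm (of_int a + q * P q - (of_int a + \<alpha> * P \<alpha>)) \<le> norm q * norm (P q - P \<alpha>) + norm (q - \<alpha>) * norm (P \<alpha>)"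
      unfolding norm_mult[symmetric] by (simp only: norm_triangle_ineq)
    also have "\<dots> \<le> R * (norm (q - \<alpha>) * (S * real L * R ^ L)) + norm (q - \<alpha>) * (S * R ^ L)"
      using 1 2 assms by (intro add_mono mult_mono) auto
    also have "\<dots> \<le> R * (norm (q - \<alpha>) * (S * real L * R ^ L)) + norm (q - \<alpha>) * (R * (S * R ^ L))"
      using assms(1) S0 R0 mult_right_mono[of 1 R "S * R ^ L"] by (intro add_left_mono mult_left_mono) simp_all
    also have "\<dots> = norm (q - \<alpha>) * (S * real (Suc L) * (R * R ^ L))" by (simp add: algebra_simps)
    also have "\<dots> \<le> norm (q - \<alpha>) * ((\<bar>real_of_int a\<bar> + S) * real (Suc L) * R ^ Suc L)"
    proof (rule mult_left_mono)
      show "S * real (Suc L) * (R * R ^ L) \<le> (\<bar>real_of_int a\<bar> + S) * real (Suc L) * R ^ Suc L"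
        using R1 unfolding power_Suc by (intro mult_right_mono) auto
    qed simp
    finally show "norm (of_int a + q * P q - (of_int a + \<alpha> * P \<alpha>)) \<le>
      norm (q - \<alpha>) * ((\<bar>real_of_int a\<bar> + S) * real (Suc L) * R ^ Suc L)" .
  qed
qed auto

text \<open>Precisions for codes up to \<open>m\<close>: roots lie at distance at least \<open>1 / (2 * qsep m)\<close> in the real or
  in the imaginary part, the test below finds roots up to \<open>2 ^ - jprec m\<close>, and the
  grid has mesh \<open>2 ^ - kprec m\<close>.\<close>
definition qsep :: "nat \<Rightarrow> nat" where "qsep m = sep (hgt m)"
definition jprec :: "nat \<Rightarrow> nat" where "jprec m = 16 * qsep m * (2 * hgt m + 3)"
definition kprec :: "nat \<Rightarrow> nat" where
  "kprec m = 2 + jprec m * hgt m + (hgt m + 2) * hgt m + 2 * hgt m"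
text \<open>Coordinates of size at most hgt m + 1 have codes at most 2 * (hgt m + 1) * 2 ^ kprec m +
  1, and the code of a pair is at most the square of one more than the sum of its parts. Below this
  bound lies an approximation of every root in question.\<close>

definition grid_bound :: "nat \<Rightarrow> nat" where
  "grid_bound m = Suc ((4 * (hgt m + 1) * 2 ^ kprec m + 3)\<^sup>2)"

lemma cmp_sep [cmp]: "cmp f \<Longrightarrow> cmp (\<lambda>x. sep (f x))"
  unfolding sep_def by (intro cmp)
lemma cmp_hgt [cmp]: "cmp f \<Longrightarrow> cmp (\<lambda>x. hgt (f x))"
  unfolding hgt_def by (intro cmp)
lemma cmp_qsep [cmp]: "cmp f \<Longrightarrow> cmp (\<lambda>x. qsep (f x))"
  unfolding qsep_def by (intro cmp)
lemma cmp_jprec [cmp]: "cmp f \<Longrightarrow> cmp (\<lambda>x. jprec (f x))"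
  unfolding jprec_def by (intro cmp)
lemma cmp_kprec [cmp]: "cmp f \<Longrightarrow> cmp (\<lambda>x. kprec (f x))"
  unfolding kprec_def by (intro cmp)
lemma cmp_grid_bound [cmp]: "cmp f \<Longrightarrow> cmp (\<lambda>x. grid_bound (f x))"
  unfolding grid_bound_def by (intro cmp)

definition gval :: "nat \<Rightarrow> int \<times> int \<Rightarrow> complex" where
  "gval m q = Complex (of_int (fst q) / 2 ^ kprec m) (of_int (snd q) / 2 ^ kprec m)"

text \<open>The inequality |p(q)| < \<open>prec m ^ length cs\<close>, squared and with denominators
  cleared, so that it compares integers.\<close>

definition near :: "nat \<Rightarrow> int list \<Rightarrow> int \<times> int \<Rightarrow> bool" where
  "near m cs q \<longleftrightarrow> (let s = horner (int (2 ^ kprec m)) q cs in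
     (fst (fst s) * fst (fst s) + snd (fst s) * snd (fst s)) * int (4 ^ (jprec m * length cs)) < snd s * snd s)"

text \<open>The threshold 1 / (4 * qsep m) is half of the least gap between distinct coordinates
  that have to be told apart. The errors of both points together stay below 1 / (8 * qsep m), so
  neither outcome comes close to the threshold.\<close>

definition same :: "nat \<Rightarrow> int \<times> int \<Rightarrow> int \<times> int \<Rightarrow> bool" where
  "same m q q' \<longleftrightarrow> \<bar>fst q - fst q'\<bar> * int (4 * qsep m) < int (2 ^ kprec m) \<and>
     \<bar>snd q - snd q'\<bar> * int (4 * qsep m) < int (2 ^ kprec m)"

definition glex :: "nat \<Rightarrow> int \<times> int \<Rightarrow> int \<times> int \<Rightarrow> bool" where
  "glex m q q' \<longleftrightarrow> int (2 ^ kprec m) \<le> (fst q' - fst q) * int (4 * qsep m) \<or>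
     (\<bar>fst q - fst q'\<bar> * int (4 * qsep m) < int (2 ^ kprec m) \<and>
      int (2 ^ kprec m) \<le> (snd q' - snd q) * int (4 * qsep m))"

lemma cmp_horner [cmp]:
  "cmp f \<Longrightarrow> cmp g \<Longrightarrow> cmp h \<Longrightarrow> cmp (\<lambda>x. horner (f x) (g x) (h x))"
proof (rule cmp_o3[of horner])
  show "cmp (\<lambda>e. horner (fst e) (fst (snd e)) (snd (snd e)))" unfolding horner_def by (intro cmp)
qed

lemma dec_near [cmp]: "cmp f \<Longrightarrow> cmp g \<Longrightarrow> cmp h \<Longrightarrow> dec (\<lambda>x. near (f x) (g x) (h x))"
  unfolding near_def Let_def by (intro cmp)
lemma dec_same [cmp]: "cmp f \<Longrightarrow> cmp g \<Longrightarrow> cmp h \<Longrightarrow> dec (\<lambda>x. same (f x) (g x) (h x))"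
  unfolding same_def by (intro cmp)
lemma dec_glex [cmp]: "cmp f \<Longrightarrow> cmp g \<Longrightarrow> cmp h \<Longrightarrow> dec (\<lambda>x. glex (f x) (g x) (h x))"
  unfolding glex_def by (intro cmp)

lemma hgt_ge_1: "1 \<le> hgt m"
  by (simp add: hgt_def)

lemma qsep_ge_1: "1 \<le> qsep m"
  using hgt_ge_1[of m] by (simp add: qsep_def sep_def)

lemma root_bound_hgt_0: "root_bound (hgt m) 0"
  by (rule root_bound_0[OF hgt_ge_1])

definition prec :: "nat \<Rightarrow> real" where "prec m = 1 / 2 ^ jprec m"

section \<open>Soundness and completeness of the grid test\<close>

lemma prec_pos: "0 < prec m" and prec_le_1: "prec m \<le> 1"
  by (simp_all add: prec_def)

text \<open>The factor 2 * hgt m + 3 is the amplification of errors in a + b * cnj c - e; even after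
  it they remain far below the gap 1 / qsep m.\<close>

lemma prec_small: "prec m * (16 * real (qsep m) * (2 * real (hgt m) + 3)) < 1"
proof -
  have "real (jprec m) < 2 ^ jprec m" by (rule of_nat_less_two_power)
  thus ?thesis by (simp add: prec_def jprec_def)
qed

lemma prec_sep: "prec m * (16 * real (qsep m)) < 1"
proof -
  have "prec m * (16 * real (qsep m)) * 1 \<le> prec m * (16 * real (qsep m)) * (2 * real (hgt m) + 3)"
    using prec_pos[of m] by (intro mult_left_mono) auto
  thus ?thesis using prec_small[of m] by (simp add: mult.assoc)
qed

lemma near_iff:
  "near m cs q \<longleftrightarrow> norm (poly (Poly (map of_int cs)) (gval m q)) < prec m ^ length cs"
proof -
  define D where "D = (2::real) ^ kprec m"
  define n where "n = length cs"
  define s where "s = horner (int (2 ^ kprec m)) q cs"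
  define P where "P = poly (Poly (map of_int cs)) (gval m q)"
  have D: "D > 0" by (simp add: D_def)
  have nz: "int (2 ^ kprec m) \<noteq> 0" by simp
  have s2: "real_of_int (snd s) = D ^ n"
    using arg_cong[OF horner(1)[OF nz, of q cs], of real_of_int] unfolding s_def[symmetric] by (simp add: D_def n_def)
  have "Complex (of_int (fst (fst s))) (of_int (snd (fst s))) = of_real (D ^ n) * P"
    using horner(2)[OF nz, of q cs] unfolding s_def[symmetric] by (simp add: D_def n_def P_def gval_def)
  from arg_cong[OF this, of "\<lambda>z. (norm z)\<^sup>2"]
  have s1: "(real_of_int (fst (fst s)))\<^sup>2 + (real_of_int (snd (fst s)))\<^sup>2 = (D ^ n * norm P)\<^sup>2"
    using D by (simp add: cmod_power2 norm_mult norm_power)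
  define E where "E = (2::real) ^ (jprec m * n)"
  have E: "E > 0" by (simp add: E_def)
  have E4: "(4::real) ^ (jprec m * n) = E\<^sup>2"
    by (simp add: E_def power2_eq_square flip: power_mult_distrib)
  have sq: "x\<^sup>2 < y\<^sup>2 \<longleftrightarrow> x < y" if "0 \<le> x" "0 \<le> y" for x y :: real
    using that power2_less_imp_less[of x y] power_strict_mono[of x y 2] by auto
  have "near m cs q \<longleftrightarrow> real_of_int ((fst (fst s) * fst (fst s) + snd (fst s) * snd (fst s)) *
      int (4 ^ (jprec m * length cs))) < real_of_int (snd s * snd s)"
    unfolding near_def Let_def s_def of_int_less_iff ..
  also have "\<dots> \<longleftrightarrow> (D ^ n * norm P)\<^sup>2 * E\<^sup>2 < (D ^ n)\<^sup>2"
    unfolding s1[symmetric] unfolding E4[symmetric] s2[symmetric] by (simp add: power2_eq_square n_def)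
  also have "\<dots> \<longleftrightarrow> (D ^ n * (norm P * E))\<^sup>2 < (D ^ n)\<^sup>2"
    by (simp add: power_mult_distrib mult.assoc)
  also have "\<dots> \<longleftrightarrow> D ^ n * (norm P * E) < D ^ n"
    using D E by (intro sq) auto
  also have "\<dots> \<longleftrightarrow> norm P < 1 / E"
    using D E by (simp add: field_simps)
  also have "1 / E = prec m ^ length cs"
    by (simp add: E_def prec_def n_def power_mult power_one_over)
  finally show ?thesis by (simp add: P_def)
qed

text \<open>The leading coefficient is a nonzero integer, hence of norm at least 1, which is what
  \<open>root_near\<close> asks for.\<close>

lemma near_sound:
  assumes "\<exists>a\<in>set cs. a \<noteq> 0" "near m cs q"
  shows "\<exists>\<alpha>\<in>croots cs. norm (gval m q - \<alpha>) < prec m"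
proof -
  let ?p = "Poly (map of_int cs) :: complex poly"
  have nz: "?p \<noteq> 0" using assms(1) unfolding Poly_of_int_eq_0_iff by blast
  define z where "z = coeff (Poly cs) (degree ?p)"
  have lz: "lead_coeff ?p = of_int z"
    unfolding z_def unfolding Poly_of_int by (simp only: coeff_map_poly of_int_0)
  have "lead_coeff ?p \<noteq> 0" using nz unfolding leading_coeff_0_iff .
  hence "z \<noteq> 0" unfolding lz by simp
  hence lc: "1 \<le> norm (lead_coeff ?p)" unfolding lz by simp
  have deg: "degree ?p \<le> length cs" using degree_Poly[of "map of_int cs :: complex list"] by simp
  from root_near[OF deg prec_pos[of m] prec_le_1 lc, of "gval m q"] assms(2)
  show ?thesis unfolding near_iff croots_def by blast
qed

lemma prod_encode_le: "prod_encode (a, b) \<le> (a + b + 1)\<^sup>2"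
proof -
  have "triangle k \<le> k\<^sup>2" for k by (induction k) (auto simp: power2_eq_square)
  from this[of "a + b"] have "prod_encode (a, b) \<le> (a + b)\<^sup>2 + a" by (simp add: prod_encode_def)
  also have "\<dots> \<le> (a + b + 1)\<^sup>2" by (simp add: power2_eq_square)
  finally show ?thesis .
qed

lemma enc_int_le: "enc i \<le> 2 * nat \<bar>i\<bar> + 1" for i :: int
  by (auto simp: enc_int_def int_encode_def sum_encode_def)

text \<open>Each summand of \<open>kprec\<close> pays for one factor: 2 for the error 2 / D with a
  spare half, \<open>jprec m * hgt m\<close> for the power of \<open>prec m\<close>,
  \<open>(hgt m + 2) * hgt m\<close> for the power of the radius hgt m + 2, and
  \<open>2 * hgt m\<close> for the two factors hgt m of the Lipschitz constant.\<close>

lemma grid_precision: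
  "2 / 2 ^ kprec m * (real (hgt m) * real (hgt m) * (real (hgt m) + 2) ^ hgt m) < prec m ^ hgt m"
  "2 / 2 ^ kprec m < prec m"
proof -
  let ?M = "hgt m"
  have lt: "real ?M < 2 ^ ?M" by (rule of_nat_less_two_power)
  have "real (?M + 2) < 2 ^ (?M + 2)" by (rule of_nat_less_two_power)
  hence "(real ?M + 2) ^ ?M \<le> (2 ^ (?M + 2)) ^ ?M" by (intro power_mono) auto
  moreover have "real ?M * real ?M \<le> 2 ^ ?M * 2 ^ ?M" using lt by (intro mult_mono) auto
  ultimately have "real ?M * real ?M * (real ?M + 2) ^ ?M \<le> 2 ^ ?M * 2 ^ ?M * (2 ^ (?M + 2)) ^ ?M"
    by (intro mult_mono) auto
  also have "\<dots> = 2 ^ (2 * ?M + (?M + 2) * ?M)"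
    by (simp only: power_mult[symmetric] power_add[symmetric] mult_2)
  finally have 1: "real ?M * real ?M * (real ?M + 2) ^ ?M \<le> 2 ^ (2 * ?M + (?M + 2) * ?M)" .
  have k: "(2::real) ^ kprec m = 4 * 2 ^ (jprec m * ?M) * 2 ^ (2 * ?M + (?M + 2) * ?M)"
    by (simp add: kprec_def power_add mult_ac)
  have "2 / 2 ^ kprec m * (real ?M * real ?M * (real ?M + 2) ^ ?M) \<le> 2 / 2 ^ kprec m * 2 ^ (2 * ?M + (?M + 2) * ?M)"
    using 1 by (intro mult_left_mono) auto
  also have "\<dots> = 1 / 2 * prec m ^ ?M" unfolding k
    by (simp add: prec_def power_one_over field_simps flip: power_mult)
  also have "\<dots> < prec m ^ ?M" using prec_pos[of m] by simp
  finally show "2 / 2 ^ kprec m * (real ?M * real ?M * (real ?M + 2) ^ ?M) < prec m ^ ?M" .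
  have "jprec m + 2 \<le> kprec m"
    using mult_le_mono2[OF hgt_ge_1[of m], of "jprec m"] unfolding kprec_def by linarith
  hence "(2::real) ^ (jprec m + 2) \<le> 2 ^ kprec m" by (intro power_increasing) auto
  hence "2 / 2 ^ kprec m \<le> 2 / (2::real) ^ (jprec m + 2)" by (intro divide_left_mono) auto
  also have "\<dots> < prec m" by (simp add: prec_def power_add field_simps)
  finally show "2 / 2 ^ kprec m < prec m" .
qed

text \<open>Round the root to the grid. The Lipschitz estimate then bounds the value of the
  polynomial at the grid point by what \<open>near\<close> tolerates.\<close>

lemma near_complete:
  assumes nz: "\<exists>a\<in>set (code_coeffs c). a \<noteq> 0" and \<alpha>: "\<alpha> \<in> croots (code_coeffs c)" and c: "c \<le> m"
  shows "\<exists>q. enc q < grid_bound m \<and> near m (code_coeffs c) q \<and> norm (gval m q - \<alpha>) < prec m"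
proof -
  let ?M = "hgt m" and ?cs = "code_coeffs c"
  define D where "D = (2::real) ^ kprec m"
  have D: "1 \<le> D" by (simp add: D_def)
  define q where "q = (\<lfloor>Re \<alpha> * D\<rfloor>, \<lfloor>Im \<alpha> * D\<rfloor>)"
  have n\<alpha>: "norm \<alpha> \<le> real ?M" by (rule root_bound_norm_le[OF root_bound_croots[OF nz \<alpha> c]])
  have re: "\<bar>Re (gval m q - \<alpha>)\<bar> \<le> 1 / D" and im: "\<bar>Im (gval m q - \<alpha>)\<bar> \<le> 1 / D"
  proof -
    have "\<bar>of_int \<lfloor>x * D\<rfloor> / D - x\<bar> \<le> 1 / D" for x
    proof -
      have "\<bar>of_int \<lfloor>x * D\<rfloor> - x * D\<bar> \<le> 1" by linarith
      moreover have "of_int \<lfloor>x * D\<rfloor> / D - x = (of_int \<lfloor>x * D\<rfloor> - x * D) / D" using D by (simp add: field_simps)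
      ultimately show ?thesis using D by (simp add: abs_divide divide_right_mono)
    qed
    thus "\<bar>Re (gval m q - \<alpha>)\<bar> \<le> 1 / D" "\<bar>Im (gval m q - \<alpha>)\<bar> \<le> 1 / D"
      by (simp_all add: gval_def q_def D_def)
  qed
  have d: "norm (gval m q - \<alpha>) \<le> 2 / D"
    using cmod_le[of "gval m q - \<alpha>"] re im by simp
  have d': "norm (gval m q - \<alpha>) < prec m" using d grid_precision(2)[of m] by (simp add: D_def)
  have nq: "norm (gval m q) \<le> real ?M + 2"
    using norm_triangle_sub[of "gval m q" \<alpha>] d' prec_le_1[of m] n\<alpha> by linarith
  have "near m ?cs q"
  proof -
    have R: "1 \<le> real ?M + 2" "norm \<alpha> \<le> real ?M + 2" using n\<alpha> by auto
    have S: "real_of_int (sum_list (map abs ?cs)) \<le> real ?M"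
      using sum_list_abs_code_coeffs(1)[OF c] by linarith
    have L: "length ?cs \<le> ?M" by (rule sum_list_abs_code_coeffs(2)[OF c])
    have S0: "0 \<le> real_of_int (sum_list (map abs ?cs))"
    proof -
      have "0 \<le> sum_list (map abs ?cs)" by (intro sum_list_nonneg) auto
      thus ?thesis by simp
    qed
    have "poly (Poly (map of_int ?cs)) \<alpha> = 0" using \<alpha> by (simp add: croots_def)
    hence "norm (poly (Poly (map of_int ?cs)) (gval m q)) \<le>
        norm (gval m q - \<alpha>) * (of_int (sum_list (map abs ?cs)) * real (length ?cs) * (real ?M + 2) ^ length ?cs)"
      using poly_bound(2)[OF R(1) nq R(2), of ?cs] by simp
    also have "\<dots> \<le> 2 / D * (real ?M * real ?M * (real ?M + 2) ^ ?M)"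
      using d S S0 L R(1) D by (intro mult_mono power_increasing mult_nonneg_nonneg) auto
    also have "\<dots> < prec m ^ ?M" using grid_precision(1)[of m] by (simp add: D_def)
    also have "\<dots> \<le> prec m ^ length ?cs" using L prec_pos[of m] prec_le_1[of m] by (intro power_decreasing) auto
    finally show ?thesis unfolding near_iff .
  qed
  moreover have "enc q < grid_bound m"
  proof -
    have b: "nat \<bar>\<lfloor>x * D\<rfloor>\<bar> \<le> (?M + 1) * 2 ^ kprec m" if "\<bar>x\<bar> \<le> real ?M" for x
    proof -
      have "\<bar>x * D\<bar> \<le> real ?M * D" using that D by (simp add: abs_mult mult_right_mono)
      hence "real_of_int \<bar>\<lfloor>x * D\<rfloor>\<bar> \<le> real ?M * D + D" using D by linarith
      also have "\<dots> = real_of_int (int ((?M + 1) * 2 ^ kprec m))" by (simp add: D_def algebra_simps)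
      finally show ?thesis by linarith
    qed
    have "\<bar>Re \<alpha>\<bar> \<le> real ?M" "\<bar>Im \<alpha>\<bar> \<le> real ?M"
      using n\<alpha> abs_Re_le_cmod[of \<alpha>] abs_Im_le_cmod[of \<alpha>] by linarith+
    from this[THEN b] enc_int_le[of "fst q"] enc_int_le[of "snd q"]
    have "enc (fst q) + enc (snd q) + 1 \<le> 4 * (?M + 1) * 2 ^ kprec m + 3"
      unfolding q_def fst_conv snd_conv by linarith
    hence "(enc (fst q) + enc (snd q) + 1)\<^sup>2 \<le> (4 * (?M + 1) * 2 ^ kprec m + 3)\<^sup>2" by (intro power_mono) auto
    thus ?thesis using prod_encode_le[of "enc (fst q)" "enc (snd q)"]
      unfolding grid_bound_def enc_prod_def by linarith
  qed
  ultimately show ?thesis using d' by blast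
qed

text \<open>Twice the real part is a root plus its conjugate, so a difference of real parts is an
  expression in four roots. Imaginary parts are compared only for equal real parts, where their
  distance is that of the roots themselves.\<close>

lemma root_separation:
  assumes "root_bound (hgt m) \<alpha>" "root_bound (hgt m) \<beta>"
  shows "Re \<alpha> \<noteq> Re \<beta> \<Longrightarrow> 1 \<le> \<bar>Re \<alpha> - Re \<beta>\<bar> * (2 * real (qsep m))"
    "Re \<alpha> = Re \<beta> \<Longrightarrow> Im \<alpha> \<noteq> Im \<beta> \<Longrightarrow> 1 \<le> \<bar>Im \<alpha> - Im \<beta>\<bar> * (2 * real (qsep m))"
proof -
  note s = root_bound_separation[OF assms(1) root_bound_cnj[OF assms(1)] assms(2) root_bound_cnj[OF assms(2)]]
  have sum: "\<alpha> + cnj \<alpha> = of_real (2 * Re \<alpha>)" "\<beta> + cnj \<beta> = of_real (2 * Re \<beta>)"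
    by (simp_all add: complex_eq_iff)
  show "1 \<le> \<bar>Re \<alpha> - Re \<beta>\<bar> * (2 * real (qsep m))" if "Re \<alpha> \<noteq> Re \<beta>"
  proof -
    have "norm (of_real (2 * Re \<alpha>) - of_real (2 * Re \<beta>) :: complex) = 2 * \<bar>Re \<alpha> - Re \<beta>\<bar>"
      using abs_mult[of 2 "Re \<alpha> - Re \<beta>"]
      unfolding of_real_diff[symmetric] norm_of_real right_diff_distrib abs_numeral .
    thus ?thesis using s(2) that unfolding sum by (simp add: qsep_def del: of_real_mult)
  qed
  show "1 \<le> \<bar>Im \<alpha> - Im \<beta>\<bar> * (2 * real (qsep m))" if "Re \<alpha> = Re \<beta>" "Im \<alpha> \<noteq> Im \<beta>"
  proof -
    have "1 \<le> norm (\<alpha> + 0 * 0 - \<beta>) * real (sep (hgt m))"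
      using that(2) by (intro root_bound_separation(1)[OF assms(1) root_bound_hgt_0 root_bound_hgt_0 assms(2)]) auto
    moreover have "norm (\<alpha> - \<beta>) = \<bar>Im \<alpha> - Im \<beta>\<bar>" using that(1) by (simp add: cmod_def)
    ultimately have "1 \<le> \<bar>Im \<alpha> - Im \<beta>\<bar> * real (qsep m)" by (simp add: qsep_def)
    also have "\<dots> \<le> \<bar>Im \<alpha> - Im \<beta>\<bar> * (2 * real (qsep m))" by (intro mult_left_mono) auto
    finally show ?thesis .
  qed
qed

lemma grid_less_iff:
  "\<bar>x - y\<bar> * int (4 * qsep m) < int (2 ^ kprec m) \<longleftrightarrow>
     \<bar>of_int x / 2 ^ kprec m - of_int y / 2 ^ kprec m\<bar> * (4 * real (qsep m)) < 1"
  "int (2 ^ kprec m) \<le> (y - x) * int (4 * qsep m) \<longleftrightarrow>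
     1 \<le> (of_int y / 2 ^ kprec m - of_int x / 2 ^ kprec m) * (4 * real (qsep m))"
proof -
  define D where "D = (2::real) ^ kprec m"
  have D: "D > 0" by (simp add: D_def)
  have "\<bar>x - y\<bar> * int (4 * qsep m) < int (2 ^ kprec m) \<longleftrightarrow>
      real_of_int (\<bar>x - y\<bar> * int (4 * qsep m)) < real_of_int (int (2 ^ kprec m))"
    by (simp only: of_int_less_iff)
  also have "\<dots> \<longleftrightarrow> \<bar>of_int x - of_int y\<bar> * (4 * real (qsep m)) < D" by (simp add: D_def)
  also have "\<dots> \<longleftrightarrow> \<bar>of_int x / D - of_int y / D\<bar> * (4 * real (qsep m)) < 1"
    using D by (simp add: diff_divide_distrib[symmetric] abs_divide pos_divide_less_eq)
  finally show "\<bar>x - y\<bar> * int (4 * qsep m) < int (2 ^ kprec m) \<longleftrightarrow>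
     \<bar>of_int x / 2 ^ kprec m - of_int y / 2 ^ kprec m\<bar> * (4 * real (qsep m)) < 1" by (simp add: D_def)
  have "int (2 ^ kprec m) \<le> (y - x) * int (4 * qsep m) \<longleftrightarrow>
      real_of_int (int (2 ^ kprec m)) \<le> real_of_int ((y - x) * int (4 * qsep m))"
    by (simp only: of_int_le_iff)
  also have "\<dots> \<longleftrightarrow> D \<le> (of_int y - of_int x) * (4 * real (qsep m))" by (simp add: D_def)
  also have "\<dots> \<longleftrightarrow> 1 \<le> (of_int y / D - of_int x / D) * (4 * real (qsep m))"
    using D by (simp add: diff_divide_distrib[symmetric] pos_le_divide_eq)
  finally show "int (2 ^ kprec m) \<le> (y - x) * int (4 * qsep m) \<longleftrightarrow>
     1 \<le> (of_int y / 2 ^ kprec m - of_int x / 2 ^ kprec m) * (4 * real (qsep m))" by (simp add: D_def)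
qed

text \<open>After scaling by 4 * Q the approximate and the true difference deviate by less than 1/2,
  while distinct values differ by at least 2; the threshold 1 lies safely between.\<close>

lemma gap_cases:
  fixes a b x y e Q :: real
  assumes "\<bar>x - a\<bar> < e" "\<bar>y - b\<bar> < e" "e * (16 * Q) < 1" "a \<noteq> b \<Longrightarrow> 1 \<le> \<bar>a - b\<bar> * (2 * Q)" "1 \<le> Q"
  shows "\<bar>x - y\<bar> * (4 * Q) < 1 \<longleftrightarrow> a = b" "1 \<le> (y - x) * (4 * Q) \<longleftrightarrow> a < b"
proof -
  have "\<bar>(x - y) - (a - b)\<bar> < 2 * e" using assms(1,2) by linarith
  hence "\<bar>(x - y) - (a - b)\<bar> * (4 * Q) \<le> 2 * e * (4 * Q)" using assms(5) by (intro mult_right_mono) auto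
  moreover have "\<bar>(x - y) - (a - b)\<bar> * (4 * Q) = \<bar>(x - y) * (4 * Q) - (a - b) * (4 * Q)\<bar>"
    using assms(5) unfolding left_diff_distrib[symmetric] by (simp add: abs_mult)
  ultimately have d: "\<bar>(x - y) * (4 * Q) - (a - b) * (4 * Q)\<bar> < 1 / 2" using assms(3) by simp
  have ab: "2 \<le> \<bar>(a - b) * (4 * Q)\<bar>" if "a \<noteq> b"
  proof -
    have "2 * 1 \<le> 2 * (\<bar>a - b\<bar> * (2 * Q))" using assms(4)[OF that] by (intro mult_left_mono) auto
    also have "\<dots> = \<bar>(a - b) * (4 * Q)\<bar>" using assms(5) unfolding abs_mult by simp
    finally show ?thesis by simp
  qed
  have Q4: "0 < 4 * Q" using assms(5) by simp
  have sgn: "a < b \<Longrightarrow> (a - b) * (4 * Q) < 0" "b < a \<Longrightarrow> 0 < (a - b) * (4 * Q)"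
    using mult_neg_pos[OF _ Q4, of "a - b"] mult_pos_pos[OF _ Q4, of "a - b"] by simp_all
  have neg: "(y - x) * (4 * Q) = - ((x - y) * (4 * Q))" by (simp add: algebra_simps)
  have xy: "\<bar>x - y\<bar> * (4 * Q) = \<bar>(x - y) * (4 * Q)\<bar>" using assms(5) by (simp add: abs_mult)
  show "\<bar>x - y\<bar> * (4 * Q) < 1 \<longleftrightarrow> a = b"
  proof (cases "a = b")
    case True
    thus ?thesis unfolding xy using d by simp
  next
    case False
    have "\<not> \<bar>(x - y) * (4 * Q)\<bar> < 1" using d ab[OF False] by linarith
    thus ?thesis unfolding xy using False by simp
  qed
  show "1 \<le> (y - x) * (4 * Q) \<longleftrightarrow> a < b"
  proof (cases a b rule: linorder_cases)
    case less
    have "1 \<le> (y - x) * (4 * Q)" unfolding neg using d ab sgn(1)[OF less] less by linarith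
    thus ?thesis using less by simp
  next
    case equal
    have "\<not> 1 \<le> (y - x) * (4 * Q)" unfolding neg using d equal by simp
    thus ?thesis using equal by simp
  next
    case greater
    have "\<not> 1 \<le> (y - x) * (4 * Q)" unfolding neg using d ab sgn(2)[OF greater] greater by linarith
    thus ?thesis using greater by simp
  qed
qed

lemma same_glex_iff:
  assumes "root_bound (hgt m) \<alpha>" "root_bound (hgt m) \<beta>"
    "norm (gval m q - \<alpha>) < prec m" "norm (gval m q' - \<beta>) < prec m"
  shows "same m q q' \<longleftrightarrow> \<alpha> = \<beta>" "glex m q q' \<longleftrightarrow> clex_less \<alpha> \<beta>"
proof -
  have re: "\<bar>of_int (fst q) / 2 ^ kprec m - Re \<alpha>\<bar> < prec m" "\<bar>of_int (fst q') / 2 ^ kprec m - Re \<beta>\<bar> < prec m"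
    using assms(3,4) abs_Re_le_cmod[of "gval m q - \<alpha>"] abs_Re_le_cmod[of "gval m q' - \<beta>"]
    by (simp_all add: gval_def)
  have im: "\<bar>of_int (snd q) / 2 ^ kprec m - Im \<alpha>\<bar> < prec m" "\<bar>of_int (snd q') / 2 ^ kprec m - Im \<beta>\<bar> < prec m"
    using assms(3,4) abs_Im_le_cmod[of "gval m q - \<alpha>"] abs_Im_le_cmod[of "gval m q' - \<beta>"]
    by (simp_all add: gval_def)
  have Q: "1 \<le> real (qsep m)" using qsep_ge_1[of m] by simp
  have RE: "\<bar>of_int (fst q) / 2 ^ kprec m - of_int (fst q') / 2 ^ kprec m\<bar> * (4 * real (qsep m)) < 1 \<longleftrightarrow> Re \<alpha> = Re \<beta>"
    "1 \<le> (of_int (fst q') / 2 ^ kprec m - of_int (fst q) / 2 ^ kprec m) * (4 * real (qsep m)) \<longleftrightarrow> Re \<alpha> < Re \<beta>"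
    using gap_cases[OF re prec_sep root_separation(1)[OF assms(1,2)] Q] by simp_all
  have IM: "\<bar>of_int (snd q) / 2 ^ kprec m - of_int (snd q') / 2 ^ kprec m\<bar> * (4 * real (qsep m)) < 1 \<longleftrightarrow> Im \<alpha> = Im \<beta>"
    "1 \<le> (of_int (snd q') / 2 ^ kprec m - of_int (snd q) / 2 ^ kprec m) * (4 * real (qsep m)) \<longleftrightarrow> Im \<alpha> < Im \<beta>"
    if "Re \<alpha> = Re \<beta>"
    using gap_cases[OF im prec_sep root_separation(2)[OF assms(1,2) that] Q] by simp_all
  show "same m q q' \<longleftrightarrow> \<alpha> = \<beta>"
    unfolding same_def grid_less_iff RE(1) complex_eq_iff using IM(1) by (cases "Re \<alpha> = Re \<beta>") simp_all
  show "glex m q q' \<longleftrightarrow> clex_less \<alpha> \<beta>"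
    unfolding glex_def grid_less_iff RE clex_less_def using IM(2) by (cases "Re \<alpha> = Re \<beta>") simp_all
qed

text \<open>A certificate that the root near q has the coded rank: l holds exactly one approximation
  of each root below it. That no root is missing is a finite check, since every root has an
  approximation below \<open>grid_bound m\<close>.\<close>

definition approx_root :: "nat \<Rightarrow> nat \<Rightarrow> int \<times> int \<Rightarrow> (int \<times> int) list \<Rightarrow> bool" where
  "approx_root m c q l \<longleftrightarrow> (\<exists>a\<in>set (code_coeffs c). a \<noteq> 0) \<and> near m (code_coeffs c) q \<and>
     length l = code_index c \<and> (\<forall>i<length l. \<forall>j<i. \<not> same m (nthd l i) (nthd l j)) \<and>
     (\<forall>h\<in>set l. near m (code_coeffs c) h \<and> glex m h q) \<and>
     (\<forall>g<grid_bound m. near m (code_coeffs c) (dcd g) \<and> glex m (dcd g) q \<longrightarrow> (\<exists>h\<in>set l. same m (dcd g) h))"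

text \<open>A certificate for the default value 0: the polynomial vanishes, or l meets every root
  and is no longer than the index, so that the index is out of range.\<close>

definition approx_default :: "nat \<Rightarrow> nat \<Rightarrow> int \<times> int \<Rightarrow> (int \<times> int) list \<Rightarrow> bool" where
  "approx_default m c q l \<longleftrightarrow> q = (0, 0) \<and> ((\<forall>a\<in>set (code_coeffs c). a = 0) \<or>
     length l \<le> code_index c \<and> (\<forall>h\<in>set l. near m (code_coeffs c) h) \<and>
     (\<forall>g<grid_bound m. near m (code_coeffs c) (dcd g) \<longrightarrow> (\<exists>h\<in>set l. same m (dcd g) h)))"

locale coded_roots =
  fixes c m :: nat
  assumes nz: "\<exists>a\<in>set (code_coeffs c). a \<noteq> 0" and c: "c \<le> m"
begin

abbreviation "cs \<equiv> code_coeffs c"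

text \<open>\<open>rt\<close> and \<open>ap\<close> pass between accepted points and roots. The
  choices are harmless: a point lies within \<open>prec m\<close> of only one root, and therefore
  \<open>rt (ap z) = z\<close>.\<close>

definition rt :: "int \<times> int \<Rightarrow> complex" where
  "rt h = (SOME \<alpha>. \<alpha> \<in> croots cs \<and> norm (gval m h - \<alpha>) < prec m)"

definition ap :: "complex \<Rightarrow> int \<times> int" where
  "ap z = (SOME q. enc q < grid_bound m \<and> near m cs q \<and> norm (gval m q - z) < prec m)"

lemma rb: "z \<in> croots cs \<Longrightarrow> root_bound (hgt m) z"
  by (rule root_bound_croots[OF nz _ c])

lemma fin: "finite (croots cs)"
  using nz by (intro finite_croots) (auto simp: Poly_of_int_eq_0_iff)

lemma rt:
  assumes "near m cs h"
  shows "rt h \<in> croots cs" "norm (gval m h - rt h) < prec m"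
  using someI_ex[of "\<lambda>\<alpha>. \<alpha> \<in> croots cs \<and> norm (gval m h - \<alpha>) < prec m"] near_sound[OF nz assms]
  unfolding rt_def by blast+

lemma rt_iff:
  assumes "near m cs h" "near m cs h'"
  shows "same m h h' \<longleftrightarrow> rt h = rt h'" "glex m h h' \<longleftrightarrow> clex_less (rt h) (rt h')"
  by (rule same_glex_iff[OF rb[OF rt(1)] rb[OF rt(1)] rt(2) rt(2)]; rule assms)+

lemma ap:
  assumes z: "z \<in> croots cs"
  shows "enc (ap z) < grid_bound m" "near m cs (ap z)" "rt (ap z) = z"
proof -
  have ap: "enc (ap z) < grid_bound m \<and> near m cs (ap z) \<and> norm (gval m (ap z) - z) < prec m"
    unfolding ap_def by (rule someI_ex[OF near_complete[OF nz z c]])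
  thus "enc (ap z) < grid_bound m" and n: "near m cs (ap z)" by blast+
  have d: "norm (gval m (ap z) - z) < prec m" using ap by blast
  have "same m (ap z) (ap z)" using same_glex_iff(1)[OF rb[OF z] rb[OF z] d d] by blast
  thus "rt (ap z) = z" using same_glex_iff(1)[OF rb[OF rt(1)[OF n]] rb[OF z] rt(2)[OF n] d] by blast
qed

text \<open>\<open>rt\<close> maps l injectively onto the roots below that of q, so the rank of this
  root is the length of l.\<close>

lemma sound_root:
  assumes app: "approx_root m c q l"
  shows "norm (gval m q - alg_decode c) < prec m"
proof -
  note d = app[unfolded approx_root_def, THEN conjunct2]
  note q = d[THEN conjunct1]
  note dist = d[THEN conjunct2, THEN conjunct2, THEN conjunct1, rule_format]
  note mem = d[THEN conjunct2, THEN conjunct2, THEN conjunct2, THEN conjunct1, rule_format]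
  note cover = d[THEN conjunct2, THEN conjunct2, THEN conjunct2, THEN conjunct2, rule_format]
  have "rt (l ! i) \<noteq> rt (l ! j)" if "i < length l" "j < i" for i j
    using dist[OF that] mem[of "l ! i"] mem[of "l ! j"] rt_iff(1)[of "l ! i" "l ! j"] that by simp
  hence "distinct (map rt l)"
    unfolding distinct_conv_nth by (metis length_map linorder_neqE_nat nth_map)
  moreover have "set (map rt l) = below (croots cs) (rt q)"
  proof (intro equalityI subsetI)
    fix z assume "z \<in> set (map rt l)"
    then obtain h where h: "h \<in> set l" "z = rt h" by auto
    show "z \<in> below (croots cs) (rt q)"
      using mem[OF h(1)] rt(1)[of h] rt_iff(2)[of h q] q h(2) by (simp add: below_def)
  next
    fix z assume "z \<in> below (croots cs) (rt q)"
    hence z: "z \<in> croots cs" "clex_less z (rt q)" by (auto simp: below_def)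
    have "glex m (ap z) q" using rt_iff(2)[OF ap(2)[OF z(1)] q] z(2) ap(3)[OF z(1)] by simp
    with cover[OF ap(1)[OF z(1)]] ap(2)[OF z(1)] obtain h where h: "h \<in> set l" "same m (ap z) h"
      unfolding dcd_enc by blast
    have "z = rt h" using rt_iff(1)[OF ap(2)[OF z(1)], of h] mem[OF h(1)] h(2) ap(3)[OF z(1)] by simp
    thus "z \<in> set (map rt l)" using h(1) by auto
  qed
  ultimately have "card (below (croots cs) (rt q)) = code_index c"
    using d[THEN conjunct2, THEN conjunct1] distinct_card[of "map rt l"] by simp
  hence "alg_decode c = rt q" by (intro alg_decode_eqI nz rt(1)[OF q])
  thus ?thesis using rt(2)[OF q] by simp
qed

lemma covered_card_le:
  assumes "\<forall>h\<in>set l. near m cs h" "\<forall>g<grid_bound m. near m cs (dcd g) \<longrightarrow> (\<exists>h\<in>set l. same m (dcd g) h)"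
  shows "card (croots cs) \<le> length l"
proof -
  have "croots cs \<subseteq> set (map rt l)"
  proof
    fix z assume z: "z \<in> croots cs"
    obtain h where h: "h \<in> set l" "same m (ap z) h"
      using assms(2)[rule_format, OF ap(1)[OF z]] ap(2)[OF z] unfolding dcd_enc by blast
    have "z = rt h" using rt_iff(1)[OF ap(2)[OF z], of h] assms(1) h ap(3)[OF z] by simp
    thus "z \<in> set (map rt l)" using h(1) by auto
  qed
  hence "card (croots cs) \<le> card (set (map rt l))" by (intro card_mono) auto
  also have "\<dots> \<le> length (map rt l)" by (rule card_length)
  finally show ?thesis by simp
qed

lemma complete_default:
  assumes "card (croots cs) \<le> code_index c"
  shows "\<exists>l. approx_default m c (0, 0) l"
proof -
  obtain zs where zs: "set zs = croots cs" "distinct zs" using finite_distinct_list[OF fin] by blast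
  have "approx_default m c (0, 0) (map ap zs)"
    unfolding approx_default_def
  proof (intro conjI disjI2 allI impI ballI refl)
    show "length (map ap zs) \<le> code_index c" using assms zs distinct_card[OF zs(2)] by simp
    show "near m cs h" if "h \<in> set (map ap zs)" for h using that ap(2) zs(1) by auto
    fix k assume k: "near m cs (dcd k)"
    have "same m (dcd k) (ap (rt (dcd k)))" using rt_iff(1)[OF k ap(2)[OF rt(1)[OF k]]] ap(3)[OF rt(1)[OF k]] by simp
    thus "\<exists>h\<in>set (map ap zs). same m (dcd k) h" using rt(1)[OF k] zs(1) by (intro bexI[of _ "ap (rt (dcd k))"]) auto
  qed
  thus ?thesis by blast
qed

lemma complete_root:
  assumes z: "z \<in> croots cs" "card (below (croots cs) z) = code_index c"
  shows "\<exists>l. approx_root m c (ap z) l"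
proof -
  have fb: "finite (below (croots cs) z)" using fin by (auto simp: below_def)
  obtain zs where zs: "set zs = below (croots cs) z" "distinct zs" using finite_distinct_list[OF fb] by blast
  have zs': "w \<in> croots cs" "clex_less w z" if "w \<in> set zs" for w
    using that zs(1) by (auto simp: below_def)
  have "approx_root m c (ap z) (map ap zs)"
    unfolding approx_root_def
  proof (intro conjI allI impI ballI nz)
    show "near m cs (ap z)" by (rule ap(2)[OF z(1)])
    show "length (map ap zs) = code_index c" using z(2) zs distinct_card[OF zs(2)] by simp
    show "near m cs h" "glex m h (ap z)" if "h \<in> set (map ap zs)" for h
    proof -
      from that obtain w where w: "w \<in> set zs" "h = ap w" by auto
      show "near m cs h" using w zs' ap(2) by blast
      show "glex m h (ap z)" unfolding w(2)
        using rt_iff(2)[OF ap(2)[OF zs'(1)[OF w(1)]] ap(2)[OF z(1)]] ap(3)[OF zs'(1)[OF w(1)]] ap(3)[OF z(1)]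
          zs'(2)[OF w(1)] by simp
    qed
    show "\<not> same m (nthd (map ap zs) i) (nthd (map ap zs) j)" if "i < length (map ap zs)" "j < i" for i j
    proof -
      have ij: "zs ! i \<in> croots cs" "zs ! j \<in> croots cs" "zs ! i \<noteq> zs ! j"
        using that zs(2) zs' by (auto simp: nth_eq_iff_index_eq)
      have "\<not> same m (ap (zs ! i)) (ap (zs ! j))"
        using rt_iff(1)[OF ap(2)[OF ij(1)] ap(2)[OF ij(2)]] ap(3)[OF ij(1)] ap(3)[OF ij(2)] ij(3) by simp
      thus ?thesis using that by simp
    qed
    fix k assume k: "near m cs (dcd k) \<and> glex m (dcd k) (ap z)"
    note n = k[THEN conjunct1]
    have "clex_less (rt (dcd k)) z" using rt_iff(2)[OF n ap(2)[OF z(1)]] k ap(3)[OF z(1)] by simp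
    hence "rt (dcd k) \<in> set zs" using rt(1)[OF n] zs(1) by (auto simp: below_def)
    moreover have "same m (dcd k) (ap (rt (dcd k)))"
      using rt_iff(1)[OF n ap(2)[OF rt(1)[OF n]]] ap(3)[OF rt(1)[OF n]] by simp
    ultimately show "\<exists>h\<in>set (map ap zs). same m (dcd k) h" by (intro bexI[of _ "ap (rt (dcd k))"]) auto
  qed
  thus ?thesis by blast
qed

end

lemma approx_sound_root:
  assumes "c \<le> m" "approx_root m c q l"
  shows "norm (gval m q - alg_decode c) < prec m"
proof -
  interpret coded_roots c m by standard (use assms in \<open>simp_all add: approx_root_def\<close>)
  show ?thesis by (rule sound_root[OF assms(2)])
qed

text \<open>If the code did name a root, then its index would be smaller than the number of roots,
  hence smaller than the length of the covering list l.\<close>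

lemma approx_sound_default:
  assumes c: "c \<le> m" and app: "approx_default m c q l"
  shows "norm (gval m q - alg_decode c) < prec m"
proof -
  have "alg_decode c = 0"
  proof (cases c rule: alg_decode_cases)
    case root
    interpret coded_roots c m by standard (use root c in simp_all)
    note d = app[unfolded approx_default_def, THEN conjunct2]
    have "length l \<le> code_index c" "card (croots cs) \<le> length l"
      using d nz by (auto intro!: covered_card_le)
    thus ?thesis using card_below_less[OF fin root(2)] root(3) by linarith
  qed
  moreover have "gval m q = 0" using app by (simp add: approx_default_def gval_def complex_eq_iff)
  ultimately show ?thesis using prec_pos[of m] by simp
qed

lemma approx_complete:
  assumes c: "c \<le> m"
  shows "\<exists>q l. approx_root m c q l \<or> approx_default m c q l"
proof (cases c rule: alg_decode_cases)
  case zero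
  thus ?thesis unfolding approx_default_def by blast
next
  case none
  interpret coded_roots c m by standard (use none c in simp_all)
  show ?thesis using complete_default[OF none(2)] by blast
next
  case root
  interpret coded_roots c m by standard (use root c in simp_all)
  show ?thesis using complete_root[OF root(2,3)] by blast
qed

lemma computable_approximation:
  obtains ap where "cmp (\<lambda>e. ap (fst e) (snd e))"
    "\<forall>m c. c \<le> m \<longrightarrow> norm (gval m (ap m c) - alg_decode c) < prec m"
proof -
  \<comment> \<open>The guard makes the search total: for codes beyond the precision parameter every
    q is accepted.\<close>
  define P where "P = (\<lambda>(e :: nat \<times> nat) q. \<exists>l. snd e \<le> fst e \<longrightarrow>
      approx_root (fst e) (snd e) q l \<or> approx_default (fst e) (snd e) q l)"
  have "sig (\<lambda>e. P (fst e) (snd e))"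
    unfolding P_def approx_root_def approx_default_def
    by (rule sig_ex, rule sig_dec) (intro cmp)
  then obtain f where f: "cmp f" "\<And>e. P e (f e)"
  proof (rule sig_select)
    show "\<exists>q. P e q" for e using approx_complete[of "snd e" "fst e"] unfolding P_def by blast
  qed blast
  show ?thesis
  proof (rule that[of "\<lambda>m c. f (m, c)"])
    show "cmp (\<lambda>e. f (fst e, snd e))" using f(1) by simp
    show "\<forall>m c. c \<le> m \<longrightarrow> norm (gval m (f (m, c)) - alg_decode c) < prec m"
    proof (intro allI impI)
      fix m c :: nat assume le: "c \<le> m"
      obtain l where "approx_root m c (f (m, c)) l \<or> approx_default m c (f (m, c)) l"
        using f(2)[of "(m, c)"] le unfolding P_def by auto
      thus "norm (gval m (f (m, c)) - alg_decode c) < prec m"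
        using approx_sound_root[OF le] approx_sound_default[OF le] by blast
    qed
  qed
qed

text \<open>One operation suffices: iterating a + b * cnj c gives inner products and entries of
  projections, and with b = 0 it decides equality of coded numbers. A nonzero difference of the two
  sides is at least 1 / qsep in norm, beyond the reach of the approximation errors.\<close>

lemma dec_alg_eq:
  "dec (\<lambda>e :: (nat \<times> nat) \<times> nat \<times> nat. alg_decode (fst (fst e)) +
     alg_decode (snd (fst e)) * cnj (alg_decode (fst (snd e))) = alg_decode (snd (snd e)))"
proof -
  obtain ap where ap: "cmp (\<lambda>e. ap (fst e) (snd e))"
    "\<forall>m c. c \<le> m \<longrightarrow> norm (gval m (ap m c) - alg_decode c) < prec m"
    by (rule computable_approximation)
  note ap = ap(1) ap(2)[rule_format]
  \<comment> \<open>The sum of the four codes bounds each of them, so a single precision serves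
    all.\<close>
  define M where "M = (\<lambda>e :: (nat \<times> nat) \<times> nat \<times> nat.
    fst (fst e) + snd (fst e) + (fst (snd e) + snd (snd e)))"
  \<comment> \<open>U and V are the real and the imaginary part of the approximate difference,
    multiplied by D * D.\<close>
  define U where "U = (\<lambda>D (a :: int \<times> int) (b :: int \<times> int) (c :: int \<times> int) (e :: int \<times> int). fst a * D + (fst b * fst c + snd b * snd c) - fst e * D)"
  define V where "V = (\<lambda>D (a :: int \<times> int) (b :: int \<times> int) (c :: int \<times> int) (e :: int \<times> int). snd a * D + (snd b * fst c - fst b * snd c) - snd e * D)"
  define T where "T = (\<lambda>e. (let m = M e; D = int (2 ^ kprec m); a = ap m (fst (fst e)); b = ap m (snd (fst e));
      c = ap m (fst (snd e)); f = ap m (snd (snd e)) in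
      \<bar>U D a b c f\<bar> * int (4 * qsep m) < D * D \<and> \<bar>V D a b c f\<bar> * int (4 * qsep m) < D * D))"
  have "dec T" unfolding T_def Let_def U_def V_def M_def
    by (intro cmp cmp_o2[OF ap(1)])
  moreover have "T ((a, b), (c, f)) \<longleftrightarrow> alg_decode a + alg_decode b * cnj (alg_decode c) = alg_decode f" for a b c f
  proof -
    define m where "m = a + b + (c + f)"
    define D where "D = (2::real) ^ kprec m"
    define e where "e = prec m"
    define Q where "Q = real (qsep m)"
    define H where "H = real (hgt m)"
    define \<alpha> \<beta> \<gamma> \<delta> where d: "\<alpha> = alg_decode a" "\<beta> = alg_decode b" "\<gamma> = alg_decode c" "\<delta> = alg_decode f"
    define A B C F where D': "A = ap m a" "B = ap m b" "C = ap m c" "F = ap m f"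
    have D0: "D > 0" by (simp add: D_def)
    have le: "a \<le> m" "b \<le> m" "c \<le> m" "f \<le> m" by (auto simp: m_def)
    note rb = le[THEN root_bound_alg_decode, folded d]
    have near: "norm (gval m A - \<alpha>) < e" "norm (gval m B - \<beta>) < e" "norm (gval m C - \<gamma>) < e" "norm (gval m F - \<delta>) < e"
      using le[THEN ap(2)] by (simp_all add: d D' e_def)
    have nb: "norm \<beta> \<le> H" "norm \<gamma> \<le> H" using rb(2,3)[THEN root_bound_norm_le] by (simp_all add: H_def)
    have e: "0 < e" "e \<le> 1" "e * (16 * Q * (2 * H + 3)) < 1"
      using prec_pos[of m] prec_le_1[of m] prec_small[of m] by (simp_all add: e_def Q_def H_def)
    have Q: "1 \<le> Q" using qsep_ge_1[of m] by (simp add: Q_def)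
    have H: "1 \<le> H" using hgt_ge_1[of m] by (simp add: H_def)
    define x where "x = gval m A + gval m B * cnj (gval m C) - gval m F"
    define y where "y = \<alpha> + \<beta> * cnj \<gamma> - \<delta>"
    \<comment> \<open>The error of the product is split so that one part contains the approximation
      of c, of norm at most H + 1, and the other the exact value of b, of norm at most H.\<close>
    have "x - y = (gval m A - \<alpha>) + ((gval m B - \<beta>) * cnj (gval m C) + \<beta> * cnj (gval m C - \<gamma>)) - (gval m F - \<delta>)"
      by (simp add: x_def y_def algebra_simps)
    also have "norm \<dots> \<le> norm (gval m A - \<alpha>) + (norm (gval m B - \<beta>) * norm (gval m C) + norm \<beta> * norm (gval m C - \<gamma>)) + norm (gval m F - \<delta>)"
    proof -
      have tri: "norm (p + (q + r) - s) \<le> norm p + (norm q + norm r) + norm s" for p q r s :: complex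
        using norm_triangle_ineq4[of "p + (q + r)" s] norm_triangle_ineq[of p "q + r"] norm_triangle_ineq[of q r] by linarith
      show ?thesis using tri[of "gval m A - \<alpha>" "(gval m B - \<beta>) * cnj (gval m C)" "\<beta> * cnj (gval m C - \<gamma>)" "gval m F - \<delta>"]
        unfolding norm_mult complex_mod_cnj .
    qed
    also have "\<dots> \<le> e + (e * (H + 1) + H * e) + e"
    proof (intro add_mono mult_mono)
      show "norm (gval m C) \<le> H + 1"
        using norm_triangle_sub[of "gval m C" \<gamma>] near(3) nb(2) e(2) by linarith
    qed (use near nb e H in auto)
    also have "\<dots> = e * (2 * H + 3)" by (simp add: algebra_simps)
    finally have xy: "norm (x - y) \<le> e * (2 * H + 3)" .
    have "norm (x - y) * (16 * Q) \<le> e * (2 * H + 3) * (16 * Q)" using xy Q by (intro mult_right_mono) auto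
    also have "\<dots> < 1" using e(3) by (simp add: mult_ac)
    finally have xy: "norm (x - y) * (16 * Q) < 1" .
    have sep: "y \<noteq> 0 \<Longrightarrow> 1 \<le> norm y * Q"
      using root_bound_separation(1)[OF rb(1,2) root_bound_cnj[OF rb(3)] rb(4)]
      by (auto simp: y_def Q_def qsep_def)
    have UV: "real_of_int (U (int (2 ^ kprec m)) A B C F) = Re x * (D * D)"
      "real_of_int (V (int (2 ^ kprec m)) A B C F) = Im x * (D * D)"
      using D0 by (simp_all add: U_def V_def x_def gval_def D_def[symmetric] field_simps)
    have test: "\<bar>W\<bar> * int (4 * qsep m) < int (2 ^ kprec m) * int (2 ^ kprec m) \<longleftrightarrow> \<bar>w\<bar> * (4 * Q) < 1"
      if w: "real_of_int W = w * (D * D)" for W and w :: real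
    proof -
      have "\<bar>W\<bar> * int (4 * qsep m) < int (2 ^ kprec m) * int (2 ^ kprec m) \<longleftrightarrow>
        real_of_int (\<bar>W\<bar> * int (4 * qsep m)) < real_of_int (int (2 ^ kprec m) * int (2 ^ kprec m))"
        by (simp only: of_int_less_iff)
      also have "\<dots> \<longleftrightarrow> \<bar>w * (D * D)\<bar> * (4 * Q) < D * D" unfolding w[symmetric] by (simp add: D_def Q_def)
      also have "\<dots> \<longleftrightarrow> (\<bar>w\<bar> * (4 * Q)) * (D * D) < 1 * (D * D)" using D0 by (simp add: abs_mult mult_ac)
      also have "\<dots> \<longleftrightarrow> \<bar>w\<bar> * (4 * Q) < 1" using D0 by (simp add: mult_less_cancel_right)
      finally show ?thesis .
    qed
    have "T ((a, b), (c, f)) \<longleftrightarrow> \<bar>Re x\<bar> * (4 * Q) < 1 \<and> \<bar>Im x\<bar> * (4 * Q) < 1"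
      unfolding T_def Let_def M_def fst_conv snd_conv m_def[symmetric] D'[symmetric] test[OF UV(1)] test[OF UV(2)] ..
    also have "\<dots> \<longleftrightarrow> y = 0"
    proof
      assume "y = 0"
      hence nx: "norm x * (16 * Q) < 1" using xy by simp
      have "\<bar>Re x\<bar> * (4 * Q) \<le> norm x * (16 * Q)" "\<bar>Im x\<bar> * (4 * Q) \<le> norm x * (16 * Q)"
        using Q abs_Re_le_cmod[of x] abs_Im_le_cmod[of x] by (auto intro!: mult_mono)
      thus "\<bar>Re x\<bar> * (4 * Q) < 1 \<and> \<bar>Im x\<bar> * (4 * Q) < 1" using nx by linarith
    next
      assume x: "\<bar>Re x\<bar> * (4 * Q) < 1 \<and> \<bar>Im x\<bar> * (4 * Q) < 1"
      show "y = 0"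
      proof (rule ccontr)
        assume "y \<noteq> 0"
        \<comment> \<open>The three contributions bounding the right-hand side are below 1/4, 1/4
          and 1/16.\<close>
        hence "1 \<le> norm y * Q" by (rule sep)
        also have "\<dots> \<le> (\<bar>Re x\<bar> + \<bar>Im x\<bar> + norm (x - y)) * Q"
          using cmod_le[of x] norm_triangle_sub[of y x] Q by (intro mult_right_mono) (auto simp: norm_minus_commute)
        also have "\<dots> = \<bar>Re x\<bar> * Q + \<bar>Im x\<bar> * Q + norm (x - y) * Q" by (simp add: algebra_simps)
        finally show False using x xy by linarith
      qed
    qed
    finally show ?thesis unfolding d[symmetric] by (simp add: y_def)
  qed
  hence "T = (\<lambda>e. alg_decode (fst (fst e)) + alg_decode (snd (fst e)) * cnj (alg_decode (fst (snd e))) =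
      alg_decode (snd (snd e)))"
    by (simp add: fun_eq_iff)
  ultimately show ?thesis by (simp only:)
qed

text \<open>Arithmetic by search: a code of the result exists because algebraic numbers are closed
  under the operation, and it is recognised by the decision procedure.\<close>

lemma ex_mac: "\<exists>f :: nat \<times> nat \<times> nat \<Rightarrow> nat. cmp f \<and>
   (\<forall>a b c. alg_decode (f (a, b, c)) = alg_decode a + alg_decode b * cnj (alg_decode c))"
proof -
  have "sig (\<lambda>e :: (nat \<times> nat \<times> nat) \<times> nat. alg_decode (fst (fst e)) +
     alg_decode (fst (snd (fst e))) * cnj (alg_decode (snd (snd (fst e)))) = alg_decode (snd e))"
  proof -
    have "dec (\<lambda>e :: (nat \<times> nat \<times> nat) \<times> nat.
       (\<lambda>e :: (nat \<times> nat) \<times> nat \<times> nat. alg_decode (fst (fst e)) +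
     alg_decode (snd (fst e)) * cnj (alg_decode (fst (snd e))) = alg_decode (snd (snd e)))
     ((fst (fst e), fst (snd (fst e))), (snd (snd (fst e)), snd e)))"
      by (rule dec_o[OF dec_alg_eq]) (intro cmp)
    thus ?thesis by (intro sig_dec) simp
  qed
  then obtain f :: "nat \<times> nat \<times> nat \<Rightarrow> nat" where "cmp f"
    "\<And>e. alg_decode (fst e) + alg_decode (fst (snd e)) * cnj (alg_decode (snd (snd e))) = alg_decode (f e)"
  proof (rule sig_select[where P = "\<lambda>e y. alg_decode (fst e) + alg_decode (fst (snd e)) * cnj (alg_decode (snd (snd e))) = alg_decode y"])
    show "\<exists>y. alg_decode (fst e) + alg_decode (fst (snd e)) * cnj (alg_decode (snd (snd e))) = alg_decode y" for e :: "nat \<times> nat \<times> nat"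
    proof -
      obtain y where "alg_decode y = alg_decode (fst e) + alg_decode (fst (snd e)) * cnj (alg_decode (snd (snd e)))"
        using alg_decode_surj[OF algebraic_add_mult[OF algebraic_alg_decode algebraic_alg_decode
          algebraic_cnj[OF algebraic_alg_decode]]] by blast
      thus ?thesis by (intro exI[of _ y]) simp
    qed
  qed blast
  thus ?thesis by (intro exI[of _ f]) auto
qed

definition mac :: "nat \<times> nat \<times> nat \<Rightarrow> nat" where
  "mac = (SOME f. cmp f \<and> (\<forall>a b c. alg_decode (f (a, b, c)) = alg_decode a + alg_decode b * cnj (alg_decode c)))"

lemma cmp_mac': "cmp mac"
  and alg_decode_mac: "alg_decode (mac (a, b, c)) = alg_decode a + alg_decode b * cnj (alg_decode c)"
  using someI_ex[OF ex_mac] unfolding mac_def[symmetric] by blast+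

lemma cmp_mac [cmp]: "cmp f \<Longrightarrow> cmp (\<lambda>x. mac (f x))"
  by (rule cmp_o[OF cmp_mac'])

definition code_zero :: nat where "code_zero = (SOME c. alg_decode c = 0)"
definition code_one :: nat where "code_one = (SOME c. alg_decode c = 1)"

lemma alg_decode_zero: "alg_decode code_zero = 0" and alg_decode_one: "alg_decode code_one = 1"
  unfolding code_zero_def code_one_def
  by (rule someI_ex[OF alg_decode_surj[OF algebraic_0]], rule someI_ex[OF alg_decode_surj[OF algebraic_1]])

lemma dec_alg_decode_eq [cmp]:
  assumes "cmp f" "cmp g"
  shows "dec (\<lambda>x. alg_decode (f x) = alg_decode (g x))"
proof -
  have "dec (\<lambda>x. (\<lambda>e :: (nat \<times> nat) \<times> nat \<times> nat. alg_decode (fst (fst e)) +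
     alg_decode (snd (fst e)) * cnj (alg_decode (fst (snd e))) = alg_decode (snd (snd e)))
     ((f x, code_zero), (code_zero, g x)))"
    by (rule dec_o[OF dec_alg_eq]) (intro cmp assms)
  thus ?thesis by (simp add: alg_decode_zero)
qed

section \<open>Projections and orthonormal sets\<close>

definition proj_of :: "nat \<Rightarrow> complex vec set \<Rightarrow> complex mat" where
  "proj_of n F = mat (2 ^ n) (2 ^ n) (\<lambda>(i, k). \<Sum>v\<in>F. v $ i * cnj (v $ k))"

lemma cscalar_prod_sum: "dim_vec v = dim_vec w \<Longrightarrow> v \<bullet>c w = (\<Sum>i<dim_vec w. v $ i * cnj (w $ i :: complex))"
  by (simp add: scalar_prod_def atLeast0LessThan conjugate_complex_def)

lemma mat_adjoint_index:
  "i < dim_col A \<Longrightarrow> j < dim_row A \<Longrightarrow> mat_adjoint A $$ (i, j) = cnj (A $$ (j, i) :: complex)"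
  by (simp add: mat_adjoint_def mat_of_rows_def conjugate_complex_def)

lemma mat_adjoint_eq_iff:
  "A \<in> carrier_mat n n \<Longrightarrow> mat_adjoint A = A \<longleftrightarrow> (\<forall>i<n. \<forall>j<n. cnj (A $$ (j, i)) = (A $$ (i, j) :: complex))"
  by (auto simp: mat_eq_iff mat_adjoint_index) (simp_all add: mat_adjoint_def)

lemma orthonormal_sum:
  assumes "orthonormal_set n F" "v \<in> F" "w \<in> F"
  shows "(\<Sum>i<2^n. v $ i * cnj (w $ i)) = (if v = w then 1 else 0)"
proof -
  have "v \<in> carrier_vec (2^n)" "w \<in> carrier_vec (2^n)" using assms unfolding orthonormal_set_def by auto
  thus ?thesis using assms cscalar_prod_sum[of v w] unfolding orthonormal_set_def by auto
qed

lemma special_projection_proj_of: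
  assumes on: "orthonormal_set n F" and fin: "finite F"
    and alg: "\<And>v i. v \<in> F \<Longrightarrow> i < 2^n \<Longrightarrow> algebraic (v $ i)"
  shows "special_projection n (proj_of n F)"
  unfolding special_projection_def
proof (intro conjI allI impI)
  show c: "proj_of n F \<in> carrier_mat (2^n) (2^n)" by (simp add: proj_of_def)
  show "mat_adjoint (proj_of n F) = proj_of n F"
    unfolding mat_adjoint_eq_iff[OF c] by (simp add: proj_of_def mult.commute)
  show "algebraic (proj_of n F $$ (i, j))" if "i < 2^n" "j < 2^n" for i j
    using that by (auto simp: proj_of_def intro!: algebraic_sum algebraic_mult algebraic_cnj alg)
  show "proj_of n F * proj_of n F = proj_of n F"
  proof (rule eq_matI)
    fix i k assume "i < dim_row (proj_of n F)" "k < dim_col (proj_of n F)"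
    hence ik: "i < 2^n" "k < 2^n" by (simp_all add: proj_of_def)
    have "(proj_of n F * proj_of n F) $$ (i, k) =
        (\<Sum>j<2^n. (\<Sum>v\<in>F. v $ i * cnj (v $ j)) * (\<Sum>w\<in>F. w $ j * cnj (w $ k)))"
      using ik by (simp add: proj_of_def scalar_prod_def atLeast0LessThan)
    also have "\<dots> = (\<Sum>j<2^n. \<Sum>v\<in>F. \<Sum>w\<in>F. v $ i * cnj (w $ k) * (w $ j * cnj (v $ j)))"
      unfolding sum_product by (intro sum.cong refl) (simp add: mult_ac)
    also have "\<dots> = (\<Sum>v\<in>F. \<Sum>w\<in>F. v $ i * cnj (w $ k) * (\<Sum>j<2^n. w $ j * cnj (v $ j)))"
      unfolding sum_distrib_left
      by (subst sum.swap, intro sum.cong refl, subst sum.swap, rule refl)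
    also have "\<dots> = (\<Sum>v\<in>F. \<Sum>w\<in>F. if w = v then v $ i * cnj (w $ k) else 0)"
      by (intro sum.cong refl) (simp add: orthonormal_sum[OF on])
    also have "\<dots> = (\<Sum>v\<in>F. v $ i * cnj (v $ k))" using fin by (simp add: sum.delta)
    also have "\<dots> = proj_of n F $$ (i, k)" using ik by (simp add: proj_of_def)
    finally show "(proj_of n F * proj_of n F) $$ (i, k) = proj_of n F $$ (i, k)" .
  qed (simp_all add: proj_of_def)
qed

lemma mtrace_proj_of:
  assumes "orthonormal_set n F"
  shows "mtrace (proj_of n F) = of_nat (card F)"
proof -
  have "mtrace (proj_of n F) = (\<Sum>i<2^n. \<Sum>v\<in>F. v $ i * cnj (v $ i))"
    by (simp add: mtrace_def proj_of_def)
  also have "\<dots> = (\<Sum>v\<in>F. \<Sum>i<2^n. v $ i * cnj (v $ i))" by (rule sum.swap)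
  also have "\<dots> = (\<Sum>v\<in>F. 1)" by (intro sum.cong refl) (simp add: orthonormal_sum[OF assms])
  finally show ?thesis by simp
qed

lemma tau_val_proj_of: "orthonormal_set n F \<Longrightarrow> tau_val (n, proj_of n F) = real (card F) / 2 ^ n"
  by (simp add: tau_val_def mtrace_proj_of)

lemma rho_val_proj_of:
  assumes "orthonormal_set n F" "\<rho> n \<in> carrier_mat (2^n) (2^n)"
  shows "rho_val \<rho> (n, proj_of n F) = (\<Sum>v\<in>F. Re ((\<rho> n *\<^sub>v v) \<bullet>c v))"
proof -
  have v: "v \<in> carrier_vec (2^n)" if "v \<in> F" for v using assms(1) that by (auto simp: orthonormal_set_def)
  have "mtrace (\<rho> n * proj_of n F) = (\<Sum>i<2^n. \<Sum>j<2^n. \<rho> n $$ (i, j) * (\<Sum>v\<in>F. v $ j * cnj (v $ i)))"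
    using assms(2) by (simp add: mtrace_def proj_of_def scalar_prod_def atLeast0LessThan)
  also have "\<dots> = (\<Sum>i<2^n. \<Sum>v\<in>F. \<Sum>j<2^n. \<rho> n $$ (i, j) * v $ j * cnj (v $ i))"
    unfolding sum_distrib_left by (intro sum.cong refl) (subst sum.swap, simp add: mult.assoc)
  also have "\<dots> = (\<Sum>v\<in>F. \<Sum>i<2^n. (\<Sum>j<2^n. \<rho> n $$ (i, j) * v $ j) * cnj (v $ i))"
    by (subst sum.swap) (simp add: sum_distrib_right)
  also have "\<dots> = (\<Sum>v\<in>F. (\<rho> n *\<^sub>v v) \<bullet>c v)"
  proof (intro sum.cong refl)
    fix v assume "v \<in> F"
    from v[OF this] have dv: "dim_vec v = 2^n" by simp
    have dr: "dim_row (\<rho> n) = 2^n" "dim_col (\<rho> n) = 2^n" using assms(2) by auto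
    have "(\<rho> n *\<^sub>v v) \<bullet>c v = (\<Sum>i<2^n. (\<rho> n *\<^sub>v v) $ i * cnj (v $ i))"
      using cscalar_prod_sum[of "\<rho> n *\<^sub>v v" v] dv dr by simp
    also have "\<dots> = (\<Sum>i<2^n. (\<Sum>j<2^n. \<rho> n $$ (i, j) * v $ j) * cnj (v $ i))"
      using dv dr by (intro sum.cong refl) (simp add: scalar_prod_def atLeast0LessThan)
    finally show "(\<Sum>i<2^n. (\<Sum>j<2^n. \<rho> n $$ (i, j) * v $ j) * cnj (v $ i)) = (\<rho> n *\<^sub>v v) \<bullet>c v" ..
  qed
  finally show ?thesis by (simp add: rho_val_def)
qed

text \<open>Peel off the normalised column of a nonzero diagonal entry. The entry itself becomes zero and
  zero diagonal entries stay zero, so the process stops.\<close>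
lemma projection_decomposition:
  fixes S :: "nat \<Rightarrow> nat \<Rightarrow> complex"
  assumes herm: "\<And>i k. i < 2^n \<Longrightarrow> k < 2^n \<Longrightarrow> S k i = cnj (S i k)"
    and idem: "\<And>i k. i < 2^n \<Longrightarrow> k < 2^n \<Longrightarrow> (\<Sum>j<2^n. S i j * S j k) = S i k"
    and alg: "\<And>i k. i < 2^n \<Longrightarrow> k < 2^n \<Longrightarrow> algebraic (S i k)"
  shows "\<exists>F. finite F \<and> orthonormal_set n F \<and> (\<forall>v\<in>F. \<forall>i<2^n. algebraic (v $ i)) \<and>
    (\<forall>i<2^n. \<forall>k<2^n. S i k = (\<Sum>v\<in>F. v $ i * cnj (v $ k)))"
  using assms
proof (induction "card {i. i < 2^n \<and> S i i \<noteq> 0}" arbitrary: S rule: less_induct)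
  case less
  note herm = less.prems(1) and idem = less.prems(2) and alg = less.prems(3)
  \<comment> \<open>A diagonal entry is the squared norm of its row, so where it is zero the whole
    row vanishes.\<close>
  have diag: "S i i = of_real (\<Sum>j<2^n. (norm (S i j))\<^sup>2)" if "i < 2^n" for i
  proof -
    have "S i i = (\<Sum>j<2^n. S i j * cnj (S i j))"
      unfolding idem[OF that that, symmetric]
    proof (intro sum.cong refl)
      fix j :: nat assume "j \<in> {..<2^n}"
      hence "S j i = cnj (S i j)" by (intro herm that) simp
      thus "S i j * S j i = S i j * cnj (S i j)" by (simp only:)
    qed
    thus ?thesis by (simp add: complex_norm_square del: of_real_power)
  qed
  have diag0: "S i k = 0" if "i < 2^n" "k < 2^n" "S i i = 0" for i k
  proof -
    have "(\<Sum>j<2^n. (norm (S i j))\<^sup>2) = 0"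
    proof (rule of_real_eq_iff[THEN iffD1])
      show "complex_of_real (\<Sum>j<2^n. (norm (S i j))\<^sup>2) = of_real 0"
        unfolding diag[OF that(1), symmetric] that(3) by simp
    qed
    hence "(norm (S i k))\<^sup>2 = 0" using that(2) by (subst (asm) sum_nonneg_eq_0_iff) auto
    thus ?thesis by simp
  qed
  show ?case
  proof (cases "\<exists>t<2^n. S t t \<noteq> 0")
    case False
    hence "S i k = 0" if "i < 2^n" "k < 2^n" for i k using diag0 that by blast
    thus ?thesis by (intro exI[of _ "{}"]) (simp add: orthonormal_set_def)
  next
    case True
    then obtain t where t: "t < 2^n" "S t t \<noteq> 0" by blast
    define s where "s = (\<Sum>j<2^n. (norm (S t j))\<^sup>2)"
    have Stt: "S t t = of_real s" using diag[OF t(1)] by (simp add: s_def)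
    have s0: "0 < s"
    proof -
      have "0 \<le> s" unfolding s_def by (intro sum_nonneg) auto
      moreover have "s \<noteq> 0" using t(2) Stt by auto
      ultimately show ?thesis by simp
    qed
    \<comment> \<open>s is the squared norm of row t and, by symmetry, of column t; dividing the
      column by the square root of s makes it a unit vector. As s is an entry of S, its square root
      is algebraic.\<close>
    define r where "r = complex_of_real (sqrt s)"
    have r: "r \<noteq> 0" "r * r = of_real s" "cnj r = r"
      using s0 by (simp_all add: r_def flip: of_real_mult)
    have algr: "algebraic r"
    proof -
      have "r = csqrt (S t t)" unfolding Stt r_def using s0 by (intro of_real_sqrt) simp
      thus ?thesis using alg[OF t(1) t(1)] by auto
    qed
    define f where "f = (\<lambda>i. S i t / r)"
    have fc: "f i * cnj (f k) = S i t * S t k / of_real s" if "i < 2^n" "k < 2^n" for i k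
      using r herm[OF that(2) t(1)] by (simp add: f_def)
    have ff: "(\<Sum>i<2^n. f i * cnj (f i)) = 1"
    proof -
      have "(\<Sum>i<2^n. f i * cnj (f i)) = (\<Sum>i<2^n. S t i * S i t / of_real s)"
        by (intro sum.cong refl) (simp add: fc mult.commute)
      also have "\<dots> = (\<Sum>i<2^n. S t i * S i t) / of_real s" by (simp add: sum_divide_distrib)
      also have "\<dots> = 1" using idem[OF t(1) t(1)] Stt s0 by simp
      finally show ?thesis .
    qed
    have Sf: "(\<Sum>j<2^n. S i j * f j) = f i" if "i < 2^n" for i
      using idem[OF that t(1)] by (simp add: f_def sum_divide_distrib[symmetric])
    have fS: "(\<Sum>j<2^n. cnj (f j) * S j k) = cnj (f k)" if "k < 2^n" for k
    proof -
      have "(\<Sum>j<2^n. cnj (f j) * S j k) = cnj (\<Sum>j<2^n. S k j * f j)"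
        unfolding cnj_sum
      proof (intro sum.cong refl)
        fix j :: nat assume "j \<in> {..<2^n}"
        hence e: "S j k = cnj (S k j)" by (intro herm that) simp
        show "cnj (f j) * S j k = cnj (S k j * f j)" unfolding e by simp
      qed
      thus ?thesis using Sf[OF that] by simp
    qed
    define S' where "S' = (\<lambda>i k. S i k - f i * cnj (f k))"
    have S'f: "(\<Sum>j<2^n. S' i j * f j) = 0" if "i < 2^n" for i
    proof -
      have "(\<Sum>j<2^n. S' i j * f j) = (\<Sum>j<2^n. S i j * f j) - f i * (\<Sum>j<2^n. f j * cnj (f j))"
        by (simp add: S'_def sum_subtractf sum_distrib_left algebra_simps)
      thus ?thesis using Sf[OF that] ff by simp
    qed
    have "\<exists>F. finite F \<and> orthonormal_set n F \<and> (\<forall>v\<in>F. \<forall>i<2^n. algebraic (v $ i)) \<and>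
      (\<forall>i<2^n. \<forall>k<2^n. S' i k = (\<Sum>v\<in>F. v $ i * cnj (v $ k)))"
    proof (rule less.hyps)
      show "card {i. i < 2^n \<and> S' i i \<noteq> 0} < card {i. i < 2^n \<and> S i i \<noteq> 0}"
      proof (rule psubset_card_mono)
        have "S' i i = 0" if "i < 2^n" "S i i = 0" for i
          using diag0[OF that(1) _ that(2)] that t(1) by (simp add: S'_def f_def)
        moreover have "S' t t = 0" using fc[OF t(1) t(1)] Stt s0 by (simp add: S'_def)
        ultimately show "{i. i < 2^n \<and> S' i i \<noteq> 0} \<subset> {i. i < 2^n \<and> S i i \<noteq> 0}" using t by blast
      qed auto
      show "S' k i = cnj (S' i k)" if "i < 2^n" "k < 2^n" for i k
        using herm[OF that] by (simp add: S'_def mult.commute)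
      show "algebraic (S' i k)" if "i < 2^n" "k < 2^n" for i k
        unfolding S'_def f_def divide_inverse
        by (intro algebraic_diff algebraic_mult algebraic_cnj algebraic_inverse alg that t(1) algr)
      show "(\<Sum>j<2^n. S' i j * S' j k) = S' i k" if ik: "i < 2^n" "k < 2^n" for i k
      proof -
        have "(\<Sum>j<2^n. S' i j * S' j k) = (\<Sum>j<2^n. S' i j * S j k) - (\<Sum>j<2^n. S' i j * f j) * cnj (f k)"
          unfolding sum_distrib_right sum_subtractf[symmetric] by (intro sum.cong refl) (simp add: S'_def algebra_simps)
        also have "\<dots> = (\<Sum>j<2^n. S i j * S j k) - f i * (\<Sum>j<2^n. cnj (f j) * S j k)"
          unfolding S'f[OF ik(1)] sum_distrib_left mult_zero_left diff_zero sum_subtractf[symmetric]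
          by (intro sum.cong refl) (simp add: S'_def algebra_simps)
        finally show ?thesis using idem[OF ik] fS[OF ik(2)] by (simp add: S'_def)
      qed
    qed
    then obtain F where F: "finite F" "orthonormal_set n F" "\<And>v i. v \<in> F \<Longrightarrow> i < 2^n \<Longrightarrow> algebraic (v $ i)"
      "\<And>i k. i < 2^n \<Longrightarrow> k < 2^n \<Longrightarrow> S' i k = (\<Sum>v\<in>F. v $ i * cnj (v $ k))" by blast
    define u where "u = vec (2^n) f"
    have u: "u \<in> carrier_vec (2^n)" "\<And>i. i < 2^n \<Longrightarrow> u $ i = f i" by (simp_all add: u_def)
    have Fc: "v \<in> carrier_vec (2^n)" if "v \<in> F" for v using F(2) that by (auto simp: orthonormal_set_def)
    \<comment> \<open>S' annihilates f. Expanding S' over F and pairing the result with w leaves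
      only the term of w.\<close>
    have orth: "(\<Sum>i<2^n. f i * cnj (w $ i)) = 0" if w: "w \<in> F" for w
    proof -
      have "0 = (\<Sum>i<2^n. (\<Sum>k<2^n. S' i k * f k) * cnj (w $ i))" by (simp add: S'f)
      also have "\<dots> = (\<Sum>i<2^n. \<Sum>k<2^n. \<Sum>v\<in>F. (f k * cnj (v $ k)) * (v $ i * cnj (w $ i)))"
        unfolding sum_distrib_right by (intro sum.cong refl) (simp add: F(4) sum_distrib_left sum_distrib_right mult_ac)
      also have "\<dots> = (\<Sum>i<2^n. \<Sum>v\<in>F. \<Sum>k<2^n. (f k * cnj (v $ k)) * (v $ i * cnj (w $ i)))"
        by (intro sum.cong refl sum.swap)
      also have "\<dots> = (\<Sum>v\<in>F. \<Sum>i<2^n. \<Sum>k<2^n. (f k * cnj (v $ k)) * (v $ i * cnj (w $ i)))" by (rule sum.swap)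
      also have "\<dots> = (\<Sum>v\<in>F. (\<Sum>k<2^n. f k * cnj (v $ k)) * (\<Sum>i<2^n. v $ i * cnj (w $ i)))"
        by (intro sum.cong refl) (subst sum.swap, rule sum_product[symmetric])
      also have "\<dots> = (\<Sum>v\<in>F. if v = w then (\<Sum>k<2^n. f k * cnj (v $ k)) else 0)"
        using w by (intro sum.cong refl) (simp add: orthonormal_sum[OF F(2)])
      also have "\<dots> = (\<Sum>k<2^n. f k * cnj (w $ k))" using w F(1) by (simp add: sum.delta)
      finally show ?thesis by simp
    qed
    have uu: "u \<bullet>c u = 1" using ff cscalar_prod_sum[of u u] u by simp
    have uw: "u \<bullet>c w = 0" if "w \<in> F" for w
      using orth[OF that] cscalar_prod_sum[of u w] u Fc[OF that] by simp
    have wu: "w \<bullet>c u = 0" if "w \<in> F" for w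
    proof -
      have "w \<bullet>c u = cnj (\<Sum>i<2^n. f i * cnj (w $ i))"
        unfolding cnj_sum using cscalar_prod_sum[of w u] u Fc[OF that] by (simp add: mult.commute)
      thus ?thesis using orth[OF that] by simp
    qed
    have "u \<notin> F" using uu uw by auto
    show ?thesis
    proof (intro exI[of _ "insert u F"] conjI ballI allI impI)
      show "orthonormal_set n (insert u F)"
        unfolding orthonormal_set_def
      proof (intro conjI ballI)
        fix v w assume "v \<in> insert u F" "w \<in> insert u F"
        thus "v \<bullet>c w = (if v = w then 1 else 0)"
          using F(2) uu uw wu \<open>u \<notin> F\<close> unfolding orthonormal_set_def by auto
      qed (use u Fc in auto)
      show "algebraic (v $ i)" if "v \<in> insert u F" "i < 2^n" for v i
      proof (cases "v = u")
        case True
        show ?thesis using that(2) unfolding True u(2)[OF that(2)] f_def divide_inverse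
          by (intro algebraic_mult algebraic_inverse algr alg t(1))
      qed (use that F(3) in auto)
      show "S i k = (\<Sum>v\<in>insert u F. v $ i * cnj (v $ k))" if "i < 2^n" "k < 2^n" for i k
        using F(1) \<open>u \<notin> F\<close> F(4)[OF that, symmetric] u(2) that by (simp add: S'_def)
    qed (use F(1) in simp)
  qed
qed

lemma special_projection_decomposition:
  assumes "special_projection n S"
  shows "\<exists>F. finite F \<and> orthonormal_set n F \<and> (\<forall>v\<in>F. \<forall>i<2^n. algebraic (v $ i)) \<and> S = proj_of n F"
proof -
  note d = assms[unfolded special_projection_def]
  have c: "S \<in> carrier_mat (2^n) (2^n)" using d by blast
  have "\<exists>F. finite F \<and> orthonormal_set n F \<and> (\<forall>v\<in>F. \<forall>i<2^n. algebraic (v $ i)) \<and>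
    (\<forall>i<2^n. \<forall>k<2^n. S $$ (i, k) = (\<Sum>v\<in>F. v $ i * cnj (v $ k)))"
  proof (rule projection_decomposition)
    show "S $$ (k, i) = cnj (S $$ (i, k))" if "i < 2^n" "k < 2^n" for i k
      using d that unfolding mat_adjoint_eq_iff[OF c] by simp
    show "(\<Sum>j<2^n. S $$ (i, j) * S $$ (j, k)) = S $$ (i, k)" if "i < 2^n" "k < 2^n" for i k
    proof -
      have "(S * S) $$ (i, k) = (\<Sum>j<2^n. S $$ (i, j) * S $$ (j, k))"
        using c that by (simp add: scalar_prod_def atLeast0LessThan)
      thus ?thesis using d by simp
    qed
  qed (use d in auto)
  then obtain F where F: "finite F" "orthonormal_set n F" "\<forall>v\<in>F. \<forall>i<2^n. algebraic (v $ i)"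
    "\<forall>i<2^n. \<forall>k<2^n. S $$ (i, k) = (\<Sum>v\<in>F. v $ i * cnj (v $ k))" by blast
  have "S = proj_of n F" by (rule eq_matI) (use c F(4) in \<open>auto simp: proj_of_def\<close>)
  with F show ?thesis by blast
qed

section \<open>Codes of orthonormal sets and of projections\<close>

definition set_elems :: "nat \<Rightarrow> nat list" where
  "set_elems c = filter (\<lambda>v. v \<in> set_decode c) [0..<c]"

definition vec_entry :: "nat \<Rightarrow> nat \<Rightarrow> nat" where
  "vec_entry v i = nthd (dcd v :: nat list) i"

definition vec_len :: "nat \<Rightarrow> nat" where
  "vec_len v = length (dcd v :: nat list)"

definition vec_eq :: "nat \<Rightarrow> nat \<Rightarrow> bool" where
  "vec_eq v w \<longleftrightarrow> vec_len v = vec_len w \<and>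
     (\<forall>i<vec_len v. alg_decode (vec_entry v i) = alg_decode (vec_entry w i))"

definition vec_ip :: "nat \<Rightarrow> nat \<Rightarrow> nat" where
  "vec_ip v w = fold (\<lambda>i r. mac (r, vec_entry v i, vec_entry w i)) [0..<vec_len v] code_zero"

text \<open>Whether an inner product has to be 1 or 0 is decided by \<open>vec_eq\<close>, since
  different codes in the set may denote one vector.\<close>

definition orth_code :: "nat \<Rightarrow> nat \<Rightarrow> bool" where
  "orth_code n c \<longleftrightarrow> (\<forall>v\<in>set (set_elems c). vec_len v = 2 ^ n) \<and>
     (\<forall>v\<in>set (set_elems c). \<forall>w\<in>set (set_elems c).
       alg_decode (vec_ip v w) = alg_decode (if vec_eq v w then code_one else code_zero))"

text \<open>Distinct codes may denote the same vector; keep the least code of each vector.\<close>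
definition set_reps :: "nat \<Rightarrow> nat list" where
  "set_reps c = filter (\<lambda>v. \<forall>w\<in>set (set_elems c). vec_eq w v \<longrightarrow> v \<le> w) (set_elems c)"

definition proj_entry :: "nat \<Rightarrow> nat \<Rightarrow> nat \<Rightarrow> nat" where
  "proj_entry c i k = fold (\<lambda>v r. mac (r, vec_entry v i, vec_entry v k)) (set_reps c) code_zero"

definition proj_code :: "nat \<Rightarrow> nat \<Rightarrow> nat" where
  "proj_code n c = enc (n, map (\<lambda>t. proj_entry c (t div 2 ^ n) (t mod 2 ^ n)) [0..<2 ^ n * 2 ^ n])"

text \<open>The padding by a code of 0 follows \<open>mat_decode\<close>, which fills lists that are
  too short.\<close>

definition mat_entry :: "nat \<Rightarrow> nat \<Rightarrow> nat" where
  "mat_entry M t = (let L = snd (dcd M :: nat \<times> nat list) in if t < length L then nthd L t else code_zero)"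

text \<open>A decidable certificate that c is an orthonormal basis of the range of the coded
  projection: finitely many equalities between coded numbers.\<close>

definition spans_code :: "nat \<Rightarrow> nat \<Rightarrow> bool" where
  "spans_code M c \<longleftrightarrow> (let n = fst (dcd M :: nat \<times> nat list) in orth_code n c \<and>
     (\<forall>t<2 ^ n * 2 ^ n. alg_decode (mat_entry (proj_code n c) t) = alg_decode (mat_entry M t)))"

section \<open>Computability and correctness of the operations on codes\<close>

lemma cmp_set_elems [cmp]: "cmp f \<Longrightarrow> cmp (\<lambda>x. set_elems (f x))"
  by (rule cmp_o[of set_elems]) (unfold set_elems_def, intro cmp)
lemma cmp_vec_entry [cmp]: "cmp f \<Longrightarrow> cmp g \<Longrightarrow> cmp (\<lambda>x. vec_entry (f x) (g x))"
  unfolding vec_entry_def by (intro cmp)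
lemma cmp_vec_len [cmp]: "cmp f \<Longrightarrow> cmp (\<lambda>x. vec_len (f x))"
  unfolding vec_len_def by (intro cmp)
lemma dec_vec_eq [cmp]: "cmp f \<Longrightarrow> cmp g \<Longrightarrow> dec (\<lambda>x. vec_eq (f x) (g x))"
  by (rule dec_o2[of vec_eq]) (unfold vec_eq_def, intro cmp)
lemma cmp_vec_ip [cmp]: "cmp f \<Longrightarrow> cmp g \<Longrightarrow> cmp (\<lambda>x. vec_ip (f x) (g x))"
  by (rule cmp_o2[of vec_ip]) (unfold vec_ip_def, intro cmp)
lemma dec_orth_code [cmp]: "cmp f \<Longrightarrow> cmp g \<Longrightarrow> dec (\<lambda>x. orth_code (f x) (g x))"
  by (rule dec_o2[of orth_code]) (unfold orth_code_def, intro cmp)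
lemma cmp_set_reps [cmp]: "cmp f \<Longrightarrow> cmp (\<lambda>x. set_reps (f x))"
  by (rule cmp_o[of set_reps]) (unfold set_reps_def, intro cmp)
lemma cmp_proj_entry [cmp]: "cmp f \<Longrightarrow> cmp g \<Longrightarrow> cmp h \<Longrightarrow> cmp (\<lambda>x. proj_entry (f x) (g x) (h x))"
  by (rule cmp_o3[of proj_entry]) (unfold proj_entry_def, intro cmp)
lemma cmp_proj_code [cmp]: "cmp f \<Longrightarrow> cmp g \<Longrightarrow> cmp (\<lambda>x. proj_code (f x) (g x))"
  by (rule cmp_o2[of proj_code]) (unfold proj_code_def, intro cmp)
lemma cmp_mat_entry [cmp]: "cmp f \<Longrightarrow> cmp g \<Longrightarrow> cmp (\<lambda>x. mat_entry (f x) (g x))"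
  unfolding mat_entry_def Let_def by (intro cmp)
lemma dec_spans_code [cmp]: "cmp f \<Longrightarrow> cmp g \<Longrightarrow> dec (\<lambda>x. spans_code (f x) (g x))"
  by (rule dec_o2[of spans_code]) (unfold spans_code_def Let_def, intro cmp)

text \<open>Membership of v means that the v-th binary digit of c is 1, hence v < 2^v, which is at
  most c.\<close>

lemma set_set_elems: "set (set_elems c) = set_decode c"
proof -
  have "v < c" if "v \<in> set_decode c" for v
  proof -
    have "c div 2 ^ v \<noteq> 0" using that by (auto simp: set_decode_def intro: ccontr)
    hence "2 ^ v \<le> c" by (simp add: div_eq_0_iff not_less)
    moreover have "v < 2 ^ v" by (rule less_exp)
    ultimately show ?thesis by linarith
  qed
  thus ?thesis by (auto simp: set_elems_def)
qed

lemma vec_decode_carrier: "vec_decode v \<in> carrier_vec (vec_len v)"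
  by (rule carrier_vecI) (simp add: vec_decode_def vec_len_def dcd_list_def)

lemma vec_decode_entry: "i < vec_len v \<Longrightarrow> vec_decode v $ i = alg_decode (vec_entry v i)"
  by (simp add: vec_decode_def vec_len_def vec_entry_def dcd_list_def vec_of_list_index)

lemma vec_eq_iff_decode: "vec_eq v w \<longleftrightarrow> vec_decode v = vec_decode w"
  using vec_decode_carrier[of v] vec_decode_carrier[of w]
  by (auto simp: vec_eq_def vec_eq_iff vec_decode_entry)

lemma alg_decode_fold_mac:
  "alg_decode (fold (\<lambda>i r. mac (r, f i, g i)) xs a) =
    alg_decode a + (\<Sum>i\<leftarrow>xs. alg_decode (f i) * cnj (alg_decode (g i)))"
  by (induction xs arbitrary: a) (simp_all add: alg_decode_mac)

lemma alg_decode_vec_ip: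
  "vec_len v = vec_len w \<Longrightarrow> alg_decode (vec_ip v w) = vec_decode v \<bullet>c vec_decode w"
  using vec_decode_carrier[of v] vec_decode_carrier[of w]
  by (simp add: vec_ip_def alg_decode_fold_mac alg_decode_zero cscalar_prod_sum vec_decode_entry
      interv_sum_list_conv_sum_set_nat atLeast0LessThan)

lemma orth_code_iff: "orth_code n c \<longleftrightarrow> orthonormal_set n (vset_decode c)"
proof -
  have len: "vec_decode v \<in> carrier_vec k \<longleftrightarrow> vec_len v = k" for v k
    using vec_decode_carrier[of v] unfolding carrier_vec_def by simp
  have "alg_decode (if vec_eq v w then code_one else code_zero) = (if vec_decode v = vec_decode w then 1 else 0)" for v w
    by (simp add: vec_eq_iff_decode alg_decode_one alg_decode_zero)
  thus ?thesis
    unfolding orth_code_def orthonormal_set_def vset_decode_def set_set_elems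
    by (auto simp: len alg_decode_vec_ip image_subset_iff)
qed

lemma set_reps_inj: "inj_on vec_decode (set (set_reps c))"
proof (rule inj_onI)
  fix v w assume "v \<in> set (set_reps c)" "w \<in> set (set_reps c)" "vec_decode v = vec_decode w"
  hence "v \<le> w" "w \<le> v" by (auto simp: set_reps_def vec_eq_iff_decode)
  thus "v = w" by simp
qed

lemma set_reps_image: "vec_decode ` set (set_reps c) = vset_decode c"
proof
  show "vec_decode ` set (set_reps c) \<subseteq> vset_decode c"
    by (auto simp: set_reps_def set_set_elems vset_decode_def)
  show "vset_decode c \<subseteq> vec_decode ` set (set_reps c)"
  proof
    fix x assume "x \<in> vset_decode c"
    then obtain v where v: "v \<in> set_decode c" "x = vec_decode v" by (auto simp: vset_decode_def)
    define w where "w = (LEAST w. w \<in> set_decode c \<and> vec_decode w = x)"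
    have w: "w \<in> set_decode c \<and> vec_decode w = x"
      unfolding w_def by (rule LeastI[of _ v]) (use v in simp)
    have "w \<le> u" if "u \<in> set_decode c" "vec_decode u = x" for u
      unfolding w_def by (rule Least_le) (use that in simp)
    hence "w \<in> set (set_reps c)" using w by (auto simp: set_reps_def set_set_elems vec_eq_iff_decode)
    thus "x \<in> vec_decode ` set (set_reps c)" using w by blast
  qed
qed

lemma distinct_set_reps: "distinct (set_reps c)"
  by (simp add: set_reps_def set_elems_def)

lemma card_vset_decode: "card (vset_decode c) = length (set_reps c)"
  unfolding set_reps_image[symmetric]
  by (simp add: card_image[OF set_reps_inj] distinct_card[OF distinct_set_reps])

lemma finite_vset_decode: "finite (vset_decode c)"
  by (simp add: vset_decode_def)

lemma algebraic_vset_decode: "v \<in> vset_decode c \<Longrightarrow> i < dim_vec v \<Longrightarrow> algebraic (v $ i)"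
proof -
  assume "v \<in> vset_decode c" "i < dim_vec v"
  then obtain w where "v = vec_decode w" "i < dim_vec (vec_decode w)" by (auto simp: vset_decode_def)
  thus ?thesis using carrier_vecD[OF vec_decode_carrier[of w]] by (simp add: vec_decode_entry algebraic_alg_decode)
qed

lemma alg_decode_proj_entry:
  assumes "orth_code n c" "i < 2 ^ n" "k < 2 ^ n"
  shows "alg_decode (proj_entry c i k) = proj_of n (vset_decode c) $$ (i, k)"
proof -
  have len: "vec_len v = 2 ^ n" if "v \<in> set (set_reps c)" for v
    using assms(1) that by (auto simp: orth_code_def set_reps_def)
  have "alg_decode (proj_entry c i k) =
      (\<Sum>v\<leftarrow>set_reps c. alg_decode (vec_entry v i) * cnj (alg_decode (vec_entry v k)))"
    by (simp add: proj_entry_def alg_decode_fold_mac alg_decode_zero)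
  also have "\<dots> = (\<Sum>v\<in>set (set_reps c). alg_decode (vec_entry v i) * cnj (alg_decode (vec_entry v k)))"
    by (rule sum_list_distinct_conv_sum_set[OF distinct_set_reps])
  also have "\<dots> = (\<Sum>v\<in>set (set_reps c). vec_decode v $ i * cnj (vec_decode v $ k))"
    using len assms by (intro sum.cong refl) (simp add: vec_decode_entry)
  also have "\<dots> = (\<Sum>v\<in>vset_decode c. v $ i * cnj (v $ k))"
    unfolding set_reps_image[symmetric] by (simp add: sum.reindex[OF set_reps_inj])
  finally show ?thesis using assms by (simp add: proj_of_def)
qed

lemma mat_decode_altdef:
  "mat_decode M = (let n = fst (dcd M :: nat \<times> nat list) in
     (n, mat (2^n) (2^n) (\<lambda>(i, j). alg_decode (mat_entry M (i * 2 ^ n + j)))))"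
proof -
  have "(if t < length (list_decode c) then alg_decode (list_decode c ! t) else 0) =
      alg_decode (mat_entry (prod_encode (n, c)) t)" for t n c
    by (simp add: mat_entry_def dcd_prod_def dcd_list_def alg_decode_zero)
  from this[of _ "snd (prod_decode M)" "fst (prod_decode M)"]
  show ?thesis by (simp add: mat_decode_def case_prod_unfold Let_def dcd_prod_def)
qed

lemma grid_index: "i < N \<Longrightarrow> j < N \<Longrightarrow> i * N + j < N * N" for i j N :: nat
  using mult_le_mono1[of "Suc i" N N] by simp

lemma mat_decode_proj_code:
  assumes "orth_code n c"
  shows "mat_decode (proj_code n c) = (n, proj_of n (vset_decode c))"
proof -
  have "mat_entry (proj_code n c) (i * 2 ^ n + j) = proj_entry c i j" if "i < 2 ^ n" "j < 2 ^ n" for i j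
    using grid_index[OF that] that by (simp add: mat_entry_def proj_code_def)
  thus ?thesis using alg_decode_proj_entry[OF assms]
    unfolding mat_decode_altdef Let_def by (auto simp: proj_code_def mat_eq_iff proj_of_def)
qed

lemma spans_code_iff:
  "spans_code M c \<longleftrightarrow> orthonormal_set (fst (mat_decode M)) (vset_decode c) \<and>
     snd (mat_decode M) = proj_of (fst (mat_decode M)) (vset_decode c)"
proof -
  define n where "n = fst (dcd M :: nat \<times> nat list)"
  have n: "fst (mat_decode M) = n" by (simp add: mat_decode_altdef Let_def n_def)
  have "(\<forall>t<2 ^ n * 2 ^ n. alg_decode (mat_entry (proj_code n c) t) = alg_decode (mat_entry M t)) \<longleftrightarrow>
      snd (mat_decode M) = proj_of n (vset_decode c)" if o: "orth_code n c"
  proof -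
    have eq: "proj_of n (vset_decode c) = mat (2^n) (2^n) (\<lambda>(i, j). alg_decode (mat_entry (proj_code n c) (i * 2 ^ n + j)))"
      using arg_cong[OF mat_decode_proj_code[OF o], of snd]
      by (simp add: mat_decode_altdef Let_def proj_code_def)
    have M: "snd (mat_decode M) = mat (2^n) (2^n) (\<lambda>(i, j). alg_decode (mat_entry M (i * 2 ^ n + j)))"
      by (simp add: mat_decode_altdef Let_def n_def)
    show ?thesis
    proof
      assume "\<forall>t<2 ^ n * 2 ^ n. alg_decode (mat_entry (proj_code n c) t) = alg_decode (mat_entry M t)"
      thus "snd (mat_decode M) = proj_of n (vset_decode c)"
        unfolding M eq by (intro cong_mat refl) (simp add: grid_index)
    next
      assume e: "snd (mat_decode M) = proj_of n (vset_decode c)"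
      show "\<forall>t<2 ^ n * 2 ^ n. alg_decode (mat_entry (proj_code n c) t) = alg_decode (mat_entry M t)"
      proof (intro allI impI)
        fix t :: nat assume t: "t < 2 ^ n * 2 ^ n"
        have ij: "t div 2 ^ n < 2 ^ n" "t mod 2 ^ n < 2 ^ n"
          using t by (auto simp: less_mult_imp_div_less)
        have "mat (2^n) (2^n) (\<lambda>(i, j). alg_decode (mat_entry M (i * 2 ^ n + j))) $$ (t div 2 ^ n, t mod 2 ^ n) =
          mat (2^n) (2^n) (\<lambda>(i, j). alg_decode (mat_entry (proj_code n c) (i * 2 ^ n + j))) $$ (t div 2 ^ n, t mod 2 ^ n)"
          using e unfolding M eq by simp
        thus "alg_decode (mat_entry (proj_code n c) t) = alg_decode (mat_entry M t)"
          using ij by (simp add: div_mult_mod_eq)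
      qed
    qed
  qed
  thus ?thesis unfolding spans_code_def Let_def n_def[symmetric] n orth_code_iff by blast
qed

text \<open>Guarantees that the search for a basis ends: the decomposition of the projection has
  algebraic entries, all of which have codes.\<close>

lemma ex_spans_code:
  assumes "special_projection (fst (mat_decode M)) (snd (mat_decode M))"
  shows "\<exists>c. spans_code M c"
proof -
  define n where "n = fst (mat_decode M)"
  obtain F where F: "finite F" "orthonormal_set n F" "\<forall>v\<in>F. \<forall>i<2^n. algebraic (v $ i)"
    "snd (mat_decode M) = proj_of n F"
    using special_projection_decomposition[OF assms] unfolding n_def by blast
  define ac where "ac = (\<lambda>z. SOME c. alg_decode c = z)"
  have ac: "alg_decode (ac z) = z" if "algebraic z" for z
    unfolding ac_def by (rule someI_ex[OF alg_decode_surj[OF that]])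
  define vc where "vc = (\<lambda>v :: complex vec. list_encode (map (\<lambda>i. ac (v $ i)) [0..<2^n]))"
  have vc: "vec_decode (vc v) = v" if "v \<in> F" for v
  proof -
    have dv: "dim_vec v = 2 ^ n" using F(2) that by (auto simp: orthonormal_set_def)
    have "map alg_decode (map (\<lambda>i. ac (v $ i)) [0..<2^n]) = map (\<lambda>i. v $ i) [0..<2^n]"
      using F(3) that by (simp add: ac)
    also have "\<dots> = list_of_vec v" by (simp add: list_of_vec_map dv)
    finally show ?thesis by (simp add: vec_decode_def vc_def vec_list del: map_map)
  qed
  have "vset_decode (set_encode (vc ` F)) = F"
    using F(1) vc by (simp add: vset_decode_def image_image)
  hence "spans_code M (set_encode (vc ` F))" unfolding spans_code_iff using F n_def by simp
  thus ?thesis by blast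
qed

section \<open>Computable sums and prefix-free codes\<close>

text \<open>Nonnegative rationals as a numerator and a denominator diminished by 1, the convention
  of \<open>rat_decode\<close>; no denominator can be zero.\<close>

definition rv :: "nat \<times> nat \<Rightarrow> real" where
  "rv q = real (fst q) / real (Suc (snd q))"

lemma rv_nonneg: "0 \<le> rv q"
  by (simp add: rv_def)

definition radd :: "nat \<times> nat \<Rightarrow> nat \<times> nat \<Rightarrow> nat \<times> nat" where
  "radd p q = (fst p * Suc (snd q) + fst q * Suc (snd p), Suc (snd p) * Suc (snd q) - 1)"

lemma rv_radd: "rv (radd p q) = rv p + rv q"
proof -
  have "Suc (Suc (snd p) * Suc (snd q) - 1) = Suc (snd p) * Suc (snd q)" by simp
  hence "rv (radd p q) = real (fst p * Suc (snd q) + fst q * Suc (snd p)) / real (Suc (snd p) * Suc (snd q))"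
    by (simp only: rv_def radd_def fst_conv snd_conv)
  also have "\<dots> = rv p + rv q" unfolding rv_def of_nat_mult of_nat_add
    by (subst add_frac_eq) simp_all
  finally show ?thesis .
qed

definition rsum :: "(nat \<Rightarrow> nat \<times> nat) \<Rightarrow> nat \<Rightarrow> nat \<times> nat" where
  "rsum q N = rec_nat (0, 0) (\<lambda>i s. radd s (q i)) N"

lemma rv_rsum: "rv (rsum q N) = (\<Sum>i<N. rv (q i))"
  by (induction N) (simp_all add: rsum_def rv_radd, simp add: rv_def)

lemma cmp_rsum:
  assumes "cmp q" "cmp f"
  shows "cmp (\<lambda>x. rsum q (f x))"
  unfolding rsum_def radd_def by (intro cmp cmp_o[OF assms(1)] assms(2))

definition ri :: "int \<times> nat \<Rightarrow> real" where
  "ri q = of_int (fst q) / real (Suc (snd q))"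

lemma rat_decode_ri: "rat_decode c = ri (dcd c)"
  by (simp add: rat_decode_def ri_def dcd_prod_def dcd_int_def case_prod_unfold)

lemma computable_realI:
  assumes "cmp s" "\<And>k. \<bar>rv (s k) - x\<bar> \<le> (1/2) ^ k"
  shows "computable_real x"
proof -
  have "cmp (\<lambda>k. enc (int (fst (s k)), snd (s k)))" by (intro cmp assms(1))
  hence "computable (\<lambda>k. enc (int (fst (s k)), snd (s k)))" by (simp add: cmp_nat_iff)
  moreover have "rat_decode (enc (int (fst (s k)), snd (s k))) = rv (s k)" for k
    by (simp add: rat_decode_ri ri_def rv_def)
  ultimately show ?thesis unfolding computable_real_def
    by (intro exI[of _ "\<lambda>k. enc (int (fst (s k)), snd (s k))"]) (simp add: assms(2))
qed

text \<open>Approximations of the whole sum reveal when a partial sum has come close to it, so a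
  computable sum of nonnegative rationals has a computable modulus of convergence.\<close>

lemma computable_tail:
  assumes q: "cmp q" and sm: "summable (\<lambda>i. rv (q i))" and cr: "computable_real (\<Sum>i. rv (q i))"
  obtains nu :: "nat \<Rightarrow> nat" where "cmp nu"
    "\<forall>k. (\<Sum>i. rv (q i)) - (\<Sum>i<nu k. rv (q i)) \<le> (1/2) ^ k"
proof -
  define X where "X = (\<Sum>i. rv (q i))"
  obtain g where g: "computable g" "\<And>k. \<bar>rat_decode (g k) - X\<bar> \<le> (1/2) ^ k"
    using cr unfolding computable_real_def X_def by blast
  have cg: "cmp g" using g(1) by (simp add: cmp_nat_iff)
  \<comment> \<open>The approximation is 2^-(k+2) accurate and the test below asks for 2^-(k+1): a
    partial sum within 2^-(k+2) passes it, and one that passes is within 2^-(k+1) + 2^-(k+2), which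
    is at most 2^-k.\<close>
  define a where "a = (\<lambda>k. fst (dcd (g (k + 2)) :: int \<times> nat))"
  define b where "b = (\<lambda>k. snd (dcd (g (k + 2)) :: int \<times> nat))"
  have ca: "cmp a" and cb: "cmp b" unfolding a_def b_def by (intro cmp cmp_o[OF cg])+
  have ab: "\<bar>of_int (a k) / real (Suc (b k)) - X\<bar> \<le> (1/2) ^ (k + 2)" for k
    using g(2)[of "k + 2"] by (simp add: rat_decode_ri ri_def a_def b_def)
  \<comment> \<open>The inequality between the approximation a / (b + 1) and the partial sum, with
    tolerance 2^-(k+1), multiplied out over the integers.\<close>
  define P where "P = (\<lambda>k N. (a k * int (Suc (snd (rsum q N))) - int (fst (rsum q N)) * int (Suc (b k))) * int (2 ^ Suc k)
    \<le> int (Suc (b k)) * int (Suc (snd (rsum q N))))"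
  have "dec (\<lambda>e. P (fst e) (snd e))"
    unfolding P_def by (intro cmp cmp_o[OF ca] cmp_o[OF cb] cmp_rsum[OF q])
  have iff: "P k N \<longleftrightarrow> of_int (a k) / real (Suc (b k)) - (\<Sum>i<N. rv (q i)) \<le> (1/2) ^ Suc k" for k N
  proof -
    define B where "B = real (Suc (b k))"
    define D where "D = real (Suc (snd (rsum q N)))"
    define E where "E = (2::real) ^ Suc k"
    have pos: "0 < B" "0 < D" "0 < E" by (simp_all add: B_def D_def E_def)
    have "P k N \<longleftrightarrow> real_of_int ((a k * int (Suc (snd (rsum q N))) - int (fst (rsum q N)) * int (Suc (b k))) * int (2 ^ Suc k))
      \<le> real_of_int (int (Suc (b k)) * int (Suc (snd (rsum q N))))"
      unfolding P_def of_int_le_iff ..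
    also have "\<dots> \<longleftrightarrow> (of_int (a k) * D - real (fst (rsum q N)) * B) * E \<le> B * D"
      by (simp only: of_int_mult of_int_diff of_int_of_nat_eq B_def D_def E_def of_nat_power of_nat_numeral of_int_power of_int_numeral)
    also have "\<dots> \<longleftrightarrow> (of_int (a k) * D - real (fst (rsum q N)) * B) / (B * D) \<le> 1 / E"
      using pos by (simp add: field_simps)
    also have "(of_int (a k) * D - real (fst (rsum q N)) * B) / (B * D) = of_int (a k) / B - real (fst (rsum q N)) / D"
      using pos by (simp add: diff_frac_eq)
    also have "real (fst (rsum q N)) / D = (\<Sum>i<N. rv (q i))"
      unfolding rv_rsum[symmetric] by (simp add: rv_def D_def)
    finally show ?thesis by (simp add: B_def E_def power_one_over)
  qed
  have "\<exists>N. P k N" for k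
  proof -
    have "(\<lambda>N. \<Sum>i<N. rv (q i)) \<longlonglongrightarrow> X" using sm unfolding X_def by (rule summable_LIMSEQ)
    moreover have "0 < (1/2::real) ^ (k + 2)" by simp
    ultimately obtain N where "norm ((\<Sum>i<N. rv (q i)) - X) < (1/2) ^ (k + 2)"
      unfolding LIMSEQ_iff by blast
    hence "X - (\<Sum>i<N. rv (q i)) \<le> (1/2) ^ (k + 2)" by (simp add: abs_if split: if_splits)
    moreover have "(1/2::real) ^ Suc k = (1/2) ^ (k + 2) + (1/2) ^ (k + 2)" by simp
    ultimately have "P k N" unfolding iff using ab[of k] by linarith
    thus ?thesis by blast
  qed
  then obtain nu where nu: "cmp nu" "\<And>k. P k (nu k)"
    using sig_select[OF sig_dec[OF \<open>dec (\<lambda>e. P (fst e) (snd e))\<close>]] by blast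
  have "X - (\<Sum>i<nu k. rv (q i)) \<le> (1/2) ^ k" for k
  proof -
    have "(1/2::real) ^ Suc k + (1/2) ^ (k + 2) \<le> (1/2) ^ k" by simp
    thus ?thesis using nu(2)[of k] ab[of k] unfolding iff by linarith
  qed
  thus ?thesis using that nu(1) unfolding X_def by blast
qed

lemma computable_suminf:
  assumes q: "cmp q" and nu: "cmp nu" and sm: "summable (\<lambda>i. rv (q i))"
    and tail: "\<And>k. (\<Sum>i. rv (q i)) - (\<Sum>i<nu k. rv (q i)) \<le> (1/2) ^ k"
  shows "computable_real (\<Sum>i. rv (q i))"
proof (rule computable_realI)
  show "cmp (\<lambda>k. rsum q (nu k))" by (rule cmp_rsum[OF q nu])
  show "\<bar>rv (rsum q (nu k)) - (\<Sum>i. rv (q i))\<bar> \<le> (1/2) ^ k" for k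
  proof -
    have "(\<Sum>i<nu k. rv (q i)) \<le> (\<Sum>i. rv (q i))" by (rule sum_le_suminf[OF sm]) (auto simp: rv_nonneg)
    thus ?thesis unfolding rv_rsum using tail[of k] by linarith
  qed
qed

text \<open>Unless the empty string is the only member, removing the first symbol splits the set
  into two prefix-free sets of shorter strings, each entering with the factor 1/2.\<close>

lemma kraft:
  fixes A :: "bool list set"
  assumes "finite A" "\<And>\<pi> \<sigma>. \<pi> \<in> A \<Longrightarrow> \<sigma> \<in> A \<Longrightarrow> prefix \<pi> \<sigma> \<Longrightarrow> \<pi> = \<sigma>" "\<And>\<pi>. \<pi> \<in> A \<Longrightarrow> length \<pi> \<le> n"
  shows "(\<Sum>\<pi>\<in>A. (1/2) ^ length \<pi>) \<le> (1::real)"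
  using assms
proof (induction n arbitrary: A)
  case 0
  hence "A \<subseteq> {[]}" by auto
  hence "A = {} \<or> A = {[]}" by auto
  thus ?case by auto
next
  case (Suc n)
  show ?case
  proof (cases "[] \<in> A")
    case True
    hence "A = {[]}" using Suc.prems(2)[of "[]"] by auto
    thus ?thesis by simp
  next
    case False
    define B where "B = (\<lambda>b. {\<pi>. b # \<pi> \<in> A})"
    have fin: "finite (B b)" for b
      using finite_vimageI[OF Suc.prems(1), of "Cons b"] by (simp add: B_def vimage_def)
    have le: "(\<Sum>\<pi>\<in>B b. (1/2) ^ length \<pi>) \<le> (1::real)" for b
    proof (rule Suc.IH[OF fin])
      show "\<pi> = \<sigma>" if "\<pi> \<in> B b" "\<sigma> \<in> B b" "prefix \<pi> \<sigma>" for \<pi> \<sigma>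
        using Suc.prems(2)[of "b # \<pi>" "b # \<sigma>"] that by (simp add: B_def)
      show "length \<pi> \<le> n" if "\<pi> \<in> B b" for \<pi>
        using Suc.prems(3)[of "b # \<pi>"] that by (simp add: B_def)
    qed
    have A: "A = Cons True ` B True \<union> Cons False ` B False"
    proof (intro equalityI subsetI)
      fix \<pi> assume "\<pi> \<in> A"
      then obtain b \<sigma> where \<pi>: "\<pi> = b # \<sigma>" "b # \<sigma> \<in> A" using False by (cases \<pi>) auto
      thus "\<pi> \<in> Cons True ` B True \<union> Cons False ` B False" by (cases b) (auto simp: B_def)
    qed (auto simp: B_def)
    have half: "(\<Sum>\<pi>\<in>Cons b ` B b. (1/2) ^ length \<pi>) = 1/2 * (\<Sum>\<pi>\<in>B b. (1/2::real) ^ length \<pi>)" for b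
      by (subst sum.reindex) (auto simp: sum_distrib_left)
    have "(\<Sum>\<pi>\<in>A. (1/2::real) ^ length \<pi>) =
        (\<Sum>\<pi>\<in>Cons True ` B True. (1/2) ^ length \<pi>) + (\<Sum>\<pi>\<in>Cons False ` B False. (1/2) ^ length \<pi>)"
      by (subst A, rule sum.union_disjoint) (use fin in auto)
    thus ?thesis unfolding half using le[of True] le[of False] by linarith
  qed
qed

lemma prefix_free_summable:
  fixes A :: "bool list set"
  assumes "\<And>\<pi> \<sigma>. \<pi> \<in> A \<Longrightarrow> \<sigma> \<in> A \<Longrightarrow> prefix \<pi> \<sigma> \<Longrightarrow> \<pi> = \<sigma>"
  shows "(\<lambda>\<pi>. (1/2::real) ^ length \<pi>) summable_on A"
proof (rule nonneg_bdd_above_summable_on)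
  show "bdd_above (sum (\<lambda>\<pi>. (1/2::real) ^ length \<pi>) ` {F. F \<subseteq> A \<and> finite F})"
  proof (rule bdd_aboveI2)
    fix F assume "F \<in> {F. F \<subseteq> A \<and> finite F}"
    thus "sum (\<lambda>\<pi>. (1/2::real) ^ length \<pi>) F \<le> 1"
      by (intro kraft[of F "Max (length ` F)"]) (auto intro: assms)
  qed
qed simp

text \<open>The code is a bijective binary numeral, so code plus 1 has one binary digit more than
  the string has symbols. This makes the length computable from the code.\<close>

lemma bl_encode_bounds: "2 ^ length \<pi> \<le> Suc (bl_encode \<pi>) \<and> Suc (bl_encode \<pi>) < 2 ^ Suc (length \<pi>)"
  by (induction \<pi>) auto

lemma bl_encode_inj: "bl_encode \<pi> = bl_encode \<sigma> \<Longrightarrow> \<pi> = \<sigma>"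
proof (induction \<pi> arbitrary: \<sigma>)
  case Nil thus ?case by (cases \<sigma>) (auto split: if_splits)
next
  case (Cons b \<pi>)
  then obtain c \<tau> where \<sigma>: "\<sigma> = c # \<tau>" by (cases \<sigma>) (auto split: if_splits)
  have e: "2 * bl_encode \<pi> + (if b then 2 else 1) = 2 * bl_encode \<tau> + (if c then 2 else 1)"
    using Cons.prems by (simp add: \<sigma>)
  have "b = c" using e by (cases b; cases c; simp; presburger)
  moreover from this have "bl_encode \<pi> = bl_encode \<tau>" using e by simp
  ultimately show ?case using Cons.IH \<sigma> by simp
qed

lemma bl_encode_surj: "\<exists>\<pi>. bl_encode \<pi> = x"
proof (induction x rule: less_induct)
  case (less x)
  show ?case
  proof (cases "x = 0")
    case True thus ?thesis by (intro exI[of _ "[]"]) simp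
  next
    case False
    hence "(x - 1) div 2 < x" by simp
    then obtain \<pi> where \<pi>: "bl_encode \<pi> = (x - 1) div 2" using less by blast
    show ?thesis
    proof (cases "even x")
      case True
      thus ?thesis using False \<pi> by (intro exI[of _ "True # \<pi>"]) (simp, presburger)
    next
      case odd: False
      thus ?thesis using \<pi> by (intro exI[of _ "False # \<pi>"]) (auto elim!: oddE)
    qed
  qed
qed

definition str_len :: "nat \<Rightarrow> nat" where
  "str_len x = (LEAST l. Suc x < 2 ^ Suc l)"

lemma cmp_str_len [cmp]: "cmp f \<Longrightarrow> cmp (\<lambda>x. str_len (f x))"
proof (rule cmp_o[of str_len])
  show "cmp str_len" unfolding str_len_def
  proof (rule cmp_Least)
    show "\<exists>l. Suc x < 2 ^ Suc l" for x
      using less_exp[of "Suc x"] by (intro exI[of _ "Suc x"]) auto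
  qed (intro cmp)
qed

lemma str_len_bl_encode: "str_len (bl_encode \<pi>) = length \<pi>"
  unfolding str_len_def
proof (rule Least_equality)
  fix l assume "Suc (bl_encode \<pi>) < 2 ^ Suc l"
  hence "(2::nat) ^ length \<pi> < 2 ^ Suc l" using bl_encode_bounds[of \<pi>] by linarith
  hence "length \<pi> < Suc l" by (rule power_less_imp_less_exp[rotated]) simp
  thus "length \<pi> \<le> l" by simp
qed (use bl_encode_bounds in blast)

text \<open>The binary expansion of \<open>v\<close> with \<open>l\<close> digits, most significant digit first, so that prefixes
  correspond to dyadic intervals containing \<open>v / 2 ^ l\<close>.\<close>
primrec bits :: "nat \<Rightarrow> nat \<Rightarrow> bool list" where
  "bits 0 v = []"
| "bits (Suc l) v = bits l (v div 2) @ [odd v]"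

lemma length_bits [simp]: "length (bits l v) = l"
  by (induction l arbitrary: v) auto

lemma bl_encode_snoc: "bl_encode (\<pi> @ [b]) = bl_encode \<pi> + 2 ^ length \<pi> * (if b then 2 else 1)"
  by (induction \<pi>) (auto simp: algebra_simps)

text \<open>\<open>bits\<close> splits off the last digit, whereas primitive recursion on a fixed v
  has to produce digits from the front: round i reads the digit of weight 2^(l - i - 1).\<close>

lemma bl_encode_bits:
  "bl_encode (bits l v) = rec_nat 0 (\<lambda>i r. r + 2 ^ i * (if odd (v div 2 ^ (l - Suc i)) then 2 else 1)) l"
proof -
  have "bl_encode (bits i (v div 2 ^ (l - i))) =
      rec_nat 0 (\<lambda>i r. r + 2 ^ i * (if odd (v div 2 ^ (l - Suc i)) then 2 else 1)) i" if "i \<le> l" for i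
    using that
  proof (induction i)
    case (Suc i)
    have "l - i = Suc (l - Suc i)" using Suc.prems by simp
    hence "v div 2 ^ (l - Suc i) div 2 = v div 2 ^ (l - i)"
      by (simp add: div_mult2_eq[symmetric] mult.commute)
    thus ?case using Suc by (simp add: bl_encode_snoc)
  qed simp
  from this[of l] show ?thesis by simp
qed

lemma cmp_bl_encode_bits: "cmp f \<Longrightarrow> cmp g \<Longrightarrow> cmp (\<lambda>x. bl_encode (bits (f x) (g x)))"
  by (rule cmp_o2[of "\<lambda>l v. bl_encode (bits l v)"]) (unfold bl_encode_bits, intro cmp)

lemma bits_take: "i \<le> l \<Longrightarrow> take i (bits l v) = bits i (v div 2 ^ (l - i))"
proof (induction l arbitrary: v)
  case (Suc l)
  show ?case
  proof (cases "i = Suc l")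
    case False
    hence "i \<le> l" using Suc.prems by simp
    hence "take i (bits (Suc l) v) = bits i (v div 2 div 2 ^ (l - i))" by (simp add: Suc.IH)
    also have "v div 2 div 2 ^ (l - i) = v div 2 ^ (Suc l - i)"
      using \<open>i \<le> l\<close> by (simp add: div_mult2_eq[symmetric] Suc_diff_le)
    finally show ?thesis .
  qed simp
qed simp

lemma bits_inj: "bits l v = bits l w \<Longrightarrow> v < 2 ^ l \<Longrightarrow> w < 2 ^ l \<Longrightarrow> v = w"
proof (induction l arbitrary: v w)
  case (Suc l)
  have "v div 2 = w div 2" using Suc by (intro Suc.IH) auto
  moreover have "odd v = odd w" using Suc.prems(1) by simp
  ultimately show ?case by (metis (full_types) bit_eq_rec)
qed simp

text \<open>The first l digits of v' are those of \<open>v' div 2 ^ (l' - l)\<close>. By injectivity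
  v is this quotient, and the inequalities are the usual bounds of integer division.\<close>

lemma prefix_bits:
  assumes "prefix (bits l v) (bits l' v')" "v < 2 ^ l" "v' < 2 ^ l'"
  shows "l \<le> l'" "real v / 2 ^ l \<le> real v' / 2 ^ l'" "real v' / 2 ^ l' < (real v + 1) / 2 ^ l"
proof -
  show l: "l \<le> l'" using prefix_length_le[OF assms(1)] by simp
  have "bits l v = take l (bits l' v')" using assms(1) by (auto simp: prefix_def)
  hence "bits l v = bits l (v' div 2 ^ (l' - l))" using bits_take[OF l] by simp
  moreover have "v' div 2 ^ (l' - l) < 2 ^ l"
    using assms(3) l by (intro less_mult_imp_div_less) (simp flip: power_add)
  ultimately have v: "v = v' div 2 ^ (l' - l)" using bits_inj assms(2) by blast
  define E where "E = (2::nat) ^ (l' - l)"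
  have E: "E > 0" by (simp add: E_def)
  have p: "(2::real) ^ l' = 2 ^ l * real E" using l by (simp add: E_def flip: power_add)
  have "v * E \<le> v'" unfolding v E_def by simp
  hence "real v * real E \<le> real v'" by (metis of_nat_le_iff of_nat_mult)
  thus "real v / 2 ^ l \<le> real v' / 2 ^ l'" unfolding p using E by (simp add: field_simps)
  have "v' < Suc v * E" unfolding v E_def using dividend_less_div_times[of "2 ^ (l' - l)" v'] by simp
  hence "real v' < (real v + 1) * real E" by (metis of_nat_Suc of_nat_less_iff of_nat_mult add.commute)
  thus "real v' / 2 ^ l' < (real v + 1) / 2 ^ l" unfolding p using E by (simp add: field_simps)
qed

section \<open>From machines to tests\<close>

text \<open>Comparing the sums would not give computability; comparing the tails lets a dominated
  series inherit the modulus of convergence.\<close>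

lemma suminf_tail_mono:
  fixes a b :: "nat \<Rightarrow> real"
  assumes "summable a" "summable b" "\<And>i. a i \<le> b i"
  shows "(\<Sum>i. a i) - (\<Sum>i<N. a i) \<le> (\<Sum>i. b i) - (\<Sum>i<N. b i)"
proof -
  have "(\<Sum>i<N. b i - a i) \<le> (\<Sum>i. b i - a i)"
    using assms by (intro sum_le_suminf summable_diff) auto
  thus ?thesis using suminf_diff[OF assms(2,1)] by (simp add: sum_subtractf)
qed

text \<open>Turning an enumeration of the domain of a machine into a test: stage \<open>n\<close> either discovers a new
  element of the domain, with weight \<open>mu n\<close>, or contributes nothing.\<close>
locale enumerated_machine =
  fixes C :: "bool list \<Rightarrow> nat option" and r :: recf and R :: "(nat \<times> nat) \<times> nat \<Rightarrow> bool"
  assumes C: "\<And>\<pi> y. C \<pi> = Some y \<longleftrightarrow> reval r [bl_encode \<pi>] y"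
    and pf: "\<And>\<pi> \<sigma>. \<pi> \<in> dom C \<Longrightarrow> \<sigma> \<in> dom C \<Longrightarrow> prefix \<pi> \<sigma> \<Longrightarrow> \<pi> = \<sigma>"
    and cr: "computable_real (machine_measure C)"
    and R: "dec R" "\<And>x y. reval r [x] y \<longleftrightarrow> (\<exists>w. R ((x, y), w))"
begin

definition inp :: "nat \<Rightarrow> nat" where "inp n = fst (fst (dcd n :: (nat \<times> nat) \<times> nat))"
definition out :: "nat \<Rightarrow> nat" where "out n = snd (fst (dcd n :: (nat \<times> nat) \<times> nat))"

text \<open>A halting program may have many witnesses. Only the first stage that shows it halting
  counts, so its weight enters the sum once.\<close>

definition new :: "nat \<Rightarrow> bool" where
  "new n \<longleftrightarrow> R (dcd n) \<and> (\<forall>n'<n. \<not> (R (dcd n') \<and> inp n' = inp n))"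

lemma cmp_inp: "cmp f \<Longrightarrow> cmp (\<lambda>x. inp (f x))" unfolding inp_def by (intro cmp)
lemma cmp_out: "cmp f \<Longrightarrow> cmp (\<lambda>x. out (f x))" unfolding out_def by (intro cmp)
lemma dec_new: "cmp f \<Longrightarrow> dec (\<lambda>x. new (f x))"
  by (rule dec_o[of new]) (unfold new_def, intro cmp dec_o[OF R(1)] cmp_inp)

lemma new_unique: "new n \<Longrightarrow> new n' \<Longrightarrow> inp n = inp n' \<Longrightarrow> n = n'"
  unfolding new_def by (cases n n' rule: linorder_cases) auto

lemma reval_inp: "R (dcd n) \<Longrightarrow> reval r [inp n] (out n)"
  unfolding R(2) inp_def out_def by (rule exI[of _ "snd (dcd n :: (nat \<times> nat) \<times> nat)"]) simp

lemma new_exists: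
  assumes "C \<pi> = Some y"
  shows "\<exists>n. new n \<and> inp n = bl_encode \<pi> \<and> out n = y"
proof -
  obtain w where "R ((bl_encode \<pi>, y), w)" using assms unfolding C R(2) by blast
  hence ex: "R (dcd (enc ((bl_encode \<pi>, y), w))) \<and> inp (enc ((bl_encode \<pi>, y), w)) = bl_encode \<pi>"
    by (simp add: inp_def)
  define n where "n = (LEAST n. R (dcd n) \<and> inp n = bl_encode \<pi>)"
  have n: "R (dcd n) \<and> inp n = bl_encode \<pi>" unfolding n_def by (rule LeastI_ex) (use ex in blast)
  have "\<not> (R (dcd n') \<and> inp n' = bl_encode \<pi>)" if "n' < n" for n'
    using that unfolding n_def by (rule not_less_Least)
  hence "new n" using n by (simp add: new_def)
  moreover have "out n = y"
  proof (rule reval_det)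
    show "reval r [inp n] (out n)" using n by (intro reval_inp) simp
    show "reval r [inp n] y" using n assms unfolding C by simp
  qed
  ultimately show ?thesis using n by blast
qed

lemma new_in_dom:
  assumes "new n"
  shows "\<exists>\<pi>. bl_encode \<pi> = inp n \<and> C \<pi> = Some (out n)"
proof -
  obtain \<pi> where \<pi>: "bl_encode \<pi> = inp n" using bl_encode_surj by blast
  have "reval r [inp n] (out n)" using assms by (intro reval_inp) (simp add: new_def)
  thus ?thesis using \<pi> by (intro exI[of _ \<pi>]) (simp add: C)
qed

definition mu :: "nat \<Rightarrow> nat \<times> nat" where
  "mu n = (if new n then (1, 2 ^ str_len (inp n) - 1) else (0, 0))"

lemma cmp_mu: "cmp mu"
  unfolding mu_def by (intro cmp dec_new cmp_inp)

lemma rv_mu: "rv (mu n) = (if new n then (1/2) ^ str_len (inp n) else 0)"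
  by (simp add: mu_def rv_def power_one_over)

text \<open>The new stages correspond bijectively to the domain, and all terms are nonnegative, so
  the order of summation is irrelevant.\<close>

lemma mu_sums: "(\<lambda>n. rv (mu n)) sums machine_measure C"
proof -
  define h where "h = (\<lambda>n. SOME \<pi>. bl_encode \<pi> = inp n)"
  have h: "bl_encode (h n) = inp n" for n
    unfolding h_def using bl_encode_surj by (rule someI_ex)
  have bij: "bij_betw h {n. new n} (dom C)"
  proof (rule bij_betw_imageI)
    show "inj_on h {n. new n}" 
    proof (rule inj_onI)
      fix n n' assume n: "n \<in> {n. new n}" "n' \<in> {n. new n}" "h n = h n'"
      have "inp n = bl_encode (h n)" by (rule h[symmetric])
      also have "\<dots> = inp n'" unfolding n(3) by (rule h)
      finally have e: "inp n = inp n'" .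
      show "n = n'" by (rule new_unique[OF _ _ e]) (use n(1,2) in simp_all)
    qed
    show "h ` {n. new n} = dom C"
    proof (intro equalityI subsetI)
      fix \<pi> assume "\<pi> \<in> h ` {n. new n}"
      then obtain n where n: "new n" "\<pi> = h n" by auto
      obtain \<sigma> where "bl_encode \<sigma> = inp n" "C \<sigma> = Some (out n)" using new_in_dom[OF n(1)] by blast
      moreover from this have "\<sigma> = \<pi>" using h[of n] n(2) by (intro bl_encode_inj) simp
      ultimately show "\<pi> \<in> dom C" by auto
    next
      fix \<pi> assume "\<pi> \<in> dom C"
      then obtain y where "C \<pi> = Some y" by auto
      from new_exists[OF this] obtain n where n: "new n" "inp n = bl_encode \<pi>" by blast
      hence "h n = \<pi>" using h[of n] by (intro bl_encode_inj) simp
      thus "\<pi> \<in> h ` {n. new n}" using n(1) by auto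
    qed
  qed
  have "((\<lambda>\<pi>. (1/2::real) ^ length \<pi>) has_sum machine_measure C) (dom C)"
    unfolding machine_measure_def by (rule has_sum_infsum[OF prefix_free_summable[OF pf]])
  hence "((\<lambda>n. (1/2::real) ^ length (h n)) has_sum machine_measure C) {n. new n}"
    by (rule iffD2[OF has_sum_reindex_bij_betw[OF bij, of "\<lambda>\<pi>. (1/2::real) ^ length \<pi>"]])
  moreover have "((\<lambda>n. (1/2::real) ^ length (h n)) has_sum machine_measure C) {n. new n} \<longleftrightarrow>
      ((\<lambda>n. rv (mu n)) has_sum machine_measure C) UNIV"
    by (rule has_sum_cong_neutral) (auto simp: rv_mu h[symmetric] str_len_bl_encode)
  ultimately show ?thesis using has_sum_imp_sums by blast
qed

text \<open>The output of a machine does not come with a dimension. For a nonempty orthonormal set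
  it is determined by the length 2^n of its vectors, and n < 2^n, which is at most the code of a
  vector and hence below c. So c bounds the search, and \<open>c \<le> k\<close> keeps it total on
  other outputs.\<close>

definition qubits :: "nat \<Rightarrow> nat" where "qubits c = (LEAST k. c \<le> k \<or> orth_code k c)"

lemma cmp_qubits: "cmp f \<Longrightarrow> cmp (\<lambda>x. qubits (f x))"
proof (rule cmp_o[of qubits])
  show "cmp qubits" unfolding qubits_def
  proof (rule cmp_Least)
    show "\<exists>k. c \<le> k \<or> orth_code k c" for c by (rule exI[of _ c]) simp
  qed (intro cmp)
qed

lemma qubits_eq:
  assumes "orth_code n c" "vset_decode c \<noteq> {}"
  shows "qubits c = n"
  unfolding qubits_def
proof (rule Least_equality)
  obtain v where v: "v \<in> set (set_elems c)" using assms(2) by (auto simp: vset_decode_def set_set_elems)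
  show "n \<le> k" if "c \<le> k \<or> orth_code k c" for k
  proof -
    have len: "vec_len v = 2 ^ n" using assms(1) v by (simp add: orth_code_def)
    have "vec_len v \<le> v" using length_le_enc[of "dcd v :: nat list"] by (simp add: vec_len_def)
    moreover have "v < c" using v by (simp add: set_elems_def)
    moreover have "n < 2 ^ n" by (rule less_exp)
    ultimately have "n < c" using len by linarith
    moreover have "k = n" if "orth_code k c" using that v len by (simp add: orth_code_def)
    ultimately show ?thesis using that by auto
  qed
qed (use assms in simp)

text \<open>The last condition is |p| + log |F| at most n for the program p and its set F, raised to
  powers of 2 so that it is decidable.\<close>

definition good :: "nat \<Rightarrow> bool" where
  "good n \<longleftrightarrow> new n \<and> orth_code (qubits (out n)) (out n) \<and>
     length (set_reps (out n)) * 2 ^ str_len (inp n) \<le> 2 ^ qubits (out n)"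

text \<open>At other stages the test receives the zero projection: 0 codes the empty set. This keeps
  the test a total sequence without adding to its trace sum.\<close>

definition tset :: "nat \<Rightarrow> nat" where "tset n = (if good n then out n else 0)"
definition tdim :: "nat \<Rightarrow> nat" where "tdim n = (if good n then qubits (out n) else 0)"

definition tau :: "nat \<Rightarrow> nat \<times> nat" where "tau n = (length (set_reps (tset n)), 2 ^ tdim n - 1)"

lemma dec_good: "cmp f \<Longrightarrow> dec (\<lambda>x. good (f x))"
  by (rule dec_o[of good]) (unfold good_def, intro cmp dec_new cmp_qubits cmp_out cmp_inp)
lemma cmp_tset: "cmp f \<Longrightarrow> cmp (\<lambda>x. tset (f x))"
  unfolding tset_def by (intro cmp dec_good cmp_out)
lemma cmp_tdim: "cmp f \<Longrightarrow> cmp (\<lambda>x. tdim (f x))"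
  unfolding tdim_def by (intro cmp dec_good cmp_qubits cmp_out)
lemma cmp_tau: "cmp tau"
  unfolding tau_def by (intro cmp cmp_tset cmp_tdim)

lemma vset_decode_0: "vset_decode 0 = {}"
  by (simp add: vset_decode_def)

lemma orth_code_tset: "orth_code (tdim n) (tset n)"
  by (auto simp: tset_def tdim_def good_def orth_code_iff vset_decode_0 orthonormal_set_def)

definition test :: "nat \<Rightarrow> nat \<times> complex mat" where
  "test n = mat_decode (proj_code (tdim n) (tset n))"

lemma test_eq: "test n = (tdim n, proj_of (tdim n) (vset_decode (tset n)))"
  unfolding test_def by (rule mat_decode_proj_code[OF orth_code_tset])

lemma tau_val_test: "tau_val (test n) = rv (tau n)"
  using orth_code_tset[of n]
  by (simp add: test_eq tau_val_proj_of orth_code_iff card_vset_decode rv_def tau_def)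

lemma tau_le_mu: "rv (tau n) \<le> rv (mu n)"
proof (cases "good n")
  case True
  define k where "k = qubits (out n)"
  define l where "l = str_len (inp n)"
  have "length (set_reps (out n)) * 2 ^ l \<le> 2 ^ k" using True by (simp add: good_def k_def l_def)
  hence "real (length (set_reps (out n)) * 2 ^ l) \<le> real (2 ^ k)" by (simp only: of_nat_le_iff)
  hence "real (length (set_reps (out n))) / 2 ^ k \<le> (1/2) ^ l"
    by (simp add: power_one_over field_simps)
  moreover have "rv (tau n) = real (length (set_reps (out n))) / 2 ^ k"
    using True by (simp add: rv_def tau_def tset_def tdim_def k_def)
  moreover have "rv (mu n) = (1/2) ^ l" using True by (simp add: rv_mu good_def l_def)
  ultimately show ?thesis by simp
next
  case False
  hence "rv (tau n) = 0" by (simp add: rv_def tau_def tset_def tdim_def set_reps_def set_elems_def)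
  thus ?thesis using rv_nonneg[of "mu n"] by simp
qed

lemma summable_tau: "summable (\<lambda>n. rv (tau n))"
  by (rule summable_comparison_test_ev[OF always_eventually sums_summable[OF mu_sums]])
    (simp add: rv_nonneg tau_le_mu)

lemma quantum_schnorr_test: "quantum_schnorr_test test"
  unfolding quantum_schnorr_test_def strong_solovay_test_def tau_val_test
proof (intro conjI allI summable_tau)
  show "\<exists>g. computable g \<and> (\<forall>m. mat_decode (g m) = test m)"
  proof (intro exI[of _ "\<lambda>n. proj_code (tdim n) (tset n)"] conjI allI)
    have "cmp (\<lambda>n. proj_code (tdim n) (tset n))" by (intro cmp cmp_tdim cmp_tset)
    thus "computable (\<lambda>n. proj_code (tdim n) (tset n))" by (simp add: cmp_nat_iff)
  qed (simp add: test_def)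
  show "special_projection (fst (test m)) (snd (test m))" for m
  proof -
    have on: "orthonormal_set (tdim m) (vset_decode (tset m))" using orth_code_tset by (simp add: orth_code_iff)
    have "special_projection (tdim m) (proj_of (tdim m) (vset_decode (tset m)))"
    proof (rule special_projection_proj_of[OF on finite_vset_decode])
      fix v and i :: nat assume "v \<in> vset_decode (tset m)" "i < 2 ^ tdim m"
      moreover from this have "dim_vec v = 2 ^ tdim m" using on by (auto simp: orthonormal_set_def)
      ultimately show "algebraic (v $ i)" by (intro algebraic_vset_decode) simp_all
    qed
    thus ?thesis by (simp add: test_eq)
  qed
  have mm: "(\<Sum>n. rv (mu n)) = machine_measure C" using mu_sums by (simp add: sums_iff)
  have sm: "summable (\<lambda>n. rv (mu n))" using mu_sums by (simp add: sums_iff)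
  \<comment> \<open>A modulus of convergence for the measure of the domain, which serves for the
    smaller trace sum as well.\<close>
  obtain nu where nu: "cmp nu" "\<forall>k. (\<Sum>i. rv (mu i)) - (\<Sum>i<nu k. rv (mu i)) \<le> (1/2) ^ k"
    using computable_tail[OF cmp_mu sm] cr unfolding mm by blast
  show "computable_real (\<Sum>m. rv (tau m))"
  proof (rule computable_suminf[OF cmp_tau nu(1) summable_tau])
    show "(\<Sum>i. rv (tau i)) - (\<Sum>i<nu k. rv (tau i)) \<le> (1/2) ^ k" for k
      using suminf_tail_mono[OF summable_tau sm tau_le_mu, of "nu k"] nu(2)[rule_format, of k] by linarith
  qed
qed

text \<open>If only finitely many members were large on the state, then the ratios w of those that
  are not zero would have a positive minimum. But a complexity at most n - d yields a large member
  with ratio below 2^(1 - d), for every d.\<close>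

lemma fails_test:
  assumes st: "is_state \<rho>" and e: "0 < \<epsilon>"
    and low: "\<And>d. 0 < d \<Longrightarrow> \<exists>n. \<not> QK C \<epsilon> n (\<rho> n) > ereal (real n - d)"
  shows "fails_at \<rho> test \<epsilon>"
  unfolding fails_at_def
proof (rule ccontr)
  assume "\<not> (\<exists>\<^sub>\<infinity>m. \<epsilon> < rho_val \<rho> (test m))"
  hence fin: "finite {m. \<epsilon> < rho_val \<rho> (test m)}" by (simp add: not_INFM MOST_iff_cofinite)
  \<comment> \<open>At a good stage with a nonempty set, \<open>log 2 (w m)\<close> is the program
    length plus the logarithm of the cardinality minus n.\<close>
  define w where "w = (\<lambda>m. rv (tau m) * 2 ^ str_len (inp m))"
  define A where "A = {m. \<epsilon> < rho_val \<rho> (test m) \<and> 0 < w m}"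
  have finA: "finite A" using fin by (rule rev_finite_subset) (auto simp: A_def)
  define \<delta> where "\<delta> = Min (insert 1 (w ` A))"
  have \<delta>: "0 < \<delta>" unfolding \<delta>_def using finA by (subst Min_gr_iff) (auto simp: A_def)
  have \<delta>le: "\<delta> \<le> w m" if "m \<in> A" for m unfolding \<delta>_def using finA that by (intro Min_le) auto
  obtain j where j: "(1/2::real) ^ j < \<delta>" using real_arch_pow_inv[OF \<delta>, of "1/2"] by auto
  \<comment> \<open>The infimum need not be attained, so one unit is given away: some description is
    shorter than n - d + 1 = n - j.\<close>
  define d where "d = real (Suc j)"
  obtain n where "\<not> QK C \<epsilon> n (\<rho> n) > ereal (real n - d)" using low[of d] by (auto simp: d_def)
  hence "QK C \<epsilon> n (\<rho> n) < ereal (real n - d + 1)"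
    unfolding not_less by (rule le_less_trans) simp
  then obtain \<pi> c where pc: "C \<pi> = Some c" "orthonormal_set n (vset_decode c)"
    "(\<Sum>v\<in>vset_decode c. Re ((\<rho> n *\<^sub>v v) \<bullet>c v)) > \<epsilon>"
    "real (length \<pi>) + log 2 (real (card (vset_decode c))) < real n - d + 1"
    unfolding QK_def Inf_less_iff by auto
  define F where "F = vset_decode c"
  have F: "F \<noteq> {}" using pc(3) e by (auto simp: F_def)
  have cardF: "0 < card F" using F finite_vset_decode by (simp add: F_def card_gt_0_iff)
  have oc: "orth_code n c" using pc(2) by (simp add: orth_code_iff)
  obtain m where m: "new m" "inp m = bl_encode \<pi>" "out m = c" using new_exists[OF pc(1)] by blast
  have qb: "qubits c = n" using qubits_eq[OF oc] F by (simp add: F_def)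
  have sl: "str_len (inp m) = length \<pi>" by (simp add: m str_len_bl_encode)
  have small: "real (card F) * 2 ^ length \<pi> < 2 ^ n * (1/2) ^ j"
  proof -
    have "real (card F) * 2 ^ length \<pi> = 2 powr (log 2 (real (card F)) + real (length \<pi>))"
      using cardF by (simp add: powr_add powr_realpow)
    also have "\<dots> < 2 powr (real n - real j)" using pc(4) by (intro powr_less_mono) (simp_all add: F_def d_def)
    also have "\<dots> = 2 ^ n * (1/2) ^ j" by (simp add: powr_diff powr_realpow power_one_over field_simps)
    finally show ?thesis .
  qed
  have "real (card F) * 2 ^ length \<pi> \<le> 2 ^ n"
  proof -
    have "2 ^ n * (1/2) ^ j \<le> 2 ^ n * (1::real)" by (intro mult_left_mono power_le_one) auto
    thus ?thesis using small by linarith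
  qed
  hence "card F * 2 ^ length \<pi> \<le> 2 ^ n" by (simp flip: of_nat_le_iff[where 'a = real])
  hence good: "good m" using m oc qb sl by (simp add: good_def card_vset_decode[symmetric] F_def)
  have td: "tdim m = n" "tset m = c" using good m qb by (simp_all add: tdim_def tset_def)
  have dm: "\<rho> n \<in> carrier_mat (2^n) (2^n)" using st by (simp add: is_state_def density_matrix_def)
  have "\<epsilon> < rho_val \<rho> (test m)"
    unfolding test_eq td using rho_val_proj_of[of n _ \<rho>, OF pc(2) dm] pc(3) by simp
  moreover have wm: "w m = real (card F) * 2 ^ length \<pi> / 2 ^ n"
    by (simp add: w_def rv_def tau_def td sl card_vset_decode F_def)
  moreover have "0 < w m" unfolding wm using cardF by simp
  ultimately have "\<delta> \<le> w m" by (intro \<delta>le) (simp add: A_def)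
  also have "\<dots> < (1/2) ^ j" unfolding wm using small by (simp add: field_simps)
  finally show False using j by simp
qed

end

lemma random_imp_QK_bound:
  assumes st: "is_state \<rho>" and rand: "quantum_schnorr_random \<rho>"
    and C: "computable_measure_machine C" and e: "0 < \<epsilon>"
  shows "\<exists>d>0. \<forall>n. QK C \<epsilon> n (\<rho> n) > ereal (real n - d)"
proof (rule ccontr)
  assume no: "\<not> ?thesis"
  have m: "prefix_free_machine C" "computable_real (machine_measure C)"
    using C by (simp_all add: computable_measure_machine_def)
  obtain r where r: "\<And>\<pi> y. C \<pi> = Some y \<longleftrightarrow> reval r [bl_encode \<pi>] y"
    using m(1) unfolding prefix_free_machine_def by blast
  have "sig (\<lambda>e :: nat \<times> nat. reval r [fst e] (snd e))"
    by (intro sig_o2[OF sig_reval] cmp)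
  then obtain R :: "(nat \<times> nat) \<times> nat \<Rightarrow> bool" where R: "dec R" "\<And>e. reval r [fst e] (snd e) \<longleftrightarrow> (\<exists>w. R (e, w))"
    unfolding sig_def by blast
  interpret enumerated_machine C r R
  proof
    show "\<pi> = \<sigma>" if "\<pi> \<in> dom C" "\<sigma> \<in> dom C" "prefix \<pi> \<sigma>" for \<pi> \<sigma>
      using m(1) that unfolding prefix_free_machine_def by blast
    show "reval r [x] y \<longleftrightarrow> (\<exists>w. R ((x, y), w))" for x y using R(2)[of "(x, y)"] by simp
  qed (use r m(2) R(1) in auto)
  have "fails_at \<rho> test \<epsilon>" by (rule fails_test[OF st e]) (use no in blast)
  moreover have "passes \<rho> test" using rand quantum_schnorr_test unfolding quantum_schnorr_random_def by blast
  ultimately show False using e unfolding passes_def by blast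
qed

section \<open>From tests to machines\<close>

text \<open>g codes the test, F provides an orthonormal basis for each projection, and nu marks
  where the blocks begin.\<close>

locale effective_test =
  fixes T :: "nat \<Rightarrow> nat \<times> complex mat" and g F nu :: "nat \<Rightarrow> nat"
  assumes g: "cmp g" "\<And>m. mat_decode (g m) = T m"
    and F: "cmp F" "\<And>m. spans_code (g m) (F m)"
    and sm: "summable (\<lambda>m. tau_val (T m))"
    and nu: "cmp nu" "\<And>k. (\<Sum>m. tau_val (T m)) - (\<Sum>m<nu k. tau_val (T m)) \<le> (1/8) ^ k"
      "\<And>i j. i < j \<Longrightarrow> nu i < nu j"
begin

definition dm :: "nat \<Rightarrow> nat" where "dm m = fst (dcd (g m) :: nat \<times> nat list)"
definition rk :: "nat \<Rightarrow> nat" where "rk m = length (set_reps (F m))"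

lemma cmp_dm: "cmp f \<Longrightarrow> cmp (\<lambda>x. dm (f x))" unfolding dm_def by (intro cmp cmp_o[OF g(1)])
lemma cmp_rk: "cmp f \<Longrightarrow> cmp (\<lambda>x. rk (f x))" unfolding rk_def by (intro cmp cmp_o[OF F(1)])

lemma fst_T: "fst (T m) = dm m"
  unfolding g(2)[symmetric] dm_def mat_decode_altdef Let_def by simp

lemma T_eq: "T m = (dm m, proj_of (dm m) (vset_decode (F m)))"
  and on: "orthonormal_set (dm m) (vset_decode (F m))"
  using F(2)[of m] unfolding spans_code_iff g(2) fst_T by (auto simp: prod_eq_iff fst_T)

lemma tau: "tau_val (T m) = real (rk m) / 2 ^ dm m"
  by (subst T_eq) (simp add: tau_val_proj_of[OF on] card_vset_decode rk_def)

lemma tau_nonneg: "0 \<le> tau_val (T m)"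
  by (simp add: tau)

text \<open>The number of \<open>k \<ge> 1\<close> with \<open>nu k \<le> m\<close>.\<close>
definition blk :: "nat \<Rightarrow> nat" where "blk m = (LEAST k. m < nu (Suc k))"

lemma nu_ge: "k \<le> nu k"
proof (induction k)
  case (Suc k) thus ?case using nu(3)[of k "Suc k"] by simp
qed simp

lemma blk_ex: "\<exists>k. m < nu (Suc k)"
  using nu_ge[of "Suc m"] by (intro exI[of _ m]) simp

lemma cmp_blk: "cmp f \<Longrightarrow> cmp (\<lambda>x. blk (f x))"
proof (rule cmp_o[of blk])
  show "cmp blk" unfolding blk_def
    by (rule cmp_Least[OF _ blk_ex]) (intro cmp cmp_o[OF nu(1)])
qed

lemma le_blk_iff: "1 \<le> k \<Longrightarrow> k \<le> blk m \<longleftrightarrow> nu k \<le> m"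
proof
  assume k: "1 \<le> k" "k \<le> blk m"
  then obtain j where j: "k = Suc j" "j < blk m" by (cases k) auto
  show "nu k \<le> m" using not_less_Least[OF j(2)[unfolded blk_def]] j(1) by simp
next
  assume k: "1 \<le> k" "nu k \<le> m"
  have "m < nu (Suc (blk m))" unfolding blk_def by (rule LeastI_ex[OF blk_ex])
  hence "\<not> Suc (blk m) < k" "k \<noteq> Suc (blk m)" using k nu(3)[of "Suc (blk m)" k] by auto
  thus "k \<le> blk m" by simp
qed

text \<open>One factor 2 ^ blk m of 4 ^ blk m shortens the codewords, the other is a reserve that
  controls the tails of the weights. The finitely many m before \<open>nu 1\<close> get no
  codeword.\<close>

definition big :: "nat \<Rightarrow> real" where
  "big m = (if 1 \<le> blk m then 4 ^ blk m * tau_val (T m) else 0)"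

lemma big_nonneg: "0 \<le> big m"
  by (simp add: big_def tau_nonneg)

lemma tail_le:
  "(\<Sum>m<M. if nu k \<le> m then tau_val (T m) else 0) \<le> (1/8) ^ k"
proof (cases "nu k \<le> M")
  case True
  have "(\<Sum>m<M. if nu k \<le> m then tau_val (T m) else 0) = (\<Sum>m\<in>{nu k..<M}. tau_val (T m))"
    by (rule sum.mono_neutral_cong_right) auto
  also have "\<dots> = (\<Sum>m<M. tau_val (T m)) - (\<Sum>m<nu k. tau_val (T m))"
    using True by (simp add: sum_diff_nat_ivl[of 0 "nu k" M, simplified atLeast0LessThan] atLeast0LessThan[symmetric] sum_diff_nat_ivl)
  also have "\<dots> \<le> (\<Sum>m. tau_val (T m)) - (\<Sum>m<nu k. tau_val (T m))"
    using sum_le_suminf[OF sm, of "{..<M}"] tau_nonneg by simp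
  finally show ?thesis using nu(2)[of k] by linarith
next
  case False
  hence "(\<Sum>m<M. if nu k \<le> m then tau_val (T m) else 0) = 0" by (intro sum.neutral) auto
  thus ?thesis by simp
qed

text \<open>Charge m to its own block and enlarge each block to the whole tail from nu k on: the
  blocks then contribute at most 4^k * 8^-k = 2^-k for k = 1, 2, ...\<close>

lemma sum_big: "(\<Sum>m<M. big m) \<le> 1"
proof -
  have "big m \<le> (\<Sum>k\<in>{1..M}. 4 ^ k * (if nu k \<le> m then tau_val (T m) else 0))" if "m < M" for m
  proof (cases "1 \<le> blk m")
    case True
    have k: "nu (blk m) \<le> m" using le_blk_iff[OF True, of m] by simp
    hence "blk m \<le> M" using nu_ge[of "blk m"] that by simp
    hence "blk m \<in> {1..M}" using True by simp
    hence "4 ^ blk m * (if nu (blk m) \<le> m then tau_val (T m) else 0) \<le>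
        (\<Sum>k\<in>{1..M}. 4 ^ k * (if nu k \<le> m then tau_val (T m) else 0))"
      using tau_nonneg by (intro member_le_sum) auto
    thus ?thesis using True k by (simp add: big_def)
  next
    case False
    thus ?thesis using tau_nonneg by (auto simp: big_def intro!: sum_nonneg)
  qed
  hence "(\<Sum>m<M. big m) \<le> (\<Sum>m<M. \<Sum>k\<in>{1..M}. 4 ^ k * (if nu k \<le> m then tau_val (T m) else 0))"
    by (intro sum_mono) simp
  also have "\<dots> = (\<Sum>k\<in>{1..M}. 4 ^ k * (\<Sum>m<M. if nu k \<le> m then tau_val (T m) else 0))"
    by (subst sum.swap) (simp add: sum_distrib_left)
  also have "\<dots> \<le> (\<Sum>k\<in>{1..M}. 4 ^ k * (1/8) ^ k)"
    by (intro sum_mono mult_left_mono tail_le) auto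
  also have "\<dots> = (\<Sum>k\<in>{1..M}. (1/2::real) ^ k)" by (simp flip: power_mult_distrib)
  also have "\<dots> = 1 - (1/2) ^ M" by (induction M) auto
  also have "\<dots> \<le> 1" by simp
  finally show ?thesis .
qed

definition act :: "nat \<Rightarrow> bool" where "act m \<longleftrightarrow> 1 \<le> blk m \<and> 1 \<le> rk m"

text \<open>The least l with 2^-l at most 2 ^ blk m times the normalised trace, so that 2^-l agrees
  with this weight up to a factor 2 when l is positive. The alternative rk m = 0 keeps the search
  total.\<close>

definition len :: "nat \<Rightarrow> nat" where
  "len m = (LEAST l. rk m = 0 \<or> 2 ^ dm m \<le> rk m * 2 ^ (blk m + l))"

lemma len_ex: "\<exists>l. rk m = 0 \<or> 2 ^ dm m \<le> rk m * 2 ^ (blk m + l)"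
proof (cases "rk m = 0")
  case False
  have "1 * 2 ^ dm m \<le> rk m * 2 ^ (blk m + dm m)" using False by (intro mult_le_mono power_increasing) auto
  thus ?thesis by (intro exI[of _ "dm m"]) simp
qed simp

lemma cmp_len: "cmp f \<Longrightarrow> cmp (\<lambda>x. len (f x))"
proof (rule cmp_o[of len])
  show "cmp len" unfolding len_def
    by (rule cmp_Least[OF _ len_ex]) (intro cmp cmp_blk cmp_rk cmp_dm)
qed

lemma dec_act: "cmp f \<Longrightarrow> dec (\<lambda>x. act (f x))"
  unfolding act_def by (intro cmp cmp_blk cmp_rk)

definition wt :: "nat \<Rightarrow> nat \<times> nat" where "wt m = (if act m then (1, 2 ^ len m - 1) else (0, 0))"

lemma cmp_wt: "cmp wt"
  unfolding wt_def by (intro cmp dec_act cmp_len)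

lemma rv_wt: "rv (wt m) = (if act m then (1/2) ^ len m else 0)"
  by (simp add: wt_def rv_def power_one_over)

lemma wt_le: "rv (wt m) \<le> (1/2) ^ blk m * big m"
proof (cases "act m")
  case True
  define r b l n where d: "r = rk m" "b = blk m" "l = len m" "n = dm m"
  have act: "1 \<le> b" "1 \<le> r" using True by (simp_all add: act_def d)
  have "r = 0 \<or> 2 ^ n \<le> r * 2 ^ (b + l)" unfolding d len_def by (rule LeastI_ex[OF len_ex])
  hence "2 ^ n \<le> r * 2 ^ (b + l)" using act by simp
  hence "real (2 ^ n) \<le> real (r * 2 ^ (b + l))" by (simp only: of_nat_le_iff)
  hence "(1/2) ^ l \<le> 2 ^ b * (real r / 2 ^ n)" by (simp add: power_add power_one_over field_simps)
  also have "\<dots> = (1/2) ^ b * (4 ^ b * (real r / 2 ^ n))"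
  proof -
    have "(1/2::real) ^ b * 4 ^ b = 2 ^ b" by (simp flip: power_mult_distrib)
    thus ?thesis by (simp add: mult.assoc[symmetric])
  qed
  finally show ?thesis using True act by (simp add: rv_wt big_def tau d)
next
  case False
  thus ?thesis using big_nonneg by (simp add: rv_wt)
qed

lemma wt_le_big: "rv (wt m) \<le> big m"
  using wt_le[of m] mult_right_mono[OF power_le_one[of "1/2::real" "blk m"] big_nonneg[of m]] by simp

text \<open>Minimality of \<open>len m\<close> will be exploited at its predecessor. If
  \<open>len m\<close> were 0, then 2 ^ blk m times the trace would be at least 1, hence big m at
  least 2, contradicting \<open>sum_big\<close>.\<close>

lemma len_pos:
  assumes "act m"
  shows "1 \<le> len m"
proof (rule ccontr)
  assume "\<not> ?thesis"
  hence "len m = 0" by simp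
  hence "rk m = 0 \<or> 2 ^ dm m \<le> rk m * 2 ^ (blk m + 0)" using LeastI_ex[OF len_ex[of m]] unfolding len_def[symmetric] by simp
  hence "2 ^ dm m \<le> rk m * 2 ^ blk m" using assms by (simp add: act_def)
  hence "real (2 ^ dm m) \<le> real (rk m * 2 ^ blk m)" by (simp only: of_nat_le_iff)
  hence 1: "1 \<le> 2 ^ blk m * tau_val (T m)" by (simp add: tau field_simps)
  have "2 * 1 \<le> 2 ^ blk m * (2 ^ blk m * tau_val (T m))"
  proof (rule mult_mono)
    have "(2::real) ^ 1 \<le> 2 ^ blk m" using assms by (intro power_increasing) (auto simp: act_def)
    thus "(2::real) \<le> 2 ^ blk m" by simp
  qed (use 1 in auto)
  also have "\<dots> = big m"
  proof -
    have "(4::real) ^ blk m = 2 ^ blk m * 2 ^ blk m" by (simp flip: power_mult_distrib)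
    thus ?thesis using assms by (simp add: big_def act_def mult.assoc)
  qed
  also have "\<dots> \<le> (\<Sum>i<Suc m. big i)" by (rule member_le_sum) (auto simp: big_nonneg)
  also have "\<dots> \<le> 1" by (rule sum_big)
  finally show False by simp
qed

text \<open>Shannon-Fano-Elias coding: the codeword of \<open>m\<close> is a dyadic interval of length
  \<open>2 ^ - Suc (len m)\<close> inside the \<open>m\<close>-th of consecutive intervals of lengths \<open>2 ^ - len m\<close>.\<close>
definition pos :: "nat \<Rightarrow> real" where "pos m = (\<Sum>i<m. rv (wt i))"

text \<open>The ceiling of pos m * 2 ^ Suc (len m): adding the denominator minus 1 before dividing
  rounds up. Rounding loses less than 2 ^ - Suc (len m) and the dyadic interval takes as much again,
  which is why one digit more than \<open>len m\<close> is used.\<close>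

definition val :: "nat \<Rightarrow> nat" where
  "val m = (fst (rsum wt m) * 2 ^ Suc (len m) + snd (rsum wt m)) div Suc (snd (rsum wt m))"

definition str :: "nat \<Rightarrow> bool list" where "str m = bits (Suc (len m)) (val m)"

lemma cmp_str: "cmp f \<Longrightarrow> cmp (\<lambda>x. bl_encode (str (f x)))"
  by (rule cmp_o[of "\<lambda>m. bl_encode (str m)"])
    (unfold str_def val_def, intro cmp cmp_bl_encode_bits cmp_len cmp_rsum[OF cmp_wt])

lemma pos_mono: "i \<le> j \<Longrightarrow> pos i \<le> pos j"
  unfolding pos_def by (rule sum_mono2) (auto simp: rv_nonneg)

lemma pos_le_1: "pos m \<le> 1"
  unfolding pos_def using sum_mono[of "{..<m}" "\<lambda>i. rv (wt i)" big] wt_le_big sum_big[of m] by (meson order_trans)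

lemma val_bounds: "pos m \<le> real (val m) / 2 ^ Suc (len m)" "(real (val m) + 1) / 2 ^ Suc (len m) < pos m + (1/2) ^ len m"
proof -
  define A B E where d: "A = fst (rsum wt m)" "B = snd (rsum wt m)" "E = (2::nat) ^ Suc (len m)"
  have E: "0 < E" by (simp add: d)
  have p: "pos m = real A / real (Suc B)" unfolding pos_def rv_rsum[symmetric] by (simp add: rv_def d)
  have v: "val m = (A * E + B) div Suc B" by (simp add: val_def d)
  have dv: "val m * Suc B + (A * E + B) mod Suc B = A * E + B" unfolding v by (rule div_mult_mod_eq)
  have "(A * E + B) mod Suc B \<le> B" using mod_less_divisor[of "Suc B" "A * E + B"] by simp
  hence "A * E \<le> val m * Suc B" and u: "val m * Suc B \<le> A * E + B" using dv by linarith+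
  hence "real (A * E) \<le> real (val m * Suc B)" by (simp only: of_nat_le_iff)
  hence l: "real A * real E \<le> real (val m) * real (Suc B)" by (simp only: of_nat_mult)
  have "val m * Suc B < A * E + Suc B" using u by linarith
  hence "real (val m * Suc B) < real (A * E + Suc B)" by (simp only: of_nat_less_iff)
  hence u: "real (val m) * real (Suc B) < real A * real E + real (Suc B)" by (simp only: of_nat_mult of_nat_add)
  have E': "(2::real) ^ Suc (len m) = real E" by (simp add: d)
  have h: "(1/2::real) ^ len m = 2 / real E" by (simp add: d power_one_over)
  define S where "S = real (Suc B)"
  have S: "0 < S" by (simp add: S_def)
  show "pos m \<le> real (val m) / 2 ^ Suc (len m)"
    unfolding p E' using l E S unfolding S_def[symmetric] by (simp add: field_simps)
  show "(real (val m) + 1) / 2 ^ Suc (len m) < pos m + (1/2) ^ len m"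
    unfolding p E' h S_def[symmetric]
  proof -
    have "real (val m) < (real A * real E + S) / S" using u S by (simp add: pos_less_divide_eq S_def)
    also have "\<dots> = real A / S * real E + 1" using S by (simp add: add_divide_distrib)
    finally have "(real (val m) + 1) / real E < (real A / S * real E + 2) / real E"
      using E by (intro divide_strict_right_mono) auto
    also have "\<dots> = real A / S + 2 / real E" using E by (simp add: add_divide_distrib)
    finally show "(real (val m) + 1) / real E < real A / S + 2 / real E" .
  qed
qed

lemma pos_Suc: "act m \<Longrightarrow> pos (Suc m) = pos m + (1/2) ^ len m"
  by (simp add: pos_def rv_wt)

lemma val_less: "act m \<Longrightarrow> val m < 2 ^ Suc (len m)"
proof -
  assume "act m"
  hence "(real (val m) + 1) / 2 ^ Suc (len m) < 1"
    using val_bounds(2)[of m] pos_Suc[of m] pos_le_1[of "Suc m"] by linarith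
  hence "real (val m) < real (2 ^ Suc (len m))" by (simp add: field_simps)
  thus ?thesis by (simp only: of_nat_less_iff)
qed

text \<open>A prefix would put the left end of the second dyadic interval into the first one, while
  different active indices occupy disjoint intervals.\<close>

lemma str_prefix_free:
  assumes "act m" "act m'" "prefix (str m) (str m')"
  shows "m = m'"
proof -
  note p = prefix_bits[OF assms(3)[unfolded str_def] val_less[OF assms(1)] val_less[OF assms(2)]]
  show ?thesis
  proof (cases m m' rule: linorder_cases)
    case less
    have "(real (val m) + 1) / 2 ^ Suc (len m) < pos (Suc m)" using val_bounds(2)[of m] pos_Suc[OF assms(1)] by simp
    also have "\<dots> \<le> pos m'" using less by (intro pos_mono) simp
    also have "\<dots> \<le> real (val m') / 2 ^ Suc (len m')" by (rule val_bounds(1))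
    finally show ?thesis using p(3) by simp
  next
    case greater
    have "real (val m') / 2 ^ Suc (len m') \<le> (real (val m') + 1) / 2 ^ Suc (len m')" by (intro divide_right_mono) auto
    also have "\<dots> < pos (Suc m')" using val_bounds(2)[of m'] pos_Suc[OF assms(2)] by simp
    also have "\<dots> \<le> pos m" using greater by (intro pos_mono) simp
    also have "\<dots> \<le> real (val m) / 2 ^ Suc (len m)" by (rule val_bounds(1))
    finally show ?thesis using p(2) by simp
  qed
qed

section \<open>The machine and its measure\<close>

definition machine :: "bool list \<Rightarrow> nat option" where
  "machine \<pi> = (if \<exists>m. act m \<and> str m = \<pi> then Some (F (THE m. act m \<and> str m = \<pi>)) else None)"

lemma machine_Some_iff: "machine \<pi> = Some y \<longleftrightarrow> (\<exists>m. act m \<and> str m = \<pi> \<and> y = F m)"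
proof -
  have "(THE m. act m \<and> str m = \<pi>) = m" if "act m" "str m = \<pi>" for m
    by (rule the_equality) (use that in \<open>auto intro: str_prefix_free\<close>)
  thus ?thesis unfolding machine_def by auto
qed

lemma dom_machine: "dom machine = str ` {m. act m}"
  by (auto simp: machine_Some_iff)

lemma str_inj: "inj_on str {m. act m}"
  by (rule inj_onI) (use str_prefix_free in auto)

lemma prefix_free_machine: "prefix_free_machine machine"
  unfolding prefix_free_machine_def
proof (intro conjI ballI impI)
  have "dec (\<lambda>e. act (snd e) \<and> bl_encode (str (snd e)) = (fst e :: nat))"
    by (intro cmp dec_act cmp_str)
  \<comment> \<open>The search stops at the least active index with the given codeword;
    prefix-freeness makes it the only one, so it agrees with \<open>machine\<close>.\<close>
  then obtain r where r: "\<And>x y. reval r [x] y \<longleftrightarrow> (\<exists>m. (act m \<and> bl_encode (str m) = x) \<and>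
      (\<forall>m'<m. \<not> (act m' \<and> bl_encode (str m') = x)) \<and> y = F m)"
    using recf_search[of "\<lambda>x m. act m \<and> bl_encode (str m) = x" F] F(1) by blast
  have "machine \<pi> = Some y \<longleftrightarrow> reval r [bl_encode \<pi>] y" for \<pi> y
  proof -
    have eq: "act m \<and> bl_encode (str m) = bl_encode \<pi> \<longleftrightarrow> act m \<and> str m = \<pi>" for m
      using bl_encode_inj by auto
    have "\<not> (act m' \<and> str m' = \<pi>)" if "act m" "str m = \<pi>" "m' < m" for m m'
      using that str_prefix_free[of m m'] by auto
    thus ?thesis unfolding machine_Some_iff r eq by blast
  qed
  thus "\<exists>f. \<forall>\<pi> y. machine \<pi> = Some y \<longleftrightarrow> reval f [bl_encode \<pi>] y" by blast
next
  fix \<pi> \<sigma> assume "\<pi> \<in> dom machine" "\<sigma> \<in> dom machine" "prefix \<pi> \<sigma>"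
  thus "\<pi> = \<sigma>" unfolding dom_machine using str_prefix_free by auto
qed

text \<open>The weight of the codeword itself, which is half of wt m because of its additional
  digit.\<close>

definition mwt :: "nat \<Rightarrow> nat \<times> nat" where "mwt m = (if act m then (1, 2 ^ Suc (len m) - 1) else (0, 0))"

lemma cmp_mwt: "cmp mwt"
  unfolding mwt_def by (intro cmp dec_act cmp_len)

lemma rv_mwt: "rv (mwt m) = (if act m then (1/2) ^ Suc (len m) else 0)"
  by (simp add: mwt_def rv_def power_one_over)

lemma mwt_le_wt: "rv (mwt m) \<le> rv (wt m)"
  by (simp add: rv_mwt rv_wt)

lemma summable_mwt: "summable (\<lambda>m. rv (mwt m))"
proof (rule summableI_nonneg_bounded)
  show "(\<Sum>i<n. rv (mwt i)) \<le> 1" for n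
    using sum_mono[of "{..<n}" "\<lambda>i. rv (mwt i)" "\<lambda>i. rv (wt i)"] mwt_le_wt pos_le_1[of n]
    unfolding pos_def by (meson order_trans)
qed (rule rv_nonneg)

lemma measure_machine: "machine_measure machine = (\<Sum>m. rv (mwt m))"
proof -
  have "((\<lambda>\<pi>. (1/2::real) ^ length \<pi>) has_sum machine_measure machine) (str ` {m. act m})"
    unfolding machine_measure_def dom_machine[symmetric]
    by (rule has_sum_infsum[OF prefix_free_summable])
      (use prefix_free_machine in \<open>unfold prefix_free_machine_def, blast\<close>)
  hence "(((\<lambda>\<pi>. (1/2::real) ^ length \<pi>) \<circ> str) has_sum machine_measure machine) {m. act m}"
    by (rule iffD1[OF has_sum_reindex[OF str_inj]])
  moreover have "(((\<lambda>\<pi>. (1/2::real) ^ length \<pi>) \<circ> str) has_sum machine_measure machine) {m. act m} \<longleftrightarrow>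
      ((\<lambda>m. rv (mwt m)) has_sum machine_measure machine) UNIV"
    by (rule has_sum_cong_neutral) (auto simp: rv_mwt str_def)
  ultimately have "(\<lambda>m. rv (mwt m)) sums machine_measure machine" using has_sum_imp_sums by blast
  thus ?thesis by (simp add: sums_iff)
qed

lemma computable_measure_machine: "computable_measure_machine machine"
  unfolding computable_measure_machine_def measure_machine
proof (intro conjI prefix_free_machine)
  have "cmp (\<lambda>k. nu (Suc k))" by (intro cmp cmp_o[OF nu(1)])
  thus "computable_real (\<Sum>m. rv (mwt m))"
  proof (rule computable_suminf[OF cmp_mwt _ summable_mwt])
    fix k
    let ?N = "nu (Suc k)"
    have "(\<Sum>i<n. rv (mwt i)) \<le> (\<Sum>i<?N. rv (mwt i)) + (1/2) ^ k" for n
    proof -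
      have "(\<Sum>i<n. rv (mwt i)) \<le> (\<Sum>i<max n ?N. rv (mwt i))"
        by (rule sum_mono2) (auto simp: rv_nonneg)
      also have "\<dots> = (\<Sum>i<?N. rv (mwt i)) + (\<Sum>i\<in>{?N..<max n ?N}. rv (mwt i))"
        by (subst sum.union_disjoint[symmetric]) (auto intro!: sum.cong)
      \<comment> \<open>Here the reserve is spent: from nu (Suc k) on, every index lies in a block
        beyond k, which leaves a factor 2^-k against big, and big sums to at most 1.\<close>
      also have "(\<Sum>i\<in>{?N..<max n ?N}. rv (mwt i)) \<le> (\<Sum>i\<in>{?N..<max n ?N}. (1/2) ^ k * big i)"
      proof (rule sum_mono)
        fix i assume "i \<in> {?N..<max n ?N}"
        hence "Suc k \<le> blk i" using le_blk_iff[of "Suc k" i] by simp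
        hence "(1/2::real) ^ blk i \<le> (1/2) ^ k" by (intro power_decreasing) auto
        hence "(1/2) ^ blk i * big i \<le> (1/2) ^ k * big i" by (intro mult_right_mono big_nonneg)
        thus "rv (mwt i) \<le> (1/2) ^ k * big i" using mwt_le_wt[of i] wt_le[of i] by linarith
      qed
      also have "\<dots> \<le> (1/2) ^ k * (\<Sum>i<max n ?N. big i)"
        unfolding sum_distrib_left[symmetric] by (intro mult_left_mono sum_mono2) (auto simp: big_nonneg)
      also have "\<dots> \<le> (1/2) ^ k * 1" by (intro mult_left_mono sum_big) auto
      finally show ?thesis by simp
    qed
    hence "(\<Sum>i. rv (mwt i)) \<le> (\<Sum>i<?N. rv (mwt i)) + (1/2) ^ k" by (intro suminf_le_const[OF summable_mwt])
    thus "(\<Sum>i. rv (mwt i)) - (\<Sum>i<?N. rv (mwt i)) \<le> (1/2) ^ k" by simp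
  qed
qed

lemma QK_low:
  assumes st: "is_state \<rho>" and e: "0 < \<epsilon>" and m: "\<epsilon> < rho_val \<rho> (T m)" and k: "1 \<le> k" "nu k \<le> m"
  shows "QK machine \<epsilon> (dm m) (\<rho> (dm m)) \<le> ereal (real (dm m) - real k + 2)"
proof -
  have dmat: "\<rho> (dm m) \<in> carrier_mat (2^dm m) (2^dm m)" using st by (simp add: is_state_def density_matrix_def)
  have rho: "\<epsilon> < (\<Sum>v\<in>vset_decode (F m). Re ((\<rho> (dm m) *\<^sub>v v) \<bullet>c v))"
    using m rho_val_proj_of[of "dm m" _ \<rho>, OF on dmat] by (simp add: T_eq)
  hence "vset_decode (F m) \<noteq> {}" using e by auto
  hence rk: "1 \<le> rk m" unfolding rk_def card_vset_decode[symmetric]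
    using finite_vset_decode by (simp add: Suc_le_eq card_gt_0_iff)
  have bk: "k \<le> blk m" using le_blk_iff[OF k(1)] k(2) by simp
  have act: "act m" using rk bk k(1) by (simp add: act_def)
  \<comment> \<open>Failure at l = len m - 1 gives log rk + blk + len - 1 < n. The codeword has len
    + 1 digits, whence the 2 in the bound.\<close>
  obtain l where l: "len m = Suc l" using len_pos[OF act] by (cases "len m") auto
  have "l < len m" by (simp add: l)
  hence "\<not> (rk m = 0 \<or> 2 ^ dm m \<le> rk m * 2 ^ (blk m + l))"
    using not_less_Least[of l "\<lambda>l. rk m = 0 \<or> 2 ^ dm m \<le> rk m * 2 ^ (blk m + l)"] unfolding len_def by blast
  hence "rk m * 2 ^ (blk m + l) < 2 ^ dm m" by simp
  hence "real (rk m * 2 ^ (blk m + l)) < real (2 ^ dm m)" by (simp only: of_nat_less_iff)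
  hence "log 2 (real (rk m) * 2 ^ (blk m + l)) < log 2 (2 ^ dm m)"
    using rk by (subst log_less_cancel_iff) auto
  hence lg: "log 2 (real (rk m)) + real (blk m + l) < real (dm m)"
    using rk by (simp add: log_mult log_nat_power)
  have "QK machine \<epsilon> (dm m) (\<rho> (dm m)) \<le>
      ereal (real (length (str m)) + log 2 (real (card (vset_decode (F m)))))"
    unfolding QK_def
  proof (rule Inf_lower, rule CollectI, intro exI conjI)
    show "machine (str m) = Some (F m)" using act by (auto simp: machine_Some_iff)
    show "\<forall>v\<in>vset_decode (F m). \<forall>i<dim_vec v. algebraic (v $ i)" using algebraic_vset_decode by blast
  qed (use on rho in auto)
  also have "\<dots> \<le> ereal (real (dm m) - real k + 2)"
    using lg bk by (simp add: str_def card_vset_decode rk_def[symmetric] l)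
  finally show ?thesis .
qed

end

lemma QK_bound_imp_random:
  assumes st: "is_state \<rho>"
    and bound: "\<And>C \<epsilon>. computable_measure_machine C \<Longrightarrow> 0 < \<epsilon> \<Longrightarrow> \<exists>d>0. \<forall>n. QK C \<epsilon> n (\<rho> n) > ereal (real n - d)"
  shows "quantum_schnorr_random \<rho>"
  unfolding quantum_schnorr_random_def passes_def
proof (intro allI impI notI)
  fix T assume T: "quantum_schnorr_test T" and "\<exists>\<epsilon>>0. fails_at \<rho> T \<epsilon>"
  then obtain \<epsilon> where e: "0 < \<epsilon>" "fails_at \<rho> T \<epsilon>" by blast
  obtain g where g: "computable g" "\<And>m. mat_decode (g m) = T m"
    and sp: "\<And>m. special_projection (fst (T m)) (snd (T m))"
    and sm: "summable (\<lambda>m. tau_val (T m))" and cr: "computable_real (\<Sum>m. tau_val (T m))"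
    using T unfolding quantum_schnorr_test_def strong_solovay_test_def by blast
  have cg: "cmp g" using g(1) by (simp add: cmp_nat_iff)
  have "sig (\<lambda>e. spans_code (g (fst e)) (snd e))" by (intro sig_dec cmp cmp_o[OF cg])
  moreover have "\<exists>c. spans_code (g m) c" for m using sp[of m] by (intro ex_spans_code) (simp add: g(2))
  ultimately obtain F where F: "cmp F" "\<And>m. spans_code (g m) (F m)"
    using sig_select[of "\<lambda>m. spans_code (g m)"] by blast
  \<comment> \<open>The normalised traces as explicit rationals, so that the modulus of convergence
    can be computed from them.\<close>
  define q where "q = (\<lambda>m. (length (set_reps (F m)), 2 ^ fst (dcd (g m) :: nat \<times> nat list) - 1 :: nat))"
  have cq: "cmp q" unfolding q_def by (intro cmp cmp_o[OF F(1)] cmp_o[OF cg])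
  have tq: "tau_val (T m) = rv (q m)" for m
  proof -
    have 1: "fst (T m) = fst (dcd (g m) :: nat \<times> nat list)"
      unfolding g(2)[symmetric] mat_decode_altdef Let_def by simp
    have 2: "orthonormal_set (fst (T m)) (vset_decode (F m))" "snd (T m) = proj_of (fst (T m)) (vset_decode (F m))"
      using F(2)[of m] unfolding spans_code_iff g(2) by auto
    have "T m = (fst (T m), proj_of (fst (T m)) (vset_decode (F m)))" using 2(2) by (simp add: prod_eq_iff)
    hence "tau_val (T m) = real (card (vset_decode (F m))) / 2 ^ fst (T m)"
      using tau_val_proj_of[OF 2(1)] by metis
    thus ?thesis by (simp add: rv_def q_def 1 card_vset_decode)
  qed
  obtain nu0 where nu0: "cmp nu0" "\<forall>k. (\<Sum>i. rv (q i)) - (\<Sum>i<nu0 k. rv (q i)) \<le> (1/2) ^ k"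
    using computable_tail[OF cq] sm cr unfolding tq by blast
  \<comment> \<open>Precision 3 * k because (1/2)^(3k) = 8^-k. Summing over all j up to k and adding
    k makes the boundaries strictly increasing without falling below
    \<open>nu0 (3 * k)\<close>.\<close>
  define nu where "nu = (\<lambda>k. k + sum_list (map (\<lambda>j. nu0 (3 * j)) [0..<Suc k]))"
  have "cmp nu" unfolding nu_def by (intro cmp cmp_o[OF nu0(1)])
  interpret effective_test T g F nu
  proof
    fix k
    have "nu0 (3 * k) \<le> nu k" by (simp add: nu_def)
    hence "(\<Sum>i<nu0 (3 * k). rv (q i)) \<le> (\<Sum>i<nu k. rv (q i))" by (intro sum_mono2) (auto simp: rv_nonneg)
    moreover have "(1/2::real) ^ (3 * k) = (1/8) ^ k" by (simp add: power_mult power3_eq_cube)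
    ultimately show "(\<Sum>m. tau_val (T m)) - (\<Sum>m<nu k. tau_val (T m)) \<le> (1/8) ^ k"
      using nu0(2)[rule_format, of "3 * k"] unfolding tq by linarith
  next
    have "nu k < nu (Suc k)" for k by (simp add: nu_def)
    thus "i < j \<Longrightarrow> nu i < nu j" for i j by (rule lift_Suc_mono_less)
  qed (use cg g(2) F sm \<open>cmp nu\<close> in auto)
  obtain d where d: "0 < d" "\<And>n. QK machine \<epsilon> n (\<rho> n) > ereal (real n - d)"
    using bound[OF computable_measure_machine e(1)] by blast
  \<comment> \<open>Beyond block k the complexity is at most n - k + 2, which for k > d + 2
    contradicts the assumed bound n - d.\<close>
  obtain k :: nat where k: "d + 2 < real k" using reals_Archimedean2[of "d + 2"] by blast
  have k1: "1 \<le> k" using k d(1) by (cases k) auto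
  obtain m where m: "nu k \<le> m" "\<epsilon> < rho_val \<rho> (T m)"
    using e(2) unfolding fails_at_def INFM_nat_le by blast
  have "ereal (real (dm m) - d) < ereal (real (dm m) - real k + 2)"
    using d(2)[of "dm m"] QK_low[OF st e(1) m(2) k1 m(1)] by (rule less_le_trans)
  thus False using k by simp
qed

theorem mainTheorem15:
  fixes \<rho> :: "nat \<Rightarrow> complex mat"
  assumes "is_state \<rho>"
  shows "quantum_schnorr_random \<rho> \<longleftrightarrow>
    (\<forall>C. computable_measure_machine C \<longrightarrow>
       (\<forall>\<epsilon>>0. \<exists>d>0. \<forall>n. QK C \<epsilon> n (\<rho> n) > ereal (real n - d)))"
proof
  assume "quantum_schnorr_random \<rho>"
  thus "\<forall>C. computable_measure_machine C \<longrightarrow> (\<forall>\<epsilon>>0. \<exists>d>0. \<forall>n. QK C \<epsilon> n (\<rho> n) > ereal (real n - d))"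
    by (intro allI impI random_imp_QK_bound[OF assms])
next
  assume bound: "\<forall>C. computable_measure_machine C \<longrightarrow> (\<forall>\<epsilon>>0. \<exists>d>0. \<forall>n. QK C \<epsilon> n (\<rho> n) > ereal (real n - d))"
  show "quantum_schnorr_random \<rho>"
    by (rule QK_bound_imp_random[OF assms]) (rule bound[rule_format])
qed

end
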